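(* (Induction-Convolution Lemma.) Let $B$ be a basis of $F_r$, $G$ a finite group, $\vec w=\{w_1,\dots,w_k\}$ a multi-word, $\zeta$ a function assigning to each $w_j$ a class function $\zeta_j:G\to\mathbb C$, and $n\ge1$. Then, as functions on $\mathcal Q_B(\vec w)$, $$\mathbb E[\mathrm{Ind}\,\zeta]=\mathbb E[\zeta]\underset{B}{*}\mu_B\underset{B}{*}\mathbb E[\mathrm{Ind}\,\mathbf 1],$$ where $\mathbb E[\zeta]$ and $\mathbb E[\mathrm{Ind}\,\zeta]$ are the functions $\eta\mapsto\mathbb E_\eta[\zeta]$ (computed with the group $G$) and $\eta\mapsto\mathbb E_\eta[\mathrm{Ind}\,\zeta]$ (computed with the group $G\wr S_n$), and $\mathbb E[\mathrm{Ind}\,\mathbf 1]$ is the function $\eta\mapsto\mathbb E_\eta[S_n\curvearrowright[n]]$ on $\mathrm{sur}_B$.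
   Context: Multi core graphs. Fix a basis $B$ of the free group $F_r$. A ($B$-labelled) multi core graph is a finite graph, possibly disconnected or empty, possibly with loops and multiple edges, in which every vertex has degree at least $2$ (a loop contributes $2$), whose edges are directed and labelled by elements of $B$ so that for every vertex $v$ and $b\in B$ there is at most one outgoing and at most one incoming $b$-edge at $v$. A morphism is a graph morphism preserving directions and labels; it is $B$-surjective if it is surjective on vertices and edges. For a vertex $p$ of a component $\Delta'$, $\pi_1^{\mathrm{lab}}(\Delta',p)\le F_r$ is the subgroup of words read along closed paths at $p$. Multi-words. A multi-word $\vec w=\{w_1,\dots,w_k\}$ is a finite multiset of (conjugacy classes of) non-trivial elements of $F_r$; $\Gamma_B(\vec w)$ is the disjoint union of oriented cycles $\Gamma_B(w_j)$, where going once around $\Gamma_B(w_j)$ in its orientation reads the cyclic reduction of $w_j$. A morphism $\vec w\to\Delta$ is a morphism $\Gamma_B(\vec w)\to\Delta$. Expectations. Let $K$ be a finite group, $\xi$ an assignment of a class function $\xi_j:K\to\mathbb C$ to each $w_j$, and $\eta:\vec w\to\Delta$ a morphism. Let $\Delta_1,\dots,\Delta_\ell$ be the components of $\Delta$, $p_i$ a vertex of $\Delta_i$, $J_i=\pi_1^{\mathrm{lab}}(\Delta_i,p_i)$. If $\eta(\Gamma_B(w_j))\subseteq\Delta_i$ (write $f(j)=i$), the image of the oriented cycle of $w_j$ is a closed path in $\Delta_i$, which determines a conjugacy class of $J_i$; let $w_j'\in J_i$ be a representative. Then $$\mathbb E_\eta[\xi]=\prod_{i=1}^\ell\mathbb E_{\alpha_i}\Big[\prod_{j:f(j)=i}\xi_j(\alpha_i(w_j'))\Big],\qquad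 \alpha_i\in\mathrm{Hom}(J_i,K)\text{ uniform}.$$ For an arbitrary morphism $\eta:\Gamma\to\Delta$ of multi core graphs, $\mathbb E_\eta[S_n\curvearrowright[n]]=\prod_i\mathbb E_{\alpha_i}\big[\prod_{\Gamma'}\#\{\text{common fixed points in }[n]\text{ of }\alpha_i(H_{\Gamma'})\}\big]$, where $\alpha_i\in\mathrm{Hom}(J_i,S_n)$ is uniform, $\Gamma'$ runs over the components of $\Gamma$ mapped into $\Delta_i$, and $H_{\Gamma'}\le J_i$ is the subgroup (defined up to conjugation in $J_i$) of loops of $\Delta_i$ that are images of closed paths in $\Gamma'$. Induction. $G\wr S_n=G^n\rtimes S_n$ with product $(v_1,\sigma_1)(v_2,\sigma_2)=(v_1\cdot(\sigma_1.v_2),\sigma_1\sigma_2)$, $(\sigma.v)(i)=v(\sigma^{-1}(i))$. For a class function $\phi$ on $G$, $\mathrm{Ind}\,\phi$ is the class function on $G\wr S_n$ given by $(\mathrm{Ind}\,\phi)(v,\sigma)=\sum_{i:\sigma(i)=i}\phi(v(i))$. $\mathrm{Ind}\,\zeta$ assigns $\mathrm{Ind}(\zeta_j)$ to $w_j$. Convolution. $\mathrm{sur}_B$ is the collection of all $B$-surjective morphisms of multi core graphs, $\eta:\Gamma\to\Delta$ and $\eta':\Gamma'\to\Delta'$ being identified if there are isomorphisms $\Gamma\cong\Gamma'$, $\Delta\cong\Delta'$ commuting with $\eta,\eta'$. $\mathcal Q_B(\vec w)$ is the set of $B$-surjective morphisms with domain $\Gamma_B(\vec w)$ (the words $w_j$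 and their orientations being remembered), up to isomorphism of the codomain. For $B$-surjective $\eta$, $\mathrm{Decomp}_B(\eta)$ is the finite set of pairs $(\eta_1,\eta_2)$ of $B$-surjective morphisms with $\eta=\eta_2\circ\eta_1$, up to isomorphism of the intermediate graph commuting with the maps. The convolution is $(f\underset{B}{*}g)(\eta)=\sum_{(\eta_1,\eta_2)\in\mathrm{Decomp}_B(\eta)}f(\eta_1)g(\eta_2)$, for $f$ a function on $\mathrm{sur}_B$ or on $\mathcal Q_B(\vec w)$ and $g$ a function on $\mathrm{sur}_B$. Its identity on $\mathbb C^{\mathrm{sur}_B}$ is the function equal to $1$ on isomorphisms and $0$ elsewhere; $\mu_B$ is the convolution inverse in $\mathbb C^{\mathrm{sur}_B}$ of the constant function $1$. *)

theory Defs
  imports Complex_Main "HOL-Algebra.Sym_Groups"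
begin

section \<open>Words in a basis of a free group\<close>

text \<open>The letter \<open>(b, True)\<close> stands for \<open>b\<close>, the letter \<open>(b, False)\<close> for \<open>b\<^sup>-\<^sup>1\<close>.\<close>

type_synonym 'f letter = "'f \<times> bool"

definition flip :: "'f letter \<Rightarrow> 'f letter" where
  "flip l = (fst l, \<not> snd l)"

definition inv_word :: "'f letter list \<Rightarrow> 'f letter list" where
  "inv_word xs = rev (map flip xs)"

primrec eval_word :: "('f, 'm) monoid_scheme \<Rightarrow> 'f letter list \<Rightarrow> 'f" where
  "eval_word F [] = \<one>\<^bsub>F\<^esub>"
| "eval_word F (l # xs) = (if snd l then fst l else inv\<^bsub>F\<^esub> (fst l)) \<otimes>\<^bsub>F\<^esub> eval_word F xs"

definition reduced :: "'f letter list \<Rightarrow> bool" where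
  "reduced xs \<longleftrightarrow> successively (\<lambda>x y. y \<noteq> flip x) xs"

definition reduced_words :: "'f set \<Rightarrow> 'f letter list set" where
  "reduced_words B = {xs. fst ` set xs \<subseteq> B \<and> reduced xs}"

text \<open>\<open>F\<close> is free with basis \<open>B\<close>. (The universal property would quantify over groups of all
  types, which cannot be written inside a formula.)\<close>

definition free_basis :: "('f, 'm) monoid_scheme \<Rightarrow> 'f set \<Rightarrow> bool" where
  "free_basis F B \<longleftrightarrow> group F \<and> B \<subseteq> carrier F \<and>
     (\<forall>g \<in> carrier F. \<exists>!xs. xs \<in> reduced_words B \<and> eval_word F xs = g)"

definition reduced_form :: "('f, 'm) monoid_scheme \<Rightarrow> 'f set \<Rightarrow> 'f \<Rightarrow> 'f letter list" where
  "reduced_form F B g = (THE xs. xs \<in> reduced_words B \<and> eval_word F xs = g)"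

fun strip_ends :: "'f letter list \<Rightarrow> 'f letter list" where
  "strip_ends xs =
     (if xs \<noteq> [] \<and> last xs = flip (hd xs) then strip_ends (butlast (tl xs)) else xs)"

declare strip_ends.simps [simp del]

definition cyclic_reduction :: "('f, 'm) monoid_scheme \<Rightarrow> 'f set \<Rightarrow> 'f \<Rightarrow> 'f letter list" where
  "cyclic_reduction F B g = strip_ends (reduced_form F B g)"


section \<open>Multi core graphs\<close>

text \<open>An edge is a triple (origin, label, terminus). In a graph in which every vertex has at most
  one outgoing edge with a given label, an edge is determined by this triple, so no graph is lost;
  loops and multiple edges with different labels are possible. All graphs have their vertices in
  one fixed infinite type, which contains a copy of every finite graph.\<close>

type_synonym vertex = "nat \<times> nat"

record 'f lgraph =
  gverts :: "vertex set"
  gedges :: "(vertex \<times> 'f \<times> vertex) set"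

definition multi_core_graph :: "'f set \<Rightarrow> 'f lgraph \<Rightarrow> bool" where
  "multi_core_graph B \<Gamma> \<longleftrightarrow>
     finite (gverts \<Gamma>) \<and> finite (gedges \<Gamma>) \<and>
     gedges \<Gamma> \<subseteq> gverts \<Gamma> \<times> B \<times> gverts \<Gamma> \<and>
     (\<forall>v b u u'. (v, b, u) \<in> gedges \<Gamma> \<longrightarrow> (v, b, u') \<in> gedges \<Gamma> \<longrightarrow> u = u') \<and>
     (\<forall>v b u u'. (u, b, v) \<in> gedges \<Gamma> \<longrightarrow> (u', b, v) \<in> gedges \<Gamma> \<longrightarrow> u = u') \<and>
     (\<forall>v \<in> gverts \<Gamma>.
        card {e \<in> gedges \<Gamma>. fst e = v} + card {e \<in> gedges \<Gamma>. snd (snd e) = v} \<ge> 2)"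

definition emap :: "(vertex \<Rightarrow> vertex) \<Rightarrow> vertex \<times> 'f \<times> vertex \<Rightarrow> vertex \<times> 'f \<times> vertex" where
  "emap h e = (h (fst e), fst (snd e), h (snd (snd e)))"

text \<open>The action of a morphism on edges is forced by its action on vertices. Only the values of
  \<open>gmap\<close> on the vertices of the domain matter.\<close>

record 'f gmor =
  gdom :: "'f lgraph"
  gcod :: "'f lgraph"
  gmap :: "vertex \<Rightarrow> vertex"

definition morphism :: "'f set \<Rightarrow> 'f gmor \<Rightarrow> bool" where
  "morphism B \<eta> \<longleftrightarrow>
     multi_core_graph B (gdom \<eta>) \<and> multi_core_graph B (gcod \<eta>) \<and>
     gmap \<eta> ` gverts (gdom \<eta>) \<subseteq> gverts (gcod \<eta>) \<and>
     emap (gmap \<eta>) ` gedges (gdom \<eta>) \<subseteq> gedges (gcod \<eta>)"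

definition sur :: "'f set \<Rightarrow> 'f gmor set" where
  "sur B = {\<eta>. morphism B \<eta> \<and>
     gmap \<eta> ` gverts (gdom \<eta>) = gverts (gcod \<eta>) \<and>
     emap (gmap \<eta>) ` gedges (gdom \<eta>) = gedges (gcod \<eta>)}"

definition graph_iso :: "'f lgraph \<Rightarrow> 'f lgraph \<Rightarrow> (vertex \<Rightarrow> vertex) \<Rightarrow> bool" where
  "graph_iso \<Gamma> \<Delta> h \<longleftrightarrow>
     bij_betw h (gverts \<Gamma>) (gverts \<Delta>) \<and> bij_betw (emap h) (gedges \<Gamma>) (gedges \<Delta>)"

definition mor_iso :: "'f gmor \<Rightarrow> 'f gmor \<Rightarrow> bool" where
  "mor_iso \<eta> \<eta>' \<longleftrightarrow> (\<exists>\<phi> \<psi>. graph_iso (gdom \<eta>) (gdom \<eta>') \<phi> \<and> graph_iso (gcod \<eta>) (gcod \<eta>') \<psi> \<and>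
     (\<forall>v \<in> gverts (gdom \<eta>). \<psi> (gmap \<eta> v) = gmap \<eta>' (\<phi> v)))"


section \<open>Convolution\<close>

definition decomp_pairs :: "'f set \<Rightarrow> 'f gmor \<Rightarrow> ('f gmor \<times> 'f gmor) set" where
  "decomp_pairs B \<eta> = {(\<eta>1, \<eta>2). \<eta>1 \<in> sur B \<and> \<eta>2 \<in> sur B \<and>
     gdom \<eta>1 = gdom \<eta> \<and> gcod \<eta>1 = gdom \<eta>2 \<and> gcod \<eta>2 = gcod \<eta> \<and>
     (\<forall>v \<in> gverts (gdom \<eta>). gmap \<eta> v = gmap \<eta>2 (gmap \<eta>1 v))}"

definition decomp_rel ::
  "'f set \<Rightarrow> 'f gmor \<Rightarrow> (('f gmor \<times> 'f gmor) \<times> ('f gmor \<times> 'f gmor)) set" where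
  "decomp_rel B \<eta> = {((\<eta>1, \<eta>2), (\<eta>1', \<eta>2')).
     (\<eta>1, \<eta>2) \<in> decomp_pairs B \<eta> \<and> (\<eta>1', \<eta>2') \<in> decomp_pairs B \<eta> \<and>
     (\<exists>\<phi>. graph_iso (gcod \<eta>1) (gcod \<eta>1') \<phi> \<and>
        (\<forall>v \<in> gverts (gdom \<eta>). \<phi> (gmap \<eta>1 v) = gmap \<eta>1' v) \<and>
        (\<forall>u \<in> gverts (gcod \<eta>1). gmap \<eta>2 u = gmap \<eta>2' (\<phi> u)))}"

definition Decomp :: "'f set \<Rightarrow> 'f gmor \<Rightarrow> ('f gmor \<times> 'f gmor) set set" where
  "Decomp B \<eta> = decomp_pairs B \<eta> // decomp_rel B \<eta>"

text \<open>For functions that respect isomorphism the summand does not depend on the chosen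
  representative of the class \<open>D\<close>. In the first argument only morphisms with the same domain as
  \<open>\<eta>\<close> occur, and different representatives differ there by an isomorphism of the codomain only.
  So the same definition serves for \<open>f\<close> a function on \<open>sur\<close> and on \<open>Qset\<close> below.\<close>

definition convol ::
  "'f set \<Rightarrow> ('f gmor \<Rightarrow> complex) \<Rightarrow> ('f gmor \<Rightarrow> complex) \<Rightarrow> 'f gmor \<Rightarrow> complex" where
  "convol B f g \<eta> = (\<Sum>D \<in> Decomp B \<eta>. case (SOME p. p \<in> D) of (\<eta>1, \<eta>2) \<Rightarrow> f \<eta>1 * g \<eta>2)"

text \<open>Functions on isomorphism classes of \<open>B\<close>-surjective morphisms. The value 0 outside \<open>sur B\<close>
  is a convention that makes such a function unique as a function on the whole type.\<close>

definition sur_functions :: "'f set \<Rightarrow> ('f gmor \<Rightarrow> complex) set" where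
  "sur_functions B = {f. (\<forall>\<eta> \<in> sur B. \<forall>\<eta>' \<in> sur B. mor_iso \<eta> \<eta>' \<longrightarrow> f \<eta> = f \<eta>') \<and>
     (\<forall>\<eta>. \<eta> \<notin> sur B \<longrightarrow> f \<eta> = 0)}"

definition convol_one :: "'f gmor \<Rightarrow> complex" where
  "convol_one \<eta> = (if graph_iso (gdom \<eta>) (gcod \<eta>) (gmap \<eta>) then 1 else 0)"

definition moebius :: "'f set \<Rightarrow> 'f gmor \<Rightarrow> complex" where
  "moebius B = (THE \<mu>. \<mu> \<in> sur_functions B \<and>
     (\<forall>\<eta> \<in> sur B. convol B \<mu> (\<lambda>_. 1) \<eta> = convol_one \<eta> \<and> convol B (\<lambda>_. 1) \<mu> \<eta> = convol_one \<eta>))"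


section \<open>Multi-words\<close>

text \<open>A multi-word is given by a list of elements of \<open>F\<close>, each representing its conjugacy class.
  Vertex \<open>(j, i)\<close> is the \<open>i\<close>-th vertex of the cycle of the \<open>j\<close>-th word; starting at \<open>(j, 0)\<close> and
  going through increasing \<open>i\<close> one reads the cyclic reduction of that word.\<close>

definition multi_word :: "('f, 'm) monoid_scheme \<Rightarrow> 'f list \<Rightarrow> bool" where
  "multi_word F ws \<longleftrightarrow> set ws \<subseteq> carrier F - {\<one>\<^bsub>F\<^esub>}"

definition word_graph :: "('f, 'm) monoid_scheme \<Rightarrow> 'f set \<Rightarrow> 'f list \<Rightarrow> 'f lgraph" where
  "word_graph F B ws =
     (let c = (\<lambda>j. cyclic_reduction F B (ws ! j));
          V = {(j, i). j < length ws \<and> i < length (c j)}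
      in \<lparr> gverts = V,
           gedges = (\<lambda>(j, i).
             let v = (j, i); v' = (j, Suc i mod length (c j)); l = c j ! i
             in if snd l then (v, fst l, v') else (v', fst l, v)) ` V \<rparr>)"

text \<open>Representatives of the elements of \<open>\<Q>\<^sub>B(w)\<close>; the passage to classes up to isomorphism of the
  codomain is not performed here.\<close>

definition Qset :: "('f, 'm) monoid_scheme \<Rightarrow> 'f set \<Rightarrow> 'f list \<Rightarrow> 'f gmor set" where
  "Qset F B ws = {\<eta> \<in> sur B. gdom \<eta> = word_graph F B ws}"


section \<open>Labelled fundamental groups\<close>

text \<open>\<open>path \<Gamma> u xs v\<close>: there is a path from \<open>u\<close> to \<open>v\<close> along which the word \<open>xs\<close> is read. Edges may
  be traversed backwards, which reads the inverse letter.\<close>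

primrec path :: "'f lgraph \<Rightarrow> vertex \<Rightarrow> 'f letter list \<Rightarrow> vertex \<Rightarrow> bool" where
  "path \<Gamma> u [] v \<longleftrightarrow> u \<in> gverts \<Gamma> \<and> u = v"
| "path \<Gamma> u (l # xs) v \<longleftrightarrow>
     (\<exists>u'. (if snd l then (u, fst l, u') else (u', fst l, u)) \<in> gedges \<Gamma> \<and> path \<Gamma> u' xs v)"

definition pi1_lab :: "('f, 'm) monoid_scheme \<Rightarrow> 'f lgraph \<Rightarrow> vertex \<Rightarrow> 'f set" where
  "pi1_lab F \<Gamma> p = {eval_word F xs | xs. path \<Gamma> p xs p}"

definition components :: "'f lgraph \<Rightarrow> vertex set set" where
  "components \<Gamma> = gverts \<Gamma> // {(u, v). \<exists>xs. path \<Gamma> u xs v}"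

definition base :: "vertex set \<Rightarrow> vertex" where
  "base C = (SOME p. p \<in> C)"

definition connecting :: "'f lgraph \<Rightarrow> vertex \<Rightarrow> vertex \<Rightarrow> 'f letter list" where
  "connecting \<Gamma> u v = (SOME xs. path \<Gamma> u xs v)"


section \<open>Expectations\<close>

definition homs :: "('f, 'm) monoid_scheme \<Rightarrow> 'f set \<Rightarrow> ('k, 'l) monoid_scheme \<Rightarrow> ('f \<Rightarrow> 'k) set"
  where "homs F J K = hom (F\<lparr>carrier := J\<rparr>) K \<inter> extensional J"

definition average :: "'x set \<Rightarrow> ('x \<Rightarrow> complex) \<Rightarrow> complex" where
  "average A f = (\<Sum>x \<in> A. f x) / of_nat (card A)"

text \<open>A representative, based at \<open>base C\<close>, of the conjugacy class determined by the image of the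
  oriented \<open>j\<close>-th cycle in the component \<open>C\<close> of the codomain.\<close>

definition image_word ::
  "('f, 'm) monoid_scheme \<Rightarrow> 'f set \<Rightarrow> 'f list \<Rightarrow> 'f gmor \<Rightarrow> vertex set \<Rightarrow> nat \<Rightarrow> 'f" where
  "image_word F B ws \<eta> C j =
     (let t = connecting (gcod \<eta>) (base C) (gmap \<eta> (j, 0))
      in eval_word F (t @ cyclic_reduction F B (ws ! j) @ inv_word t))"

definition expect_words ::
  "('f, 'm) monoid_scheme \<Rightarrow> 'f set \<Rightarrow> 'f list \<Rightarrow> ('k, 'l) monoid_scheme \<Rightarrow>
   (nat \<Rightarrow> 'k \<Rightarrow> complex) \<Rightarrow> 'f gmor \<Rightarrow> complex" where
  "expect_words F B ws K \<xi> \<eta> =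
     (\<Prod>C \<in> components (gcod \<eta>).
        average (homs F (pi1_lab F (gcod \<eta>) (base C)) K)
          (\<lambda>\<alpha>. \<Prod>j \<in> {j. j < length ws \<and> gmap \<eta> (j, 0) \<in> C}. \<xi> j (\<alpha> (image_word F B ws \<eta> C j))))"

text \<open>\<open>C'\<close> is a component of the domain mapped into the component \<open>C\<close> of the codomain. A morphism
  preserves labels, so a closed path and its image read the same word.\<close>

definition image_subgroup ::
  "('f, 'm) monoid_scheme \<Rightarrow> 'f gmor \<Rightarrow> vertex set \<Rightarrow> vertex set \<Rightarrow> 'f set" where
  "image_subgroup F \<eta> C C' =
     (let q = base C'; t = connecting (gcod \<eta>) (base C) (gmap \<eta> q)
      in {eval_word F (t @ xs @ inv_word t) | xs. path (gdom \<eta>) q xs q})"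

definition expect_fix :: "('f, 'm) monoid_scheme \<Rightarrow> nat \<Rightarrow> 'f gmor \<Rightarrow> complex" where
  "expect_fix F n \<eta> =
     (\<Prod>C \<in> components (gcod \<eta>).
        average (homs F (pi1_lab F (gcod \<eta>) (base C)) (sym_group n))
          (\<lambda>\<alpha>. \<Prod>C' \<in> {C' \<in> components (gdom \<eta>). gmap \<eta> ` C' \<subseteq> C}.
             of_nat (card {x \<in> {1..n}. \<forall>h \<in> image_subgroup F \<eta> C C'. \<alpha> h x = x})))"


section \<open>Wreath products and induction\<close>

definition class_function :: "('g, 'm) monoid_scheme \<Rightarrow> ('g \<Rightarrow> complex) \<Rightarrow> bool" where
  "class_function G \<phi> \<longleftrightarrow>
     (\<forall>g \<in> carrier G. \<forall>h \<in> carrier G. \<phi> (h \<otimes>\<^bsub>G\<^esub> g \<otimes>\<^bsub>G\<^esub> inv\<^bsub>G\<^esub> h) = \<phi> g)"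

definition wreath ::
  "('g, 'm) monoid_scheme \<Rightarrow> nat \<Rightarrow> ((nat \<Rightarrow> 'g) \<times> (nat \<Rightarrow> nat)) monoid" where
  "wreath G n = \<lparr>
     carrier = ({1..n} \<rightarrow>\<^sub>E carrier G) \<times> carrier (sym_group n),
     mult = (\<lambda>(v1, \<sigma>1) (v2, \<sigma>2).
       (\<lambda>i \<in> {1..n}. v1 i \<otimes>\<^bsub>G\<^esub> v2 (inv' \<sigma>1 i), \<sigma>1 \<otimes>\<^bsub>sym_group n\<^esub> \<sigma>2)),
     one = (\<lambda>i \<in> {1..n}. \<one>\<^bsub>G\<^esub>, \<one>\<^bsub>sym_group n\<^esub>) \<rparr>"

definition Ind :: "nat \<Rightarrow> ('g \<Rightarrow> complex) \<Rightarrow> (nat \<Rightarrow> 'g) \<times> (nat \<Rightarrow> nat) \<Rightarrow> complex" where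
  "Ind n \<phi> = (\<lambda>(v, \<sigma>). \<Sum>i \<in> {i \<in> {1..n}. \<sigma> i = i}. \<phi> (v i))"

end

theory Submission
  imports Defs
begin

text \<open>
  Write \<open>\<Gamma>\<close> for the graph of the words and fix \<open>\<eta>: \<Gamma> \<rightarrow> \<Delta>\<close>. The proof rests on two reformulations that
  turn the claim into a Moebius inversion on a finite poset.

  First, all expectations become averages over edge labellings. A labelling \<open>\<beta>\<close> of the edges of
  \<open>\<Delta>\<close> by elements of a finite group \<open>K\<close> induces a homomorphism from the fundamental group of each
  component to \<open>K\<close>, by reading \<open>\<beta>\<close> along closed paths. Labellings correspond bijectively to a
  homomorphism on each component together with an arbitrary element of \<open>K\<close> at each vertex that is
  not a base point, so a uniformly random labelling induces independent uniform homomorphisms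
  (\<open>expectation_as_labellings\<close>). Hence \<open>E\<^sub>\<eta>[\<xi>]\<close> is the average over \<open>\<beta>\<close> of the product over \<open>j\<close> of
  \<open>\<xi>\<^sub>j\<close> at the product of \<open>\<beta>\<close> along the \<open>j\<close>-th cycle (\<open>expect_words_labellings\<close>), and
  \<open>E\<^sub>\<eta>[S\<^sub>n \<curvearrowright> [n]]\<close> is the average over permutation labellings \<open>\<sigma>\<close> of the number of sections, that
  is, of maps \<open>s\<close> from the vertices of the domain of \<open>\<eta>\<close> to \<open>[n]\<close> which follow \<open>\<sigma>\<close> along every edge: a common
  fixed point at one vertex spreads uniquely over its component (\<open>expect_fix_labellings\<close>).

  A labelling by \<open>G \<wr> S\<^sub>n\<close> is a permutation labelling \<open>\<sigma>\<close> together with a \<open>G\<close>-labelling of the edges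
  of the \<open>n\<close>-sheeted cover of \<open>\<Delta>\<close> which \<open>\<sigma>\<close> defines. Expanding \<open>Ind \<zeta>\<^sub>j\<close> over the fixed points
  gives one term for each section \<open>s\<close>, in which the \<open>G\<close>-labels are read along the lift of \<open>\<Gamma>\<close> to the
  cover determined by \<open>s\<close>. The average over the \<open>G\<close>-labels depends only on which edges of \<open>\<Gamma>\<close> have the
  same image in the cover; so it is \<open>E\<^sub>\<theta>[\<zeta>]\<close>, where \<open>\<theta>\<close> is the map of \<open>\<Gamma>\<close> onto its image in the
  cover. Therefore the left hand side is the average over \<open>\<sigma>\<close> of the sum of \<open>f(T\<^sub>s)\<close> over the
  sections \<open>s\<close>, where \<open>T\<^sub>s\<close> is the kernel of \<open>v \<mapsto> (\<eta> v, s v)\<close> and \<open>f(S)\<close> is the expectation of \<open>\<zeta>\<close>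
  for the surjective morphism with kernel \<open>S\<close> (\<open>expect_wreath\<close>, \<open>average_over_section\<close>).

  Secondly, a \<open>B\<close>-surjective morphism is determined, up to isomorphism of its codomain, by its
  kernel, the equivalence relation that it induces on the vertices of its domain. So decompositions of \<open>\<eta>\<close> correspond to the kernels below
  that of \<open>\<eta>\<close>, convolutions become sums over intervals in the poset of kernels
  (\<open>convol_by_kernels\<close>), and \<open>\<mu>\<^sub>B\<close> becomes the Moebius function of that poset
  (\<open>moebius_eq_kernel_moebius\<close>). If \<open>\<eta> = \<eta>\<^sub>2 \<circ> \<eta>\<^sub>1\<close>, then the sections over \<open>\<eta>\<^sub>2\<close> are the sections
  \<open>s\<close> over \<open>\<eta>\<close> with \<open>ker \<eta>\<^sub>1 \<subseteq> T\<^sub>s\<close> (\<open>card_sections_decomp\<close>). So the right hand side is the average over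
  \<open>\<sigma>\<close> of the sum over all sections \<open>s\<close> of \<open>\<Sum>\<^sub>S \<Sum>\<^sub>R f(R) \<mu>(R, S)\<close>, where \<open>R \<subseteq> S \<subseteq> T\<^sub>s\<close>, and Moebius
  inversion reduces the inner double sum to \<open>f(T\<^sub>s)\<close>.
\<close>

section \<open>The Moebius function of inclusion\<close>

text \<open>The recursion is over the upper end of the interval, so that the defining identity is
  \<open>\<mu> * 1 = \<delta>\<close>.\<close>
function inclusion_moebius :: "'a set set \<Rightarrow> 'a set \<Rightarrow> 'a set \<Rightarrow> complex" where
  "inclusion_moebius P x y = (if x = y then 1
     else if finite P \<and> x \<subset> y then - (\<Sum>z \<in> {z \<in> P. x \<subseteq> z \<and> z \<subset> y}. inclusion_moebius P x z) else 0)"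
  by pat_completeness auto
termination
proof (relation "measure (\<lambda>(P, x, y). card {z \<in> P. z \<subset> y})")
  fix P :: "'a set set" and x y z
  assume "finite P \<and> x \<subset> y" and z: "z \<in> {z \<in> P. x \<subseteq> z \<and> z \<subset> y}"
  then have "{w \<in> P. w \<subset> z} \<subset> {w \<in> P. w \<subset> y}" "finite {w \<in> P. w \<subset> y}" by auto
  then show "((P, x, z), P, x, y) \<in> measure (\<lambda>(P, x, y). card {z \<in> P. z \<subset> y})"
    by (simp add: psubset_card_mono)
qed simp

declare inclusion_moebius.simps [simp del]

lemma inclusion_moebius_refl [simp]: "inclusion_moebius P x x = 1"
  by (simp add: inclusion_moebius.simps)

lemma inclusion_moebius_sum_upper:
  assumes "finite P" "x \<in> P" "y \<in> P" "x \<subseteq> y"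
  shows "(\<Sum>z \<in> {z \<in> P. x \<subseteq> z \<and> z \<subseteq> y}. inclusion_moebius P x z) = (if x = y then 1 else 0)"
proof (cases "x = y")
  case True
  then have "{z \<in> P. x \<subseteq> z \<and> z \<subseteq> y} = {x}" using assms by auto
  then show ?thesis using True by simp
next
  case False
  have "{z \<in> P. x \<subseteq> z \<and> z \<subseteq> y} = insert y {z \<in> P. x \<subseteq> z \<and> z \<subset> y}" using assms by auto
  then show ?thesis using False assms by (simp add: inclusion_moebius.simps[of P x y] psubset_eq)
qed

text \<open>The opposite identity \<open>1 * \<mu> = \<delta>\<close>. Let \<open>A = 1 * \<mu>\<close>. Then \<open>\<mu> * A = (\<mu> * 1) * \<mu> = \<mu>\<close>, and if
  \<open>A\<close> is already known to be \<open>\<delta>\<close> on all smaller intervals with the same upper end, this equation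
  determines \<open>A\<close> on the whole interval.\<close>
lemma inclusion_moebius_sum_lower:
  assumes P: "finite P" and y: "y \<in> P" and "x \<in> P" "x \<subseteq> y"
  shows "(\<Sum>z \<in> {z \<in> P. x \<subseteq> z \<and> z \<subseteq> y}. inclusion_moebius P z y) = (if x = y then 1 else 0)"
  using assms(3,4)
proof (induction "card {z \<in> P. x \<subset> z}" arbitrary: x rule: less_induct)
  case less
  define A where "A \<equiv> \<lambda>x. (\<Sum>z \<in> {z \<in> P. x \<subseteq> z \<and> z \<subseteq> y}. inclusion_moebius P z y)"
  have IH: "A z = (if z = y then 1 else 0)" if "z \<in> P" "x \<subset> z" "z \<subseteq> y" for z
  proof -
    have "{w \<in> P. z \<subset> w} \<subset> {w \<in> P. x \<subset> w}" using that by auto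
    then have "card {w \<in> P. z \<subset> w} < card {w \<in> P. x \<subset> w}"
      using P by (intro psubset_card_mono) auto
    from less.hyps[OF this that(1,3)] show ?thesis by (simp add: A_def)
  qed
  \<comment> \<open>The equation \<open>\<mu> * A = \<mu>\<close>.\<close>
  have "(\<Sum>z \<in> {z \<in> P. x \<subseteq> z \<and> z \<subseteq> y}. inclusion_moebius P x z * A z)
      = (\<Sum>z \<in> {z \<in> P. x \<subseteq> z \<and> z \<subseteq> y}. \<Sum>w \<in> {w \<in> P. z \<subseteq> w \<and> w \<subseteq> y}. inclusion_moebius P x z * inclusion_moebius P w y)"
    by (simp add: A_def sum_distrib_left)
  also have "\<dots> = (\<Sum>w \<in> {w \<in> P. x \<subseteq> w \<and> w \<subseteq> y}. \<Sum>z \<in> {z \<in> P. x \<subseteq> z \<and> z \<subseteq> w}. inclusion_moebius P x z * inclusion_moebius P w y)"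
  proof -
    let ?I = "{z \<in> P. x \<subseteq> z \<and> z \<subseteq> y}"
    have "(\<Sum>z \<in> ?I. \<Sum>w \<in> {w \<in> P. z \<subseteq> w \<and> w \<subseteq> y}. inclusion_moebius P x z * inclusion_moebius P w y)
        = (\<Sum>z \<in> ?I. \<Sum>w \<in> {w. w \<in> ?I \<and> z \<subseteq> w}. inclusion_moebius P x z * inclusion_moebius P w y)"
      by (intro sum.cong refl) auto
    also have "\<dots> = (\<Sum>w \<in> ?I. \<Sum>z \<in> {z. z \<in> ?I \<and> z \<subseteq> w}. inclusion_moebius P x z * inclusion_moebius P w y)"
      using P by (intro sum.swap_restrict) auto
    also have "\<dots> = (\<Sum>w \<in> ?I. \<Sum>z \<in> {z \<in> P. x \<subseteq> z \<and> z \<subseteq> w}. inclusion_moebius P x z * inclusion_moebius P w y)"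
      by (intro sum.cong refl) auto
    finally show ?thesis .
  qed
  also have "\<dots> = (\<Sum>w \<in> {w \<in> P. x \<subseteq> w \<and> w \<subseteq> y}. (if w = x then inclusion_moebius P w y else 0))"
    using inclusion_moebius_sum_upper[OF P less.prems(1)] by (intro sum.cong refl) (simp add: sum_distrib_right[symmetric])
  also have "\<dots> = inclusion_moebius P x y" using less.prems P by simp
  finally have conv: "(\<Sum>z \<in> {z \<in> P. x \<subseteq> z \<and> z \<subseteq> y}. inclusion_moebius P x z * A z) = inclusion_moebius P x y" .
  show ?case
  proof (cases "x = y")
    case True
    then have "{z \<in> P. x \<subseteq> z \<and> z \<subseteq> y} = {x}" using less.prems by auto
    then show ?thesis using True by simp
  next
    case False
    have "{z \<in> P. x \<subseteq> z \<and> z \<subseteq> y} = insert x {z \<in> P. x \<subset> z \<and> z \<subseteq> y}" using less.prems by auto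
    then have "inclusion_moebius P x y = A x + (\<Sum>z \<in> {z \<in> P. x \<subset> z \<and> z \<subseteq> y}. inclusion_moebius P x z * A z)"
      using conv P by simp
    also have "(\<Sum>z \<in> {z \<in> P. x \<subset> z \<and> z \<subseteq> y}. inclusion_moebius P x z * A z)
        = (\<Sum>z \<in> {z \<in> P. x \<subset> z \<and> z \<subseteq> y}. if z = y then inclusion_moebius P x z else 0)"
      by (intro sum.cong refl) (simp add: IH)
    also have "\<dots> = inclusion_moebius P x y" using P y less.prems False by (simp add: psubset_eq)
    finally show ?thesis using False by (simp add: A_def)
  qed
qed

text \<open>In the theorem \<open>f\<close> is the expectation of \<open>\<zeta>\<close>, and \<open>U\<close> is the kernel of a lift to a cover.\<close>
lemma inclusion_moebius_inversion:
  assumes P: "finite P" and U: "U \<in> P"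
  shows "(\<Sum>S \<in> {S \<in> P. S \<subseteq> U}. \<Sum>R \<in> {R \<in> P. R \<subseteq> S}. f R * inclusion_moebius P R S) = f U"
proof -
  have "(\<Sum>S \<in> {S \<in> P. S \<subseteq> U}. \<Sum>R \<in> {R \<in> P. R \<subseteq> S}. f R * inclusion_moebius P R S)
      = (\<Sum>S \<in> {S \<in> P. S \<subseteq> U}. \<Sum>R \<in> {R. R \<in> {R \<in> P. R \<subseteq> U} \<and> R \<subseteq> S}. f R * inclusion_moebius P R S)"
    by (intro sum.cong refl) auto
  also have "\<dots> = (\<Sum>R \<in> {R \<in> P. R \<subseteq> U}. \<Sum>S \<in> {S. S \<in> {S \<in> P. S \<subseteq> U} \<and> R \<subseteq> S}. f R * inclusion_moebius P R S)"
    using P by (intro sum.swap_restrict) auto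
  also have "\<dots> = (\<Sum>R \<in> {R \<in> P. R \<subseteq> U}. f R * (\<Sum>S \<in> {S \<in> P. R \<subseteq> S \<and> S \<subseteq> U}. inclusion_moebius P R S))"
    unfolding sum_distrib_left by (intro sum.cong refl) auto
  also have "\<dots> = (\<Sum>R \<in> {R \<in> P. R \<subseteq> U}. if R = U then f R else 0)"
    by (intro sum.cong refl) (simp add: inclusion_moebius_sum_upper[OF P _ U])
  also have "\<dots> = f U" using P U by simp
  finally show ?thesis .
qed

text \<open>The Moebius function of an interval depends only on the interval as a poset. This is what makes it
  invariant under isomorphisms of graphs and under the passage to a quotient graph.\<close>
lemma inclusion_moebius_iso:
  assumes P: "finite P" and Q: "finite Q"
    and h: "bij_betw h {z \<in> P. x \<subseteq> z \<and> z \<subseteq> y} {z \<in> Q. x' \<subseteq> z \<and> z \<subseteq> y'}"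
    and mono: "\<And>z w. z \<in> P \<Longrightarrow> x \<subseteq> z \<Longrightarrow> z \<subseteq> y \<Longrightarrow> w \<in> P \<Longrightarrow> x \<subseteq> w \<Longrightarrow> w \<subseteq> y \<Longrightarrow>
      h z \<subseteq> h w \<longleftrightarrow> z \<subseteq> w"
    and hx: "h x = x'" and x: "x \<in> P" and z: "z \<in> P" "x \<subseteq> z" "z \<subseteq> y"
  shows "inclusion_moebius Q x' (h z) = inclusion_moebius P x z"
  using z
proof (induction "card {w \<in> P. w \<subset> z}" arbitrary: z rule: less_induct)
  case less
  note z = less.prems
  have xy: "x \<subseteq> y" using z by auto
  have inj: "inj_on h {z \<in> P. x \<subseteq> z \<and> z \<subseteq> y}" using h by (simp add: bij_betw_def)
  have strict: "h w \<subset> h z \<longleftrightarrow> w \<subset> z" if "w \<in> P" "x \<subseteq> w" "w \<subseteq> y" for w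
    using mono[OF that z] mono[OF z that] by auto
  show ?case
  proof (cases "x = z")
    case True
    show ?thesis unfolding True[symmetric] hx by simp
  next
    case False
    then have xz: "x \<subset> z" using z by auto
    then have hxz: "x' \<subset> h z" using strict[of x] x xy hx by auto
    have img: "h ` {w \<in> P. x \<subseteq> w \<and> w \<subseteq> y} = {w \<in> Q. x' \<subseteq> w \<and> w \<subseteq> y'}"
      using h by (simp add: bij_betw_def)
    have hz: "h z \<subseteq> y'" using img z by blast
    have "bij_betw h {w \<in> P. x \<subseteq> w \<and> w \<subset> z} {w \<in> Q. x' \<subseteq> w \<and> w \<subset> h z}"
      unfolding bij_betw_def
    proof
      show "inj_on h {w \<in> P. x \<subseteq> w \<and> w \<subset> z}"
        by (rule inj_on_subset[OF inj]) (use z in auto)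
      show "h ` {w \<in> P. x \<subseteq> w \<and> w \<subset> z} = {w \<in> Q. x' \<subseteq> w \<and> w \<subset> h z}"
      proof (intro equalityI subsetI)
        fix w assume "w \<in> h ` {w \<in> P. x \<subseteq> w \<and> w \<subset> z}"
        then obtain v where v: "v \<in> P" "x \<subseteq> v" "v \<subset> z" "w = h v" by auto
        then have vy: "v \<subseteq> y" using z by auto
        then have "h v \<in> {w \<in> Q. x' \<subseteq> w \<and> w \<subseteq> y'}" using img v by blast
        then show "w \<in> {w \<in> Q. x' \<subseteq> w \<and> w \<subset> h z}" using strict[OF v(1,2) vy] v by auto
      next
        fix w assume w: "w \<in> {w \<in> Q. x' \<subseteq> w \<and> w \<subset> h z}"
        then have "w \<in> h ` {w \<in> P. x \<subseteq> w \<and> w \<subseteq> y}" unfolding img using hz by auto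
        then obtain v where "w = h v" "v \<in> {w \<in> P. x \<subseteq> w \<and> w \<subseteq> y}" by (rule imageE)
        then have v: "v \<in> P" "x \<subseteq> v" "v \<subseteq> y" "w = h v" by simp_all
        then show "w \<in> h ` {w \<in> P. x \<subseteq> w \<and> w \<subset> z}" using strict[OF v(1-3)] w by auto
      qed
    qed
    from sum.reindex_bij_betw[OF this, of "inclusion_moebius Q x'"]
    have "(\<Sum>w \<in> {w \<in> Q. x' \<subseteq> w \<and> w \<subset> h z}. inclusion_moebius Q x' w)
        = (\<Sum>w \<in> {w \<in> P. x \<subseteq> w \<and> w \<subset> z}. inclusion_moebius Q x' (h w))" by simp
    also have "\<dots> = (\<Sum>w \<in> {w \<in> P. x \<subseteq> w \<and> w \<subset> z}. inclusion_moebius P x w)"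
    proof (intro sum.cong refl less.hyps)
      fix w assume w: "w \<in> {w \<in> P. x \<subseteq> w \<and> w \<subset> z}"
      have "{v \<in> P. v \<subset> w} \<subset> {v \<in> P. v \<subset> z}" using w by auto
      then show "card {v \<in> P. v \<subset> w} < card {v \<in> P. v \<subset> z}"
        using P by (intro psubset_card_mono) auto
    qed (use z in auto)
    finally show ?thesis using xz hxz P Q less_imp_neq[OF xz] less_imp_neq[OF hxz] by (simp add: inclusion_moebius.simps[of Q x' "h z"] inclusion_moebius.simps[of P x z])
  qed
qed

section \<open>Decompositions and kernels\<close>

(* Vertices are pairs of numbers; quantifiers over vertices are to be kept intact. *)
declare split_paired_Ex [simp del] split_paired_All [simp del]

definition mor_kernel :: "'f gmor \<Rightarrow> (vertex \<times> vertex) set" where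
  "mor_kernel \<eta> = {(u, v). u \<in> gverts (gdom \<eta>) \<and> v \<in> gverts (gdom \<eta>) \<and> gmap \<eta> u = gmap \<eta> v}"

text \<open>Only vertices are recorded: in a folded graph the identifications of edges follow from those of
  their end points and from the labels.\<close>
definition kernels :: "'f set \<Rightarrow> 'f lgraph \<Rightarrow> (vertex \<times> vertex) set set" where
  "kernels B \<Gamma> = mor_kernel ` {\<eta> \<in> sur B. gdom \<eta> = \<Gamma>}"

lemma mor_kernel_in_kernels: "\<eta> \<in> sur B \<Longrightarrow> mor_kernel \<eta> \<in> kernels B (gdom \<eta>)"
  by (auto simp: kernels_def)

lemma multi_core_graphD:
  assumes "multi_core_graph B \<Gamma>"
  shows "finite (gverts \<Gamma>)" "finite (gedges \<Gamma>)" "gedges \<Gamma> \<subseteq> gverts \<Gamma> \<times> B \<times> gverts \<Gamma>"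
    "\<And>v b u u'. (v, b, u) \<in> gedges \<Gamma> \<Longrightarrow> (v, b, u') \<in> gedges \<Gamma> \<Longrightarrow> u = u'"
    "\<And>v b u u'. (u, b, v) \<in> gedges \<Gamma> \<Longrightarrow> (u', b, v) \<in> gedges \<Gamma> \<Longrightarrow> u = u'"
    "\<And>v. v \<in> gverts \<Gamma> \<Longrightarrow>
      card {e \<in> gedges \<Gamma>. fst e = v} + card {e \<in> gedges \<Gamma>. snd (snd e) = v} \<ge> 2"
  using assms unfolding multi_core_graph_def by blast+

lemma surD:
  assumes "\<eta> \<in> sur B"
  shows "multi_core_graph B (gdom \<eta>)" "multi_core_graph B (gcod \<eta>)"
    "gmap \<eta> ` gverts (gdom \<eta>) = gverts (gcod \<eta>)"
    "emap (gmap \<eta>) ` gedges (gdom \<eta>) = gedges (gcod \<eta>)"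
  using assms by (auto simp: sur_def morphism_def)

lemma surI:
  assumes "multi_core_graph B (gdom \<eta>)" "multi_core_graph B (gcod \<eta>)"
    "gmap \<eta> ` gverts (gdom \<eta>) = gverts (gcod \<eta>)"
    "emap (gmap \<eta>) ` gedges (gdom \<eta>) = gedges (gcod \<eta>)"
  shows "\<eta> \<in> sur B"
  using assms by (auto simp: sur_def morphism_def)

lemma emap_simp [simp]: "emap h (u, b, v) = (h u, b, h v)"
  by (simp add: emap_def)

lemma emap_emap: "emap g (emap h e) = emap (\<lambda>v. g (h v)) e"
  by (simp add: emap_def)

lemma edge_ends:
  assumes "multi_core_graph B \<Gamma>" "(u, b, v) \<in> gedges \<Gamma>"
  shows "u \<in> gverts \<Gamma>" "v \<in> gverts \<Gamma>" "b \<in> B"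
  using multi_core_graphD(3)[OF assms(1)] assms(2) by auto

lemma emap_cong:
  assumes "multi_core_graph B \<Gamma>" "e \<in> gedges \<Gamma>" "\<And>v. v \<in> gverts \<Gamma> \<Longrightarrow> g v = h v"
  shows "emap g e = emap h e"
  using edge_ends[OF assms(1)] assms(2,3) by (cases e) auto

lemma finite_kernels: "multi_core_graph B \<Gamma> \<Longrightarrow> finite (kernels B \<Gamma>)"
  by (rule finite_subset[of _ "Pow (gverts \<Gamma> \<times> gverts \<Gamma>)"])
    (auto simp: kernels_def mor_kernel_def dest: multi_core_graphD)

lemma identity_sur:
  assumes "multi_core_graph B \<Gamma>"
  shows "\<lparr>gdom = \<Gamma>, gcod = \<Gamma>, gmap = id\<rparr> \<in> sur B"
  using assms by (intro surI) (auto simp: emap_def)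

lemma Id_in_kernels:
  assumes "multi_core_graph B \<Gamma>"
  shows "Id_on (gverts \<Gamma>) \<in> kernels B \<Gamma>"
proof -
  have "mor_kernel \<lparr>gdom = \<Gamma>, gcod = \<Gamma>, gmap = id\<rparr> = Id_on (gverts \<Gamma>)" by (auto simp: mor_kernel_def)
  then show ?thesis using mor_kernel_in_kernels[OF identity_sur[OF assms]] by simp
qed

lemma Id_subset_ker: "Id_on (gverts (gdom \<eta>)) \<subseteq> mor_kernel \<eta>"
  by (auto simp: mor_kernel_def)

lemma kernels_above_Id: "S \<in> kernels B \<Gamma> \<Longrightarrow> Id_on (gverts \<Gamma>) \<subseteq> S"
  by (auto simp: kernels_def mor_kernel_def)

text \<open>Since \<open>\<eta>1\<close> is onto, \<open>\<eta>\<close> factors through it as soon as it is constant on its fibres.\<close>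
lemma sur_factor:
  assumes s: "\<eta> \<in> sur B" and s1: "\<eta>1 \<in> sur B" and d: "gdom \<eta>1 = gdom \<eta>" and k: "mor_kernel \<eta>1 \<subseteq> mor_kernel \<eta>"
  obtains \<eta>2 where "(\<eta>1, \<eta>2) \<in> decomp_pairs B \<eta>"
proof -
  define g where "g u = gmap \<eta> (SOME v. v \<in> gverts (gdom \<eta>) \<and> gmap \<eta>1 v = u)" for u
  define \<eta>2 where "\<eta>2 = \<lparr>gdom = gcod \<eta>1, gcod = gcod \<eta>, gmap = g\<rparr>"
  have g: "g (gmap \<eta>1 v) = gmap \<eta> v" if v: "v \<in> gverts (gdom \<eta>)" for v
  proof -
    define w where "w = (SOME w. w \<in> gverts (gdom \<eta>) \<and> gmap \<eta>1 w = gmap \<eta>1 v)"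
    have "w \<in> gverts (gdom \<eta>) \<and> gmap \<eta>1 w = gmap \<eta>1 v"
      unfolding w_def by (rule someI[of _ v]) (use v in simp)
    then have "(w, v) \<in> mor_kernel \<eta>1" using v d by (simp add: mor_kernel_def)
    then have "(w, v) \<in> mor_kernel \<eta>" using k by auto
    then show ?thesis by (simp add: g_def mor_kernel_def flip: w_def)
  qed
  have ge: "emap g (emap (gmap \<eta>1) e) = emap (gmap \<eta>) e" if "e \<in> gedges (gdom \<eta>)" for e
    unfolding emap_emap by (rule emap_cong[OF surD(1)[OF s] that]) (rule g)
  have "g ` gverts (gcod \<eta>1) = gmap \<eta> ` gverts (gdom \<eta>)"
    unfolding surD(3)[OF s1, symmetric] d image_image by (rule image_cong) (auto simp: g)
  moreover have "emap g ` gedges (gcod \<eta>1) = emap (gmap \<eta>) ` gedges (gdom \<eta>)"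
    unfolding surD(4)[OF s1, symmetric] d image_image by (rule image_cong) (auto simp: ge)
  ultimately have "\<eta>2 \<in> sur B"
    using surD[OF s] surD[OF s1] by (intro surI) (simp_all add: \<eta>2_def)
  then have "(\<eta>1, \<eta>2) \<in> decomp_pairs B \<eta>"
    using s s1 d g by (simp add: decomp_pairs_def \<eta>2_def)
  then show thesis by (rule that)
qed

lemma decomp_pairsD:
  assumes "(\<eta>1, \<eta>2) \<in> decomp_pairs B \<eta>"
  shows "\<eta>1 \<in> sur B" "\<eta>2 \<in> sur B" "gdom \<eta>1 = gdom \<eta>" "gcod \<eta>1 = gdom \<eta>2" "gcod \<eta>2 = gcod \<eta>"
    "\<And>v. v \<in> gverts (gdom \<eta>) \<Longrightarrow> gmap \<eta>2 (gmap \<eta>1 v) = gmap \<eta> v"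
  using assms by (auto simp: decomp_pairs_def)

lemma decomp_ker_subset:
  assumes "(\<eta>1, \<eta>2) \<in> decomp_pairs B \<eta>"
  shows "mor_kernel \<eta>1 \<subseteq> mor_kernel \<eta>"
proof (rule subrelI)
  fix u v assume "(u, v) \<in> mor_kernel \<eta>1"
  then show "(u, v) \<in> mor_kernel \<eta>"
    using decomp_pairsD(3)[OF assms] decomp_pairsD(6)[OF assms, of u] decomp_pairsD(6)[OF assms, of v]
    by (simp add: mor_kernel_def)
qed

lemma graph_isoI:
  assumes \<Gamma>: "multi_core_graph B \<Gamma>" and v: "bij_betw h (gverts \<Gamma>) (gverts \<Delta>)"
    and e: "emap h ` gedges \<Gamma> = gedges \<Delta>"
  shows "graph_iso \<Gamma> \<Delta> h"
proof -
  have "inj_on (emap h) (gedges \<Gamma>)"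
  proof (rule inj_onI)
    fix e e' assume *: "e \<in> gedges \<Gamma>" "e' \<in> gedges \<Gamma>" "emap h e = emap h e'"
    obtain u b v u' b' v' where [simp]: "e = (u, b, v)" "e' = (u', b', v')" by (cases e, cases e')
    have "inj_on h (gverts \<Gamma>)" using v by (simp add: bij_betw_def)
    then show "e = e'"
      using * edge_ends[OF \<Gamma>, of u b v] edge_ends[OF \<Gamma>, of u' b' v'] by (simp add: inj_on_eq_iff)
  qed
  then show ?thesis using v e by (simp add: graph_iso_def bij_betw_def)
qed

text \<open>The intermediate graph of a decomposition is the quotient of the domain by the kernel of \<open>\<eta>1\<close>. So
  two decompositions with the same kernel are related by the isomorphism between the two models of
  this quotient.\<close>
lemma decomp_rel_iff_ker:
  assumes p: "(\<eta>1, \<eta>2) \<in> decomp_pairs B \<eta>" and p': "(\<eta>1', \<eta>2') \<in> decomp_pairs B \<eta>"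
  shows "((\<eta>1, \<eta>2), (\<eta>1', \<eta>2')) \<in> decomp_rel B \<eta> \<longleftrightarrow> mor_kernel \<eta>1 = mor_kernel \<eta>1'"
proof
  assume "((\<eta>1, \<eta>2), (\<eta>1', \<eta>2')) \<in> decomp_rel B \<eta>"
  then obtain \<phi> where \<phi>: "graph_iso (gcod \<eta>1) (gcod \<eta>1') \<phi>"
      "\<And>v. v \<in> gverts (gdom \<eta>) \<Longrightarrow> \<phi> (gmap \<eta>1 v) = gmap \<eta>1' v"
    by (auto simp: decomp_rel_def)
  have "gmap \<eta>1 u = gmap \<eta>1 v \<longleftrightarrow> gmap \<eta>1' u = gmap \<eta>1' v"
    if "u \<in> gverts (gdom \<eta>)" "v \<in> gverts (gdom \<eta>)" for u v
  proof -
    have "inj_on \<phi> (gverts (gcod \<eta>1))" using \<phi>(1) by (simp add: graph_iso_def bij_betw_def)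
    moreover have "gmap \<eta>1 u \<in> gverts (gcod \<eta>1)" "gmap \<eta>1 v \<in> gverts (gcod \<eta>1)"
      using that surD(3)[OF decomp_pairsD(1)[OF p]] decomp_pairsD(3)[OF p] by auto
    ultimately show ?thesis using \<phi>(2)[OF that(1)] \<phi>(2)[OF that(2)] by (metis inj_on_eq_iff)
  qed
  then show "mor_kernel \<eta>1 = mor_kernel \<eta>1'" using decomp_pairsD(3)[OF p] decomp_pairsD(3)[OF p']
    by (auto simp: mor_kernel_def)
next
  assume k: "mor_kernel \<eta>1 = mor_kernel \<eta>1'"
  note d = decomp_pairsD[OF p] and d' = decomp_pairsD[OF p']
  obtain \<theta> where \<theta>: "(\<eta>1, \<theta>) \<in> decomp_pairs B \<eta>1'"
    by (rule sur_factor[OF d'(1) d(1)]) (use d d' k in auto)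
  note t = decomp_pairsD[OF \<theta>]
  have "inj_on (gmap \<theta>) (gverts (gcod \<eta>1))"
  proof (rule inj_onI)
    fix x y assume "x \<in> gverts (gcod \<eta>1)" "y \<in> gverts (gcod \<eta>1)" and eq: "gmap \<theta> x = gmap \<theta> y"
    then obtain u v where uv: "u \<in> gverts (gdom \<eta>)" "v \<in> gverts (gdom \<eta>)"
        "x = gmap \<eta>1 u" "y = gmap \<eta>1 v"
      using surD(3)[OF d(1)] d(3) by (metis imageE)
    then have "gmap \<eta>1' u = gmap \<eta>1' v" using eq t(6) d'(3) by auto
    then have "(u, v) \<in> mor_kernel \<eta>1'" using uv d'(3) by (simp add: mor_kernel_def)
    then have "(u, v) \<in> mor_kernel \<eta>1" by (simp add: k)
    then show "x = y" using uv by (simp add: mor_kernel_def)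
  qed
  then have iso: "graph_iso (gcod \<eta>1) (gcod \<eta>1') (gmap \<theta>)"
    using surD(1,3,4)[OF t(2)] t(4,5) by (intro graph_isoI[of B]) (auto simp: bij_betw_def)
  have "gmap \<eta>2 u = gmap \<eta>2' (gmap \<theta> u)" if u: "u \<in> gverts (gcod \<eta>1)" for u
  proof -
    obtain v where v: "v \<in> gverts (gdom \<eta>)" "u = gmap \<eta>1 v"
      using u surD(3)[OF d(1)] d(3) by (metis imageE)
    then show ?thesis using d(6) d'(6) t(6) d'(3) by simp
  qed
  then show "((\<eta>1, \<eta>2), (\<eta>1', \<eta>2')) \<in> decomp_rel B \<eta>"
    using p p' iso t(6) d'(3) by (auto simp: decomp_rel_def)
qed

text \<open>The form in which the convolution is used from here on. The hypothesis makes the summand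
  independent of the representatives chosen in the definition of the convolution.\<close>
lemma convol_by_kernels:
  assumes s: "\<eta> \<in> sur B"
    and H: "\<And>\<eta>1 \<eta>2. (\<eta>1, \<eta>2) \<in> decomp_pairs B \<eta> \<Longrightarrow> f \<eta>1 * g \<eta>2 = H (mor_kernel \<eta>1)"
  shows "convol B f g \<eta> = (\<Sum>S \<in> {S \<in> kernels B (gdom \<eta>). S \<subseteq> mor_kernel \<eta>}. H S)"
proof -
  define rep where "rep D = (SOME p. p \<in> D)" for D :: "('a gmor \<times> 'a gmor) set"
  have equiv: "equiv (decomp_pairs B \<eta>) (decomp_rel B \<eta>)"
  proof (rule equivI)
    show "decomp_rel B \<eta> \<subseteq> decomp_pairs B \<eta> \<times> decomp_pairs B \<eta>" by (auto simp: decomp_rel_def)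
    show "refl_on (decomp_pairs B \<eta>) (decomp_rel B \<eta>)"
      by (auto simp: refl_on_def decomp_rel_iff_ker)
    have sub: "x \<in> decomp_pairs B \<eta> \<and> y \<in> decomp_pairs B \<eta>" if "(x, y) \<in> decomp_rel B \<eta>" for x y
      using that by (auto simp: decomp_rel_def)
    show "sym (decomp_rel B \<eta>)"
    proof (rule symI)
      fix x y assume "(x, y) \<in> decomp_rel B \<eta>"
      then show "(y, x) \<in> decomp_rel B \<eta>"
        using sub[of x y] by (cases x, cases y) (auto simp: decomp_rel_iff_ker)
    qed
    show "trans (decomp_rel B \<eta>)"
    proof (rule transI)
      fix x y z assume "(x, y) \<in> decomp_rel B \<eta>" "(y, z) \<in> decomp_rel B \<eta>"
      then show "(x, z) \<in> decomp_rel B \<eta>"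
        using sub[of x y] sub[of y z] by (cases x, cases y, cases z) (auto simp: decomp_rel_iff_ker)
    qed
  qed
  have rep: "rep D \<in> D" "rep D \<in> decomp_pairs B \<eta>" if D: "D \<in> Decomp B \<eta>" for D
  proof -
    have "D \<noteq> {}" "D \<subseteq> decomp_pairs B \<eta>"
      using D in_quotient_imp_non_empty[OF equiv] in_quotient_imp_subset[OF equiv]
      by (auto simp: Decomp_def)
    moreover from this(1) show "rep D \<in> D" by (simp add: rep_def some_in_eq)
    ultimately show "rep D \<in> decomp_pairs B \<eta>" by auto
  qed
  have "convol B f g \<eta> = (\<Sum>D \<in> Decomp B \<eta>. H (mor_kernel (fst (rep D))))"
    unfolding convol_def rep_def[symmetric]
  proof (intro sum.cong refl)
    fix D assume D: "D \<in> Decomp B \<eta>"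
    then show "(case rep D of (\<eta>1, \<eta>2) \<Rightarrow> f \<eta>1 * g \<eta>2) = H (mor_kernel (fst (rep D)))"
      using rep(2)[OF D] H by (cases "rep D") auto
  qed
  also have "bij_betw (\<lambda>D. mor_kernel (fst (rep D))) (Decomp B \<eta>) {S \<in> kernels B (gdom \<eta>). S \<subseteq> mor_kernel \<eta>}"
    unfolding bij_betw_def
  proof
    show "inj_on (\<lambda>D. mor_kernel (fst (rep D))) (Decomp B \<eta>)"
    proof (rule inj_onI)
      fix D D' assume D: "D \<in> Decomp B \<eta>" "D' \<in> Decomp B \<eta>" "mor_kernel (fst (rep D)) = mor_kernel (fst (rep D'))"
      then have "(rep D, rep D') \<in> decomp_rel B \<eta>"
        using decomp_rel_iff_ker rep(2) by (metis prod.collapse)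
      then show "D = D'"
        using D rep(1) quotient_eqI[OF equiv] unfolding Decomp_def by blast
    qed
    show "(\<lambda>D. mor_kernel (fst (rep D))) ` Decomp B \<eta> = {S \<in> kernels B (gdom \<eta>). S \<subseteq> mor_kernel \<eta>}"
    proof (intro equalityI subsetI)
      fix S assume "S \<in> (\<lambda>D. mor_kernel (fst (rep D))) ` Decomp B \<eta>"
      then obtain D where D: "D \<in> Decomp B \<eta>" "S = mor_kernel (fst (rep D))" by auto
      obtain \<eta>1 \<eta>2 where e: "rep D = (\<eta>1, \<eta>2)" by force
      then show "S \<in> {S \<in> kernels B (gdom \<eta>). S \<subseteq> mor_kernel \<eta>}"
        using D rep(2)[OF D(1)] decomp_ker_subset[of \<eta>1 \<eta>2] decomp_pairsD(1,3)[of \<eta>1 \<eta>2] mor_kernel_in_kernels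
        by (metis (mono_tags) fst_conv mem_Collect_eq)
    next
      fix S assume S: "S \<in> {S \<in> kernels B (gdom \<eta>). S \<subseteq> mor_kernel \<eta>}"
      then obtain \<eta>1 where e1: "\<eta>1 \<in> sur B" "gdom \<eta>1 = gdom \<eta>" "S = mor_kernel \<eta>1" by (auto simp: kernels_def)
      then obtain \<eta>2 where p: "(\<eta>1, \<eta>2) \<in> decomp_pairs B \<eta>" using sur_factor[OF s e1(1,2)] S by auto
      define D where "D = decomp_rel B \<eta> `` {(\<eta>1, \<eta>2)}"
      have D: "D \<in> Decomp B \<eta>" unfolding D_def Decomp_def using p by (rule quotientI)
      have "((\<eta>1, \<eta>2), rep D) \<in> decomp_rel B \<eta>" using rep(1)[OF D] by (simp add: D_def)
      then have "mor_kernel \<eta>1 = mor_kernel (fst (rep D))"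
        using decomp_rel_iff_ker[OF p] rep(2)[OF D] by (metis prod.collapse)
      then show "S \<in> (\<lambda>D. mor_kernel (fst (rep D))) ` Decomp B \<eta>" using D e1 by auto
    qed
  qed
  then have "(\<Sum>D \<in> Decomp B \<eta>. H (mor_kernel (fst (rep D)))) = (\<Sum>S \<in> {S \<in> kernels B (gdom \<eta>). S \<subseteq> mor_kernel \<eta>}. H S)"
    by (rule sum.reindex_bij_betw)
  finally show ?thesis .
qed

text \<open>Every equivalence relation with a folded quotient is a kernel. The quotient is modelled on a set
  of representatives. Its vertices have degree at least 2 because the quotient map is injective on
  the edges that leave, and on those that enter, a given vertex.\<close>
lemma folded_map_kernel:
  fixes k :: "vertex \<Rightarrow> 'x" and B :: "'f set"
  assumes mc: "multi_core_graph B \<Gamma>"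
    and folded: "\<And>u u' b v v'. (u, b, v) \<in> gedges \<Gamma> \<Longrightarrow> (u', b, v') \<in> gedges \<Gamma> \<Longrightarrow> k u = k u' \<longleftrightarrow> k v = k v'"
  shows "{(u, v). u \<in> gverts \<Gamma> \<and> v \<in> gverts \<Gamma> \<and> k u = k v} \<in> kernels B \<Gamma>"
proof -
  define rep where "rep v = (SOME w. w \<in> gverts \<Gamma> \<and> k w = k v)" for v
  have rep: "rep v \<in> gverts \<Gamma>" "k (rep v) = k v" if "v \<in> gverts \<Gamma>" for v
  proof -
    have "rep v \<in> gverts \<Gamma> \<and> k (rep v) = k v" unfolding rep_def by (rule someI[of _ v]) (use that in simp)
    then show "rep v \<in> gverts \<Gamma>" "k (rep v) = k v" by auto
  qed
  have rep_eq: "rep u = rep v \<longleftrightarrow> k u = k v" if "u \<in> gverts \<Gamma>" "v \<in> gverts \<Gamma>" for u v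
  proof
    assume "rep u = rep v" then show "k u = k v" using rep(2)[OF that(1)] rep(2)[OF that(2)] by simp
  next
    assume "k u = k v" then show "rep u = rep v" by (simp add: rep_def)
  qed
  define \<Delta> where "\<Delta> = \<lparr>gverts = rep ` gverts \<Gamma>, gedges = emap rep ` gedges \<Gamma>\<rparr>"
  have edge: "\<exists>u v. (u, b, v) \<in> gedges \<Gamma> \<and> x = rep u \<and> y = rep v" if xy: "(x, b, y) \<in> gedges \<Delta>" for x b y
  proof -
    from xy obtain e where e: "e \<in> gedges \<Gamma>" "(x, b, y) = emap rep e" by (auto simp: \<Delta>_def)
    obtain u c v where [simp]: "e = (u, c, v)" by (cases e)
    show ?thesis using e by auto
  qed
  have "multi_core_graph B \<Delta>"
    unfolding multi_core_graph_def
  proof (intro conjI allI impI ballI)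
    show "finite (gverts \<Delta>)" "finite (gedges \<Delta>)" using multi_core_graphD[OF mc] by (simp_all add: \<Delta>_def)
    show "gedges \<Delta> \<subseteq> gverts \<Delta> \<times> B \<times> gverts \<Delta>"
    proof
      fix e assume "e \<in> gedges \<Delta>"
      then obtain x b y where e: "e = (x, b, y)" "(x, b, y) \<in> gedges \<Delta>" by (cases e) auto
      obtain u v where "(u, b, v) \<in> gedges \<Gamma>" "x = rep u" "y = rep v" using edge[OF e(2)] by blast
      then show "e \<in> gverts \<Delta> \<times> B \<times> gverts \<Delta>" using edge_ends[OF mc, of u b v] by (simp add: e(1) \<Delta>_def)
    qed
  next
    fix x b y y' assume a: "(x, b, y) \<in> gedges \<Delta>" "(x, b, y') \<in> gedges \<Delta>"
    obtain u v where uv: "(u, b, v) \<in> gedges \<Gamma>" "x = rep u" "y = rep v" using edge[OF a(1)] by blast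
    obtain u' v' where uv': "(u', b, v') \<in> gedges \<Gamma>" "x = rep u'" "y' = rep v'" using edge[OF a(2)] by blast
    show "y = y'"
      using rep_eq[of u u'] rep_eq[of v v'] folded[OF uv(1) uv'(1)] edge_ends[OF mc uv(1)] edge_ends[OF mc uv'(1)]
        uv uv' by simp
  next
    fix x b y y' assume a: "(y, b, x) \<in> gedges \<Delta>" "(y', b, x) \<in> gedges \<Delta>"
    obtain u v where uv: "(u, b, v) \<in> gedges \<Gamma>" "y = rep u" "x = rep v" using edge[OF a(1)] by blast
    obtain u' v' where uv': "(u', b, v') \<in> gedges \<Gamma>" "y' = rep u'" "x = rep v'" using edge[OF a(2)] by blast
    show "y = y'"
      using rep_eq[of u u'] rep_eq[of v v'] folded[OF uv(1) uv'(1)] edge_ends[OF mc uv(1)] edge_ends[OF mc uv'(1)]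
        uv uv' by simp
  next
    fix x assume "x \<in> gverts \<Delta>"
    then obtain v where v: "v \<in> gverts \<Gamma>" "x = rep v" by (auto simp: \<Delta>_def)
    then have x: "x \<in> gverts \<Gamma>" and rx: "rep x = x"
      using rep[OF v(1)] rep_eq[of "rep v" v] by auto
    have fin: "finite (gedges \<Delta>)" using multi_core_graphD(2)[OF mc] by (simp add: \<Delta>_def)
    have "card {e \<in> gedges \<Gamma>. fst e = x} \<le> card {e \<in> gedges \<Delta>. fst e = x}"
    proof (rule card_inj_on_le[of "emap rep"])
      show "inj_on (emap rep) {e \<in> gedges \<Gamma>. fst e = x}"
      proof (rule inj_onI)
        fix e e' assume *: "e \<in> {e \<in> gedges \<Gamma>. fst e = x}" "e' \<in> {e \<in> gedges \<Gamma>. fst e = x}" "emap rep e = emap rep e'"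
        obtain b y b' y' where "e = (x, b, y)" "e' = (x, b', y')" using * by (cases e, cases e') auto
        then show "e = e'" using * multi_core_graphD(4)[OF mc, of x b y y'] by auto
      qed
      show "emap rep ` {e \<in> gedges \<Gamma>. fst e = x} \<subseteq> {e \<in> gedges \<Delta>. fst e = x}"
      proof (rule image_subsetI)
        fix e assume e: "e \<in> {e \<in> gedges \<Gamma>. fst e = x}"
        then have "emap rep e \<in> gedges \<Delta>" by (simp add: \<Delta>_def)
        then show "emap rep e \<in> {e \<in> gedges \<Delta>. fst e = x}" using e rx by (simp add: emap_def)
      qed
    qed (use fin in simp)
    moreover have "card {e \<in> gedges \<Gamma>. snd (snd e) = x} \<le> card {e \<in> gedges \<Delta>. snd (snd e) = x}"
    proof (rule card_inj_on_le[of "emap rep"])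
      show "inj_on (emap rep) {e \<in> gedges \<Gamma>. snd (snd e) = x}"
      proof (rule inj_onI)
        fix e e' assume *: "e \<in> {e \<in> gedges \<Gamma>. snd (snd e) = x}" "e' \<in> {e \<in> gedges \<Gamma>. snd (snd e) = x}" "emap rep e = emap rep e'"
        obtain b y b' y' where "e = (y, b, x)" "e' = (y', b', x)" using * by (cases e, cases e') auto
        then show "e = e'" using * multi_core_graphD(5)[OF mc, of y b x y'] by auto
      qed
      show "emap rep ` {e \<in> gedges \<Gamma>. snd (snd e) = x} \<subseteq> {e \<in> gedges \<Delta>. snd (snd e) = x}"
      proof (rule image_subsetI)
        fix e assume e: "e \<in> {e \<in> gedges \<Gamma>. snd (snd e) = x}"
        then have "emap rep e \<in> gedges \<Delta>" by (simp add: \<Delta>_def)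
        then show "emap rep e \<in> {e \<in> gedges \<Delta>. snd (snd e) = x}" using e rx by (simp add: emap_def)
      qed
    qed (use fin in simp)
    ultimately show "card {e \<in> gedges \<Delta>. fst e = x} + card {e \<in> gedges \<Delta>. snd (snd e) = x} \<ge> 2"
      using multi_core_graphD(6)[OF mc x] by linarith
  qed
  then have "\<lparr>gdom = \<Gamma>, gcod = \<Delta>, gmap = rep\<rparr> \<in> sur B"
    using mc by (intro surI) (simp_all add: \<Delta>_def)
  moreover have "mor_kernel \<lparr>gdom = \<Gamma>, gcod = \<Delta>, gmap = rep\<rparr> = {(u, v). u \<in> gverts \<Gamma> \<and> v \<in> gverts \<Gamma> \<and> k u = k v}"
    using rep_eq by (auto simp: mor_kernel_def)
  ultimately show ?thesis using mor_kernel_in_kernels by (metis gmor.select_convs(1))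
qed

section \<open>The Moebius function of surjective morphisms\<close>

text \<open>Turns kernels on the codomain of \<open>\<theta>\<close> into those kernels on its domain that contain the kernel of
  \<open>\<theta>\<close>.\<close>
definition pullback :: "'f gmor \<Rightarrow> (vertex \<times> vertex) set \<Rightarrow> (vertex \<times> vertex) set" where
  "pullback \<theta> S = {(u, v). u \<in> gverts (gdom \<theta>) \<and> v \<in> gverts (gdom \<theta>) \<and> (gmap \<theta> u, gmap \<theta> v) \<in> S}"

definition kernel_moebius :: "'f set \<Rightarrow> 'f gmor \<Rightarrow> complex" where
  "kernel_moebius B \<eta> = (if \<eta> \<in> sur B then inclusion_moebius (kernels B (gdom \<eta>)) (Id_on (gverts (gdom \<eta>))) (mor_kernel \<eta>) else 0)"

lemma sur_compose:
  assumes "\<theta> \<in> sur B" "\<eta> \<in> sur B" "gcod \<theta> = gdom \<eta>"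
  shows "\<lparr>gdom = gdom \<theta>, gcod = gcod \<eta>, gmap = \<lambda>v. gmap \<eta> (gmap \<theta> v)\<rparr> \<in> sur B"
proof (rule surI)
  show "emap (gmap \<lparr>gdom = gdom \<theta>, gcod = gcod \<eta>, gmap = \<lambda>v. gmap \<eta> (gmap \<theta> v)\<rparr>) `
    gedges (gdom \<lparr>gdom = gdom \<theta>, gcod = gcod \<eta>, gmap = \<lambda>v. gmap \<eta> (gmap \<theta> v)\<rparr>)
    = gedges (gcod \<lparr>gdom = gdom \<theta>, gcod = gcod \<eta>, gmap = \<lambda>v. gmap \<eta> (gmap \<theta> v)\<rparr>)"
    using surD(4)[OF assms(1)] surD(4)[OF assms(2)] assms(3)
    by (simp add: emap_emap[symmetric] image_image[symmetric])
  show "gmap \<lparr>gdom = gdom \<theta>, gcod = gcod \<eta>, gmap = \<lambda>v. gmap \<eta> (gmap \<theta> v)\<rparr> `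
    gverts (gdom \<lparr>gdom = gdom \<theta>, gcod = gcod \<eta>, gmap = \<lambda>v. gmap \<eta> (gmap \<theta> v)\<rparr>)
    = gverts (gcod \<lparr>gdom = gdom \<theta>, gcod = gcod \<eta>, gmap = \<lambda>v. gmap \<eta> (gmap \<theta> v)\<rparr>)"
    using surD(3)[OF assms(1)] surD(3)[OF assms(2)] assms(3)
    by (simp add: image_image[symmetric])
qed (use surD[OF assms(1)] surD[OF assms(2)] in simp_all)

text \<open>Pulling back along \<open>\<theta>\<close> is an isomorphism from the interval below the kernel of \<open>\<eta>\<close> onto the interval
  between the kernels of \<open>\<theta>\<close> and of \<open>\<chi> = \<eta> \<circ> \<theta>\<close>: the pullback of the kernel of \<open>\<rho>\<close> is the
  kernel of \<open>\<rho> \<circ> \<theta>\<close>, and by factorisation every kernel in the second interval arises in this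
  way.\<close>
lemma inclusion_moebius_pullback:
  assumes p: "(\<theta>, \<eta>) \<in> decomp_pairs B \<chi>"
  shows "inclusion_moebius (kernels B (gdom \<eta>)) (Id_on (gverts (gdom \<eta>))) (mor_kernel \<eta>) = inclusion_moebius (kernels B (gdom \<chi>)) (mor_kernel \<theta>) (mor_kernel \<chi>)"
proof -
  note d = decomp_pairsD[OF p]
  have \<Gamma>: "multi_core_graph B (gdom \<chi>)" "multi_core_graph B (gdom \<eta>)"
    using surD(1)[OF d(1)] surD(1)[OF d(2)] d(3) by auto
  let ?V = "gverts (gdom \<chi>)" and ?W = "gverts (gdom \<eta>)"
  have onto: "gmap \<theta> ` ?V = ?W" using surD(3)[OF d(1)] d(3,4) by simp
  have pbId: "pullback \<theta> (Id_on ?W) = mor_kernel \<theta>"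
    using onto d(3) by (auto simp: pullback_def mor_kernel_def)
  have pbker: "pullback \<theta> (mor_kernel \<rho>) \<in> kernels B (gdom \<chi>)" if \<rho>: "\<rho> \<in> sur B" "gdom \<rho> = gdom \<eta>" for \<rho>
  proof -
    have "pullback \<theta> (mor_kernel \<rho>) = mor_kernel \<lparr>gdom = gdom \<theta>, gcod = gcod \<rho>, gmap = \<lambda>v. gmap \<rho> (gmap \<theta> v)\<rparr>"
      using onto d(3) \<rho>(2) by (auto simp: pullback_def mor_kernel_def)
    then show ?thesis using mor_kernel_in_kernels[OF sur_compose[OF d(1) \<rho>(1)]] d(3,4) \<rho>(2) by simp
  qed
  have pb\<eta>: "pullback \<theta> (mor_kernel \<eta>) = mor_kernel \<chi>"
    using onto d(3,6) by (auto simp: pullback_def mor_kernel_def)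
  have mono: "pullback \<theta> S \<subseteq> pullback \<theta> S' \<longleftrightarrow> S \<subseteq> S'" if "S \<subseteq> ?W \<times> ?W" for S S'
  proof
    assume a: "pullback \<theta> S \<subseteq> pullback \<theta> S'"
    show "S \<subseteq> S'"
    proof
      fix q assume q: "q \<in> S"
      then have "fst q \<in> gmap \<theta> ` ?V" "snd q \<in> gmap \<theta> ` ?V" using that onto by auto
      then obtain u v where "u \<in> ?V" "v \<in> ?V" "q = (gmap \<theta> u, gmap \<theta> v)"
        by (elim imageE) (metis prod.collapse)
      then show "q \<in> S'" using a q d(3) by (auto simp: pullback_def)
    qed
  qed (auto simp: pullback_def)
  have KW: "S \<subseteq> ?W \<times> ?W" if "S \<in> kernels B (gdom \<eta>)" for S
    using that by (auto simp: kernels_def mor_kernel_def)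
  have "bij_betw (pullback \<theta>) {z \<in> kernels B (gdom \<eta>). Id_on ?W \<subseteq> z \<and> z \<subseteq> mor_kernel \<eta>}
     {z \<in> kernels B (gdom \<chi>). mor_kernel \<theta> \<subseteq> z \<and> z \<subseteq> mor_kernel \<chi>}"
    unfolding bij_betw_def
  proof
    show "inj_on (pullback \<theta>) {z \<in> kernels B (gdom \<eta>). Id_on ?W \<subseteq> z \<and> z \<subseteq> mor_kernel \<eta>}"
      by (rule inj_onI) (metis (no_types, lifting) KW mem_Collect_eq mono order_refl subset_antisym)
    show "pullback \<theta> ` {z \<in> kernels B (gdom \<eta>). Id_on ?W \<subseteq> z \<and> z \<subseteq> mor_kernel \<eta>}
      = {z \<in> kernels B (gdom \<chi>). mor_kernel \<theta> \<subseteq> z \<and> z \<subseteq> mor_kernel \<chi>}"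
    proof (intro equalityI subsetI)
      fix R assume "R \<in> pullback \<theta> ` {z \<in> kernels B (gdom \<eta>). Id_on ?W \<subseteq> z \<and> z \<subseteq> mor_kernel \<eta>}"
      then obtain \<rho> where \<rho>: "\<rho> \<in> sur B" "gdom \<rho> = gdom \<eta>" "R = pullback \<theta> (mor_kernel \<rho>)"
          "Id_on ?W \<subseteq> mor_kernel \<rho>" "mor_kernel \<rho> \<subseteq> mor_kernel \<eta>" by (auto simp: kernels_def)
      then have "R \<in> kernels B (gdom \<chi>)" using pbker by auto
      moreover have "mor_kernel \<theta> \<subseteq> R" unfolding \<rho>(3) pbId[symmetric] using \<rho>(4) by (auto simp: pullback_def)
      moreover have "R \<subseteq> mor_kernel \<chi>" unfolding \<rho>(3) pb\<eta>[symmetric] using \<rho>(5) by (auto simp: pullback_def)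
      ultimately show "R \<in> {z \<in> kernels B (gdom \<chi>). mor_kernel \<theta> \<subseteq> z \<and> z \<subseteq> mor_kernel \<chi>}" by auto
    next
      fix R assume R: "R \<in> {z \<in> kernels B (gdom \<chi>). mor_kernel \<theta> \<subseteq> z \<and> z \<subseteq> mor_kernel \<chi>}"
      then obtain \<rho>' where \<rho>': "\<rho>' \<in> sur B" "gdom \<rho>' = gdom \<chi>" "R = mor_kernel \<rho>'" by (auto simp: kernels_def)
      obtain \<rho> where r: "(\<theta>, \<rho>) \<in> decomp_pairs B \<rho>'"
        using sur_factor[OF \<rho>'(1) d(1)] R \<rho>' d(3) by auto
      note dr = decomp_pairsD[OF r]
      have "pullback \<theta> (mor_kernel \<rho>) = R"
        using onto dr(3,4,6) d(3,4) \<rho>'(2) by (auto simp: pullback_def mor_kernel_def \<rho>'(3))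
      moreover have K: "mor_kernel \<rho> \<in> kernels B (gdom \<eta>)" using mor_kernel_in_kernels[OF dr(2)] dr(4) d(4) by simp
      moreover have "mor_kernel \<rho> \<subseteq> mor_kernel \<eta>"
        using mono[OF KW[OF K], of "mor_kernel \<eta>"] R calculation(1) pb\<eta> by auto
      ultimately show "R \<in> pullback \<theta> ` {z \<in> kernels B (gdom \<eta>). Id_on ?W \<subseteq> z \<and> z \<subseteq> mor_kernel \<eta>}"
        using kernels_above_Id[OF K] by blast
    qed
  qed
  from inclusion_moebius_iso[OF finite_kernels[OF \<Gamma>(2)] finite_kernels[OF \<Gamma>(1)] this _ pbId Id_in_kernels[OF \<Gamma>(2)]
      mor_kernel_in_kernels[OF d(2)] Id_subset_ker order_refl]
  show ?thesis using mono KW unfolding pb\<eta> by metis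
qed

lemma kernel_moebius_decomp:
  assumes "(\<theta>, \<eta>) \<in> decomp_pairs B \<chi>"
  shows "kernel_moebius B \<eta> = inclusion_moebius (kernels B (gdom \<chi>)) (mor_kernel \<theta>) (mor_kernel \<chi>)"
  using inclusion_moebius_pullback[OF assms] decomp_pairsD(2)[OF assms] by (simp add: kernel_moebius_def)

text \<open>An isomorphism between two morphisms is itself a surjective morphism with trivial kernel. This
  makes invariance under isomorphism a special case of the pullback formula.\<close>
lemma mor_iso_decomp:
  assumes s: "\<eta> \<in> sur B" and s': "\<eta>' \<in> sur B" and i: "mor_iso \<eta> \<eta>'"
  obtains \<theta> \<chi> where "(\<theta>, \<eta>') \<in> decomp_pairs B \<chi>" "gdom \<chi> = gdom \<eta>" "mor_kernel \<theta> = Id_on (gverts (gdom \<eta>))"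
    "mor_kernel \<chi> = mor_kernel \<eta>"
proof -
  obtain \<phi> \<psi> where \<phi>: "graph_iso (gdom \<eta>) (gdom \<eta>') \<phi>" and \<psi>: "graph_iso (gcod \<eta>) (gcod \<eta>') \<psi>"
    and c: "\<And>v. v \<in> gverts (gdom \<eta>) \<Longrightarrow> \<psi> (gmap \<eta> v) = gmap \<eta>' (\<phi> v)"
    using i by (auto simp: mor_iso_def)
  define \<theta> where "\<theta> = \<lparr>gdom = gdom \<eta>, gcod = gdom \<eta>', gmap = \<phi>\<rparr>"
  define \<chi> where "\<chi> = \<lparr>gdom = gdom \<eta>, gcod = gcod \<eta>', gmap = \<lambda>v. gmap \<eta>' (\<phi> v)\<rparr>"
  have th: "\<theta> \<in> sur B"
    using \<phi> surD[OF s] surD[OF s'] by (intro surI) (auto simp: \<theta>_def graph_iso_def bij_betw_def)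
  have "\<chi> \<in> sur B" using sur_compose[OF th s'] by (simp add: \<theta>_def \<chi>_def)
  have p: "(\<theta>, \<eta>') \<in> decomp_pairs B \<chi>" using th s' by (simp add: decomp_pairs_def \<theta>_def \<chi>_def)
  have kt: "mor_kernel \<theta> = Id_on (gverts (gdom \<eta>))"
    using \<phi> by (auto simp: mor_kernel_def \<theta>_def graph_iso_def bij_betw_def dest: inj_onD)
  have inj: "inj_on \<psi> (gverts (gcod \<eta>))" using \<psi> by (simp add: graph_iso_def bij_betw_def)
  have "gmap \<eta>' (\<phi> u) = gmap \<eta>' (\<phi> v) \<longleftrightarrow> gmap \<eta> u = gmap \<eta> v"
    if "u \<in> gverts (gdom \<eta>)" "v \<in> gverts (gdom \<eta>)" for u v
  proof -
    have "gmap \<eta> u \<in> gverts (gcod \<eta>)" "gmap \<eta> v \<in> gverts (gcod \<eta>)" using that surD(3)[OF s] by auto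
    then show ?thesis using c[OF that(1)] c[OF that(2)] inj by (metis inj_on_eq_iff)
  qed
  then have "mor_kernel \<chi> = mor_kernel \<eta>" by (auto simp: mor_kernel_def \<chi>_def)
  then show thesis using that p kt by (simp add: \<chi>_def)
qed

lemma convol_one_iff_ker:
  assumes "\<eta> \<in> sur B"
  shows "convol_one \<eta> = (if Id_on (gverts (gdom \<eta>)) = mor_kernel \<eta> then 1 else 0)"
proof -
  have "graph_iso (gdom \<eta>) (gcod \<eta>) (gmap \<eta>) \<longleftrightarrow> Id_on (gverts (gdom \<eta>)) = mor_kernel \<eta>" (is "?L \<longleftrightarrow> ?R")
  proof
    assume ?L then show ?R by (auto simp: mor_kernel_def graph_iso_def bij_betw_def dest: inj_onD)
  next
    assume R: ?R
    have "inj_on (gmap \<eta>) (gverts (gdom \<eta>))"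
    proof (rule inj_onI)
      fix u v assume "u \<in> gverts (gdom \<eta>)" "v \<in> gverts (gdom \<eta>)" "gmap \<eta> u = gmap \<eta> v"
      then have "(u, v) \<in> mor_kernel \<eta>" by (simp add: mor_kernel_def)
      then show "u = v" unfolding R[symmetric] by auto
    qed
    then show ?L using surD[OF assms] by (intro graph_isoI[of B]) (auto simp: bij_betw_def)
  qed
  then show ?thesis by (simp add: convol_one_def)
qed

lemma interval_kernels:
  "{S \<in> kernels B (gdom \<eta>). S \<subseteq> mor_kernel \<eta>} = {S \<in> kernels B (gdom \<eta>). Id_on (gverts (gdom \<eta>)) \<subseteq> S \<and> S \<subseteq> mor_kernel \<eta>}"
  using kernels_above_Id by blast

lemma kernel_moebius_sur_functions: "kernel_moebius B \<in> sur_functions B"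
proof -
  have "kernel_moebius B \<eta> = kernel_moebius B \<eta>'" if s: "\<eta> \<in> sur B" "\<eta>' \<in> sur B" "mor_iso \<eta> \<eta>'" for \<eta> \<eta>'
  proof -
    obtain \<theta> \<chi> where *: "(\<theta>, \<eta>') \<in> decomp_pairs B \<chi>" "gdom \<chi> = gdom \<eta>"
        "mor_kernel \<theta> = Id_on (gverts (gdom \<eta>))" "mor_kernel \<chi> = mor_kernel \<eta>"
      using mor_iso_decomp[OF s] by blast
    show ?thesis unfolding kernel_moebius_decomp[OF *(1)] using s(1) * by (simp add: kernel_moebius_def)
  qed
  moreover have "kernel_moebius B \<eta> = 0" if "\<eta> \<notin> sur B" for \<eta> using that by (simp add: kernel_moebius_def)
  ultimately show ?thesis unfolding sur_functions_def by blast
qed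

lemma kernel_moebius_convol_one:
  assumes s: "\<eta> \<in> sur B"
  shows "convol B (kernel_moebius B) (\<lambda>_. 1) \<eta> = convol_one \<eta>"
proof -
  have "convol B (kernel_moebius B) (\<lambda>_. 1) \<eta> = (\<Sum>S \<in> {S \<in> kernels B (gdom \<eta>). S \<subseteq> mor_kernel \<eta>}.
      inclusion_moebius (kernels B (gdom \<eta>)) (Id_on (gverts (gdom \<eta>))) S)"
    by (rule convol_by_kernels[OF s]) (use decomp_pairsD in \<open>fastforce simp: kernel_moebius_def\<close>)
  then show ?thesis
    unfolding interval_kernels convol_one_iff_ker[OF s]
    using inclusion_moebius_sum_upper[OF finite_kernels Id_in_kernels mor_kernel_in_kernels[OF s] Id_subset_ker] surD(1)[OF s] by simp
qed

lemma one_convol_kernel_moebius: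
  assumes s: "\<eta> \<in> sur B"
  shows "convol B (\<lambda>_. 1) (kernel_moebius B) \<eta> = convol_one \<eta>"
proof -
  have "convol B (\<lambda>_. 1) (kernel_moebius B) \<eta> = (\<Sum>S \<in> {S \<in> kernels B (gdom \<eta>). S \<subseteq> mor_kernel \<eta>}.
      inclusion_moebius (kernels B (gdom \<eta>)) S (mor_kernel \<eta>))"
    by (rule convol_by_kernels[OF s]) (simp add: kernel_moebius_decomp)
  then show ?thesis
    unfolding interval_kernels convol_one_iff_ker[OF s]
    using inclusion_moebius_sum_lower[OF finite_kernels mor_kernel_in_kernels[OF s] Id_in_kernels Id_subset_ker] surD(1)[OF s] by simp
qed

lemma mor_iso_same_ker:
  assumes s: "\<eta> \<in> sur B" "\<eta>' \<in> sur B" and d: "gdom \<eta> = gdom \<eta>'" and k: "mor_kernel \<eta> = mor_kernel \<eta>'"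
  shows "mor_iso \<eta> \<eta>'"
proof -
  obtain \<theta> where t: "(\<eta>, \<theta>) \<in> decomp_pairs B \<eta>'" using sur_factor[OF s(2,1)] d k by auto
  obtain \<theta>' where t': "(\<eta>', \<theta>') \<in> decomp_pairs B \<eta>'" using sur_factor[OF s(2,2)] by auto
  obtain \<phi> where "graph_iso (gcod \<eta>) (gcod \<eta>') \<phi>"
      "\<And>v. v \<in> gverts (gdom \<eta>') \<Longrightarrow> \<phi> (gmap \<eta> v) = gmap \<eta>' v"
    using decomp_rel_iff_ker[OF t t'] k unfolding decomp_rel_def by auto
  moreover have "graph_iso (gdom \<eta>) (gdom \<eta>') id"
    using d surD(1)[OF s(1)] by (intro graph_isoI[of B]) (auto simp: emap_def)
  ultimately show ?thesis unfolding mor_iso_def using d by (metis id_apply)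
qed

text \<open>Uniqueness of the convolution inverse: isolating the kernel of \<open>\<eta>\<close> in the sum for \<open>\<mu> * 1 = \<delta>\<close>
  expresses \<open>\<mu> \<eta>\<close> by the values at morphisms with smaller kernels.\<close>
lemma moebius_eq_kernel_moebius: "moebius B = kernel_moebius B"
  unfolding moebius_def
proof (rule the_equality)
  show "kernel_moebius B \<in> sur_functions B \<and> (\<forall>\<eta> \<in> sur B. convol B (kernel_moebius B) (\<lambda>_. 1) \<eta> = convol_one \<eta> \<and>
    convol B (\<lambda>_. 1) (kernel_moebius B) \<eta> = convol_one \<eta>)"
    using kernel_moebius_sur_functions kernel_moebius_convol_one one_convol_kernel_moebius by blast
next
  fix \<mu> assume \<mu>: "\<mu> \<in> sur_functions B \<and> (\<forall>\<eta> \<in> sur B. convol B \<mu> (\<lambda>_. 1) \<eta> = convol_one \<eta> \<and>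
    convol B (\<lambda>_. 1) \<mu> \<eta> = convol_one \<eta>)"
  have inv: "\<mu> \<eta> = \<mu> \<eta>'" if "\<eta> \<in> sur B" "\<eta>' \<in> sur B" "gdom \<eta> = gdom \<eta>'" "mor_kernel \<eta> = mor_kernel \<eta>'" for \<eta> \<eta>'
    using \<mu> mor_iso_same_ker[OF that] that by (auto simp: sur_functions_def)
  have "\<mu> \<eta> = kernel_moebius B \<eta>" if "\<eta> \<in> sur B" for \<eta>
    using that
  proof (induction "card (mor_kernel \<eta>)" arbitrary: \<eta> rule: less_induct)
    case less
    note s = less.prems
    let ?K = "kernels B (gdom \<eta>)"
    define m where "m S = \<mu> (SOME \<theta>. \<theta> \<in> sur B \<and> gdom \<theta> = gdom \<eta> \<and> mor_kernel \<theta> = S)" for S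
    have m: "m (mor_kernel \<theta>) = \<mu> \<theta>" if "\<theta> \<in> sur B" "gdom \<theta> = gdom \<eta>" for \<theta>
    proof -
      define \<theta>' where "\<theta>' = (SOME \<theta>'. \<theta>' \<in> sur B \<and> gdom \<theta>' = gdom \<eta> \<and> mor_kernel \<theta>' = mor_kernel \<theta>)"
      have "\<theta>' \<in> sur B \<and> gdom \<theta>' = gdom \<eta> \<and> mor_kernel \<theta>' = mor_kernel \<theta>"
        unfolding \<theta>'_def by (rule someI[of _ \<theta>]) (use that in simp)
      then show ?thesis using inv[of \<theta>' \<theta>] that by (simp add: m_def \<theta>'_def)
    qed
    have fin: "finite {S \<in> ?K. S \<subseteq> mor_kernel \<eta>}" using finite_kernels[OF surD(1)[OF s]] by simp
    have "(\<Sum>S \<in> {S \<in> ?K. S \<subseteq> mor_kernel \<eta>}. m S) = convol B \<mu> (\<lambda>_. 1) \<eta>"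
      by (rule convol_by_kernels[OF s, symmetric]) (use decomp_pairsD m in fastforce)
    also have "\<dots> = convol B (kernel_moebius B) (\<lambda>_. 1) \<eta>" using \<mu> s kernel_moebius_convol_one[OF s] by simp
    also have "\<dots> = (\<Sum>S \<in> {S \<in> ?K. S \<subseteq> mor_kernel \<eta>}. inclusion_moebius ?K (Id_on (gverts (gdom \<eta>))) S)"
      by (rule convol_by_kernels[OF s]) (use decomp_pairsD in \<open>fastforce simp: kernel_moebius_def\<close>)
    finally have eq: "(\<Sum>S \<in> {S \<in> ?K. S \<subseteq> mor_kernel \<eta>}. m S) = \<dots>" .
    have split: "{S \<in> ?K. S \<subseteq> mor_kernel \<eta>} = insert (mor_kernel \<eta>) {S \<in> ?K. S \<subset> mor_kernel \<eta>}"
      using mor_kernel_in_kernels[OF s] by auto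
    have "(\<Sum>S \<in> {S \<in> ?K. S \<subset> mor_kernel \<eta>}. m S) = (\<Sum>S \<in> {S \<in> ?K. S \<subset> mor_kernel \<eta>}. inclusion_moebius ?K (Id_on (gverts (gdom \<eta>))) S)"
    proof (intro sum.cong refl)
      fix S assume S: "S \<in> {S \<in> ?K. S \<subset> mor_kernel \<eta>}"
      then obtain \<theta> where t: "\<theta> \<in> sur B" "gdom \<theta> = gdom \<eta>" "S = mor_kernel \<theta>" by (auto simp: kernels_def)
      have "finite (mor_kernel \<eta>)"
        by (rule finite_subset[of _ "gverts (gdom \<eta>) \<times> gverts (gdom \<eta>)"])
          (use multi_core_graphD(1)[OF surD(1)[OF s]] in \<open>auto simp: mor_kernel_def\<close>)
      then have "card (mor_kernel \<theta>) < card (mor_kernel \<eta>)" using S t by (auto intro: psubset_card_mono)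
      from less.hyps[OF this t(1)] show "m S = inclusion_moebius ?K (Id_on (gverts (gdom \<eta>))) S"
        using m t by (simp add: kernel_moebius_def)
    qed
    then have "m (mor_kernel \<eta>) = inclusion_moebius ?K (Id_on (gverts (gdom \<eta>))) (mor_kernel \<eta>)"
      using eq fin unfolding split by simp
    then show ?case using m[OF s] s by (simp add: kernel_moebius_def)
  qed
  moreover have "\<mu> \<eta> = 0" if "\<eta> \<notin> sur B" for \<eta> using \<mu> that by (auto simp: sur_functions_def)
  ultimately show "\<mu> = kernel_moebius B" by (force simp: kernel_moebius_def)
qed

section \<open>Averages\<close>

lemma average_cong: "(\<And>x. x \<in> A \<Longrightarrow> f x = g x) \<Longrightarrow> average A f = average A g"
  unfolding average_def by (metis (mono_tags, lifting) sum.cong)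

lemma average_sum: "average A (\<lambda>x. \<Sum>s\<in>S. f s x) = (\<Sum>s\<in>S. average A (f s))"
  unfolding average_def by (subst sum.swap) (simp add: sum_divide_distrib)

lemma average_product:
  assumes bij: "bij_betw h (A \<times> Y) X"
  shows "average X F = average A (\<lambda>a. average Y (\<lambda>y. F (h (a, y))))"
proof -
  have "(\<Sum>x\<in>X. F x) = (\<Sum>q\<in>A \<times> Y. F (h q))" by (rule sum.reindex_bij_betw[OF bij, symmetric])
  also have "\<dots> = (\<Sum>a\<in>A. \<Sum>y\<in>Y. F (h (a, y)))" unfolding sum.cartesian_product by (simp add: case_prod_unfold)
  finally have "(\<Sum>x\<in>X. F x) = \<dots>" .
  moreover have "card X = card A * card Y"
    using bij_betw_same_card[OF bij] by (simp add: card_cartesian_product)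
  ultimately show ?thesis by (simp add: average_def sum_divide_distrib[symmetric] mult.commute)
qed

lemma average_fibres:
  assumes bij: "bij_betw h (A \<times> Y) X" and fin: "finite Y" "Y \<noteq> {}"
    and eq: "\<And>a y. a \<in> A \<Longrightarrow> y \<in> Y \<Longrightarrow> F (h (a, y)) = f a"
  shows "average X F = average A f"
proof -
  have "average Y (\<lambda>y. F (h (a, y))) = f a" if "a \<in> A" for a
    using fin by (simp add: average_def eq[OF that] card_gt_0_iff)
  then show ?thesis unfolding average_product[OF bij] by (rule average_cong)
qed

lemma prod_average:
  assumes "finite I" "\<And>i. i \<in> I \<Longrightarrow> finite (A i)"
  shows "(\<Prod>i\<in>I. average (A i) (f i)) = average (PiE I A) (\<lambda>a. \<Prod>i\<in>I. f i (a i))"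
  using assms by (simp add: average_def prod_dividef prod_sum_PiE card_PiE)

text \<open>If the points of \<open>X\<close> carry independent uniform values in \<open>K\<close>, then the values at the points \<open>c e\<close>
  are as if each fibre of \<open>c\<close> carried one independent uniform value, attached here to a
  representative of the fibre. The values outside the image of \<open>c\<close> are averaged out.\<close>
lemma average_along_map:
  assumes fin: "finite X" and c: "c ` E \<subseteq> X" and K: "finite K" "K \<noteq> {}"
    and \<Phi>: "\<And>f g. (\<And>e. e \<in> E \<Longrightarrow> f e = g e) \<Longrightarrow> \<Phi> f = \<Phi> g"
  defines "rep \<equiv> \<lambda>e. SOME e'. e' \<in> E \<and> c e' = c e"
  shows "average (X \<rightarrow>\<^sub>E K) (\<lambda>f. \<Phi> (\<lambda>e. f (c e))) = average (rep ` E \<rightarrow>\<^sub>E K) (\<lambda>f. \<Phi> (\<lambda>e. f (rep e)))"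
proof -
  have rep: "rep e \<in> E" "c (rep e) = c e" if "e \<in> E" for e
  proof -
    have "rep e \<in> E \<and> c (rep e) = c e" unfolding rep_def by (rule someI[of _ e]) (use that in simp)
    then show "rep e \<in> E" "c (rep e) = c e" by auto
  qed
  have rep_cong: "rep e = rep e'" if "c e = c e'" for e e' using that by (simp add: rep_def)
  define r where "r x = (SOME y. y \<in> rep ` E \<and> c y = x)" for x
  have rc: "r (c e) = rep e" if "e \<in> E" for e
  proof -
    have "r (c e) \<in> rep ` E \<and> c (r (c e)) = c e"
      unfolding r_def by (rule someI[of _ "rep e"]) (use that rep in auto)
    then obtain e' where "e' \<in> E" "r (c e) = rep e'" "c e' = c e" using rep by auto
    then show ?thesis using rep_cong[of e' e] by simp
  qed
  define h where "h = (\<lambda>(w, b). \<lambda>x \<in> X. if x \<in> c ` E then w (r x) else (b :: 'a \<Rightarrow> 'c) x)"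
  have "bij_betw h ((rep ` E \<rightarrow>\<^sub>E K) \<times> ((X - c ` E) \<rightarrow>\<^sub>E K)) (X \<rightarrow>\<^sub>E K)"
  proof (rule bij_betw_byWitness[where f' = "\<lambda>f. (\<lambda>y \<in> rep ` E. f (c y), \<lambda>x \<in> X - c ` E. f x)"])
    show "\<forall>q \<in> (rep ` E \<rightarrow>\<^sub>E K) \<times> ((X - c ` E) \<rightarrow>\<^sub>E K). (\<lambda>y \<in> rep ` E. h q (c y), \<lambda>x \<in> X - c ` E. h q x) = q"
    proof
      fix q assume "q \<in> (rep ` E \<rightarrow>\<^sub>E K) \<times> ((X - c ` E) \<rightarrow>\<^sub>E K)"
      then obtain w b where q: "q = (w, b)" "w \<in> rep ` E \<rightarrow>\<^sub>E K" "b \<in> (X - c ` E) \<rightarrow>\<^sub>E K" by auto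
      have "(\<lambda>y \<in> rep ` E. h q (c y)) = w"
      proof (rule extensionalityI[of _ "rep ` E"])
        fix y assume "y \<in> rep ` E"
        then obtain e where e: "e \<in> E" "y = rep e" by auto
        then have "c e \<in> X" using c by auto
        then show "(\<lambda>y \<in> rep ` E. h q (c y)) y = w y" using e rep rc by (simp add: h_def q(1))
      qed (use q in \<open>auto simp: PiE_def\<close>)
      moreover have "(\<lambda>x \<in> X - c ` E. h q x) = b"
        using q(3) by (intro extensionalityI[of _ "X - c ` E"]) (auto simp: PiE_def h_def q(1))
      ultimately show "(\<lambda>y \<in> rep ` E. h q (c y), \<lambda>x \<in> X - c ` E. h q x) = q" by (simp add: q(1))
    qed
    show "\<forall>f \<in> X \<rightarrow>\<^sub>E K. h (\<lambda>y \<in> rep ` E. f (c y), \<lambda>x \<in> X - c ` E. f x) = f"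
    proof
      fix f assume f: "f \<in> X \<rightarrow>\<^sub>E K"
      show "h (\<lambda>y \<in> rep ` E. f (c y), \<lambda>x \<in> X - c ` E. f x) = f"
      proof (rule extensionalityI[of _ X])
        fix x assume x: "x \<in> X"
        show "h (\<lambda>y \<in> rep ` E. f (c y), \<lambda>x \<in> X - c ` E. f x) x = f x"
        proof (cases "x \<in> c ` E")
          case True
          then obtain e where "e \<in> E" "x = c e" by auto
          then show ?thesis using x rc rep by (simp add: h_def)
        qed (use x in \<open>simp add: h_def\<close>)
      qed (use f in \<open>auto simp: PiE_def h_def\<close>)
    qed
    show "h ` ((rep ` E \<rightarrow>\<^sub>E K) \<times> ((X - c ` E) \<rightarrow>\<^sub>E K)) \<subseteq> X \<rightarrow>\<^sub>E K"
    proof (rule image_subsetI)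
      fix q assume "q \<in> (rep ` E \<rightarrow>\<^sub>E K) \<times> ((X - c ` E) \<rightarrow>\<^sub>E K)"
      then obtain w b where q: "q = (w, b)" "w \<in> rep ` E \<rightarrow>\<^sub>E K" "b \<in> (X - c ` E) \<rightarrow>\<^sub>E K" by auto
      have "h q x \<in> K" if x: "x \<in> X" for x
      proof (cases "x \<in> c ` E")
        case True
        then obtain e where "e \<in> E" "x = c e" by auto
        then show ?thesis using x rc PiE_mem[OF q(2), of "rep e"] by (simp add: h_def q(1))
      next
        case False
        then show ?thesis using x PiE_mem[OF q(3), of x] by (simp add: h_def q(1))
      qed
      moreover have "h q \<in> extensional X" unfolding h_def q(1) by simp
      ultimately show "h q \<in> X \<rightarrow>\<^sub>E K" by (simp add: PiE_iff)
    qed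
    show "(\<lambda>f. (\<lambda>y \<in> rep ` E. f (c y), \<lambda>x \<in> X - c ` E. f x)) ` (X \<rightarrow>\<^sub>E K) \<subseteq> (rep ` E \<rightarrow>\<^sub>E K) \<times> ((X - c ` E) \<rightarrow>\<^sub>E K)"
      using c rep by (auto simp: PiE_iff)
  qed
  then show ?thesis
  proof (rule average_fibres)
    show "finite ((X - c ` E) \<rightarrow>\<^sub>E K)" using fin K by (intro finite_PiE) auto
    show "(X - c ` E) \<rightarrow>\<^sub>E K \<noteq> {}" using K by (simp add: PiE_eq_empty_iff)
    fix w b assume "w \<in> rep ` E \<rightarrow>\<^sub>E K" "b \<in> (X - c ` E) \<rightarrow>\<^sub>E K"
    show "\<Phi> (\<lambda>e. h (w, b) (c e)) = \<Phi> (\<lambda>e. w (rep e))"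
      by (rule \<Phi>) (use c rc in \<open>auto simp: h_def\<close>)
  qed
qed

text \<open>The representatives of the fibres depend on the partition of \<open>E\<close> into fibres only. Hence so does the
  average.\<close>
lemma average_same_partition:
  assumes "finite X" "c ` E \<subseteq> X" "finite X'" "c' ` E \<subseteq> X'" "finite K" "K \<noteq> {}"
    and \<Phi>: "\<And>f g. (\<And>e. e \<in> E \<Longrightarrow> f e = g e) \<Longrightarrow> \<Phi> f = \<Phi> g"
    and same: "\<And>e e'. e \<in> E \<Longrightarrow> e' \<in> E \<Longrightarrow> c e = c e' \<longleftrightarrow> c' e = c' e'"
  shows "average (X \<rightarrow>\<^sub>E K) (\<lambda>f. \<Phi> (\<lambda>e. f (c e))) = average (X' \<rightarrow>\<^sub>E K) (\<lambda>f. \<Phi> (\<lambda>e. f (c' e)))"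
proof -
  have rep: "(SOME e'. e' \<in> E \<and> c e' = c e) = (SOME e'. e' \<in> E \<and> c' e' = c' e)" if "e \<in> E" for e
    by (rule arg_cong[of _ _ Eps]) (use same that in auto)
  then have img: "(\<lambda>e. SOME e'. e' \<in> E \<and> c e' = c e) ` E = (\<lambda>e. SOME e'. e' \<in> E \<and> c' e' = c' e) ` E"
    by (rule image_cong[OF refl])
  let ?r = "\<lambda>e. SOME e'. e' \<in> E \<and> c e' = c e" and ?r' = "\<lambda>e. SOME e'. e' \<in> E \<and> c' e' = c' e"
  have "average (X \<rightarrow>\<^sub>E K) (\<lambda>f. \<Phi> (\<lambda>e. f (c e))) = average (?r ` E \<rightarrow>\<^sub>E K) (\<lambda>f. \<Phi> (\<lambda>e. f (?r e)))"
    by (rule average_along_map[OF assms(1,2,5,6)]) (rule \<Phi>)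
  also have "\<dots> = average (?r' ` E \<rightarrow>\<^sub>E K) (\<lambda>f. \<Phi> (\<lambda>e. f (?r e)))"
    by (simp only: img)
  also have "\<dots> = average (?r' ` E \<rightarrow>\<^sub>E K) (\<lambda>f. \<Phi> (\<lambda>e. f (?r' e)))"
    by (rule average_cong, rule \<Phi>) (use rep in simp)
  also have "\<dots> = average (X' \<rightarrow>\<^sub>E K) (\<lambda>f. \<Phi> (\<lambda>e. f (c' e)))"
    by (rule average_along_map[OF assms(3,4,5,6), symmetric]) (rule \<Phi>)
  finally show ?thesis .
qed

section \<open>Words and paths\<close>

definition edge_along :: "vertex \<Rightarrow> 'f letter \<Rightarrow> vertex \<Rightarrow> vertex \<times> 'f \<times> vertex" where
  "edge_along u l u' = (if snd l then (u, fst l, u') else (u', fst l, u))"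

lemma flip_simps [simp]: "fst (flip l) = fst l" "snd (flip l) = (\<not> snd l)" "flip (flip l) = l"
  by (auto simp: flip_def)

lemma edge_along_flip [simp]: "edge_along u (flip l) u' = edge_along u' l u"
  by (simp add: edge_along_def)

lemma path_Cons: "path \<Gamma> u (l # xs) v \<longleftrightarrow> (\<exists>u'. edge_along u l u' \<in> gedges \<Gamma> \<and> path \<Gamma> u' xs v)"
  by (simp add: edge_along_def)

declare path.simps(2) [simp del]

lemma edge_alongD:
  assumes "multi_core_graph B \<Gamma>" "edge_along u l u' \<in> gedges \<Gamma>"
  shows "u \<in> gverts \<Gamma>" "u' \<in> gverts \<Gamma>" "fst l \<in> B"
  using multi_core_graphD(3)[OF assms(1)] assms(2) by (auto simp: edge_along_def split: if_splits)

lemma edge_along_target: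
  assumes "multi_core_graph B \<Gamma>" "edge_along u l u' \<in> gedges \<Gamma>" "edge_along u l u'' \<in> gedges \<Gamma>"
  shows "u' = u''"
  using multi_core_graphD(4,5)[OF assms(1)] assms(2,3) by (auto simp: edge_along_def split: if_splits)

lemma edge_along_source:
  assumes "multi_core_graph B \<Gamma>" "edge_along u l v \<in> gedges \<Gamma>" "edge_along u' l v \<in> gedges \<Gamma>"
  shows "u = u'"
  using edge_along_target[OF assms(1), of v "flip l"] assms(2,3) by simp

lemma emap_edge_along: "emap h (edge_along u l u') = edge_along (h u) l (h u')"
  by (simp add: edge_along_def)

lemma path_end: "path \<Gamma> u xs v \<Longrightarrow> v \<in> gverts \<Gamma>"
  by (induction xs arbitrary: u) (auto simp: path_Cons)

lemma path_start: "multi_core_graph B \<Gamma> \<Longrightarrow> path \<Gamma> u xs v \<Longrightarrow> u \<in> gverts \<Gamma>"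
  by (cases xs) (auto simp: path_Cons dest: edge_alongD)

lemma path_letters: "multi_core_graph B \<Gamma> \<Longrightarrow> path \<Gamma> u xs v \<Longrightarrow> fst ` set xs \<subseteq> B"
  by (induction xs arbitrary: u) (auto simp: path_Cons dest: edge_alongD)

lemma path_append: "path \<Gamma> u (xs @ ys) w \<longleftrightarrow> (\<exists>v. path \<Gamma> u xs v \<and> path \<Gamma> v ys w)"
  if "multi_core_graph B \<Gamma>"
proof (induction xs arbitrary: u)
  case Nil then show ?case using path_start[OF that, of u ys w] by auto
next
  case (Cons l xs) then show ?case by (auto simp: path_Cons)
qed

lemma inv_word_simps [simp]: "inv_word [] = []" "inv_word (l # xs) = inv_word xs @ [flip l]"
  by (auto simp: inv_word_def)

lemma path_single: "multi_core_graph B \<Gamma> \<Longrightarrow> path \<Gamma> u [l] v \<longleftrightarrow> edge_along u l v \<in> gedges \<Gamma>"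
  by (auto simp: path_Cons dest: edge_alongD)

lemma path_inv:
  assumes "multi_core_graph B \<Gamma>" "path \<Gamma> u xs v"
  shows "path \<Gamma> v (inv_word xs) u"
  using assms(2)
proof (induction xs arbitrary: u)
  case (Cons l xs)
  then obtain u' where "edge_along u l u' \<in> gedges \<Gamma>" "path \<Gamma> u' xs v" by (auto simp: path_Cons)
  with Cons.IH[of u'] have "path \<Gamma> v (inv_word xs) u'" "path \<Gamma> u' [flip l] u"
    by (simp_all add: path_single[OF assms(1)])
  then show ?case using path_append[OF assms(1)] by auto
qed simp

lemma path_emap:
  assumes "morphism B \<eta>" "path (gdom \<eta>) u xs v"
  shows "path (gcod \<eta>) (gmap \<eta> u) xs (gmap \<eta> v)"
  using assms(2)
proof (induction xs arbitrary: u)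
  case Nil then show ?case using assms(1) by (auto simp: morphism_def)
next
  case (Cons l xs)
  then obtain u' where u': "edge_along u l u' \<in> gedges (gdom \<eta>)" "path (gdom \<eta>) u' xs v"
    by (auto simp: path_Cons)
  then have "edge_along (gmap \<eta> u) l (gmap \<eta> u') \<in> gedges (gcod \<eta>)"
    using assms(1) by (auto simp: morphism_def simp flip: emap_edge_along)
  then show ?case using Cons.IH[OF u'(2)] by (auto simp: path_Cons)
qed

lemma inv_word_letters: "fst ` set (inv_word xs) = fst ` set xs"
  by (simp add: inv_word_def image_image)

context
  fixes F :: "('f, 'm) monoid_scheme"
  assumes F: "group F"
begin

interpretation F: group F by (rule F)

lemma eval_closed: "fst ` set xs \<subseteq> carrier F \<Longrightarrow> eval_word F xs \<in> carrier F"
  by (induction xs) auto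

lemma eval_append: "fst ` set xs \<subseteq> carrier F \<Longrightarrow> fst ` set ys \<subseteq> carrier F \<Longrightarrow>
    eval_word F (xs @ ys) = eval_word F xs \<otimes>\<^bsub>F\<^esub> eval_word F ys"
  by (induction xs) (auto simp: eval_closed F.m_assoc)


lemma eval_inv_word: "fst ` set xs \<subseteq> carrier F \<Longrightarrow> eval_word F (inv_word xs) = inv\<^bsub>F\<^esub> eval_word F xs"
proof (induction xs)
  case (Cons l xs)
  then have "fst ` set (inv_word xs) \<subseteq> carrier F" by (simp only: inv_word_letters) auto
  with Cons show ?case by (simp add: eval_append eval_closed F.inv_mult_group)
qed simp

end

definition cancel :: "'f letter \<Rightarrow> 'f letter list \<Rightarrow> 'f letter list" where
  "cancel l xs = (if xs \<noteq> [] \<and> hd xs = flip l then tl xs else l # xs)"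

definition reduce :: "'f letter list \<Rightarrow> 'f letter list" where
  "reduce xs = foldr cancel xs []"

lemma reduce_simps [simp]: "reduce [] = []" "reduce (l # xs) = cancel l (reduce xs)"
  by (simp_all add: reduce_def)

lemma reduced_cancel: "reduced xs \<Longrightarrow> reduced (cancel l xs)"
  by (cases xs) (auto simp: reduced_def cancel_def successively_Cons)

lemma reduced_reduce: "reduced (reduce xs)"
proof (induction xs)
  case Nil then show ?case by (simp add: reduced_def)
qed (simp add: reduced_cancel)

lemma cancel_letters: "fst ` set (cancel l xs) \<subseteq> insert (fst l) (fst ` set xs)"
  by (cases xs) (auto simp: cancel_def)

lemma reduce_letters: "fst ` set (reduce xs) \<subseteq> fst ` set xs"
proof (induction xs)
  case (Cons l xs)
  have "fst ` set (reduce (l # xs)) \<subseteq> insert (fst l) (fst ` set (reduce xs))"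
    using cancel_letters by simp
  also have "\<dots> \<subseteq> fst ` set (l # xs)" using Cons by auto
  finally show ?case .
qed simp

lemma eval_cancel:
  assumes "group F" "fst l \<in> carrier F" "fst ` set xs \<subseteq> carrier F"
  shows "eval_word F (cancel l xs) = eval_word F (l # xs)"
proof (cases "xs \<noteq> [] \<and> hd xs = flip l")
  case True
  interpret group F by (rule assms)
  from True obtain ys where ys: "xs = flip l # ys" by (cases xs) auto
  then have "eval_word F ys \<in> carrier F" using assms eval_closed by auto
  then show ?thesis using True assms ys by (auto simp: cancel_def m_assoc[symmetric])
qed (auto simp: cancel_def)

lemma eval_reduce:
  assumes "group F" "fst ` set xs \<subseteq> carrier F"
  shows "eval_word F (reduce xs) = eval_word F xs"
  using assms(2)
proof (induction xs)
  case (Cons l xs)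
  have "fst ` set (reduce xs) \<subseteq> carrier F"
    by (rule subset_trans[OF reduce_letters]) (use Cons.prems in auto)
  then show ?case using Cons eval_cancel[OF assms(1)] by simp
qed simp

lemma free_basis_group: "free_basis F B \<Longrightarrow> group F"
  by (simp add: free_basis_def)

lemma free_basis_subset: "free_basis F B \<Longrightarrow> B \<subseteq> carrier F"
  by (simp add: free_basis_def)

section \<open>Reading a labelling along a path\<close>

definition target :: "'f lgraph \<Rightarrow> vertex \<Rightarrow> 'f letter \<Rightarrow> vertex" where
  "target \<Gamma> u l = (THE u'. edge_along u l u' \<in> gedges \<Gamma>)"

definition letter_value :: "('k, 'l) monoid_scheme \<Rightarrow> (vertex \<times> 'f \<times> vertex \<Rightarrow> 'k) \<Rightarrow>
    vertex \<Rightarrow> 'f letter \<Rightarrow> vertex \<Rightarrow> 'k" where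
  "letter_value K \<beta> u l u' =
     (if snd l then \<beta> (edge_along u l u') else inv\<^bsub>K\<^esub> (\<beta> (edge_along u l u')))"

text \<open>The product of the labels along the path that starts at \<open>u\<close> and reads the given word. In a folded
  graph the word and the start determine the path.\<close>
primrec reading :: "('k, 'l) monoid_scheme \<Rightarrow> 'f lgraph \<Rightarrow> (vertex \<times> 'f \<times> vertex \<Rightarrow> 'k) \<Rightarrow>
    vertex \<Rightarrow> 'f letter list \<Rightarrow> 'k" where
  "reading K \<Gamma> \<beta> u [] = \<one>\<^bsub>K\<^esub>"
| "reading K \<Gamma> \<beta> u (l # xs) =
     letter_value K \<beta> u l (target \<Gamma> u l) \<otimes>\<^bsub>K\<^esub> reading K \<Gamma> \<beta> (target \<Gamma> u l) xs"

lemma target_eq: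
  assumes "multi_core_graph B \<Gamma>" "edge_along u l u' \<in> gedges \<Gamma>"
  shows "target \<Gamma> u l = u'"
  unfolding target_def using assms edge_along_target[OF assms(1)] by (intro the_equality) auto

lemma reading_Cons:
  assumes "multi_core_graph B \<Gamma>" "edge_along u l u' \<in> gedges \<Gamma>"
  shows "reading K \<Gamma> \<beta> u (l # xs) = letter_value K \<beta> u l u' \<otimes>\<^bsub>K\<^esub> reading K \<Gamma> \<beta> u' xs"
  by (simp add: target_eq[OF assms])

declare reading.simps(2) [simp del]

lemma reading_emap:
  assumes m: "morphism B \<eta>" and "path (gdom \<eta>) u xs v"
  shows "reading K (gcod \<eta>) \<beta> (gmap \<eta> u) xs = reading K (gdom \<eta>) (\<lambda>e. \<beta> (emap (gmap \<eta>) e)) u xs"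
  using assms(2)
proof (induction xs arbitrary: u)
  case (Cons l xs)
  have mc: "multi_core_graph B (gdom \<eta>)" "multi_core_graph B (gcod \<eta>)"
    using m by (auto simp: morphism_def)
  from Cons.prems obtain u' where u': "edge_along u l u' \<in> gedges (gdom \<eta>)" "path (gdom \<eta>) u' xs v"
    by (auto simp: path_Cons)
  then have "edge_along (gmap \<eta> u) l (gmap \<eta> u') \<in> gedges (gcod \<eta>)"
    using m by (auto simp: morphism_def simp flip: emap_edge_along)
  then show ?case
    using Cons.IH[OF u'(2)]
    by (simp add: reading_Cons[OF mc(1) u'(1)] reading_Cons[OF mc(2)] letter_value_def emap_edge_along)
qed simp

lemma reading_cong:
  assumes mc: "multi_core_graph B \<Gamma>" and "path \<Gamma> u xs v" and eq: "\<And>e. e \<in> gedges \<Gamma> \<Longrightarrow> \<beta> e = \<beta>' e"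
  shows "reading K \<Gamma> \<beta> u xs = reading K \<Gamma> \<beta>' u xs"
  using assms(2)
proof (induction xs arbitrary: u)
  case (Cons l xs)
  then obtain u' where "edge_along u l u' \<in> gedges \<Gamma>" "path \<Gamma> u' xs v" by (auto simp: path_Cons)
  then show ?case using Cons.IH eq by (simp add: reading_Cons[OF mc] letter_value_def)
qed simp

locale labelled_graph = group K for K (structure) +
  fixes B :: "'f set" and \<Gamma> :: "'f lgraph" and \<beta> :: "vertex \<times> 'f \<times> vertex \<Rightarrow> 'a"
  assumes mc: "multi_core_graph B \<Gamma>" and \<beta>: "\<And>e. e \<in> gedges \<Gamma> \<Longrightarrow> \<beta> e \<in> carrier K"
begin

lemma letter_value_closed: "edge_along u l u' \<in> gedges \<Gamma> \<Longrightarrow> letter_value K \<beta> u l u' \<in> carrier K"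
  using \<beta> by (simp add: letter_value_def)

lemma letter_value_flip:
  "edge_along u l u' \<in> gedges \<Gamma> \<Longrightarrow> letter_value K \<beta> u' (flip l) u = inv (letter_value K \<beta> u l u')"
  using \<beta> by (simp add: letter_value_def)

lemma reading_closed: "path \<Gamma> u xs v \<Longrightarrow> reading K \<Gamma> \<beta> u xs \<in> carrier K"
  by (induction xs arbitrary: u) (auto simp: path_Cons reading_Cons[OF mc] letter_value_closed)

lemma reading_append:
  assumes "path \<Gamma> u xs v" "path \<Gamma> v ys w"
  shows "reading K \<Gamma> \<beta> u (xs @ ys) = reading K \<Gamma> \<beta> u xs \<otimes> reading K \<Gamma> \<beta> v ys"
  using assms(1)
proof (induction xs arbitrary: u)
  case Nil then show ?case using assms reading_closed by simp
next
  case (Cons l xs)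
  then obtain u' where "edge_along u l u' \<in> gedges \<Gamma>" "path \<Gamma> u' xs v" by (auto simp: path_Cons)
  then show ?case
    using Cons.IH assms(2) by (simp add: reading_Cons[OF mc] m_assoc letter_value_closed reading_closed)
qed

lemma reading_single: "edge_along u l v \<in> gedges \<Gamma> \<Longrightarrow> reading K \<Gamma> \<beta> u [l] = letter_value K \<beta> u l v"
  by (simp add: reading_Cons[OF mc] letter_value_closed)

lemma reading_inv:
  assumes "path \<Gamma> u xs v"
  shows "reading K \<Gamma> \<beta> v (inv_word xs) = inv (reading K \<Gamma> \<beta> u xs)"
  using assms
proof (induction xs arbitrary: u)
  case (Cons l xs)
  then obtain u' where u': "edge_along u l u' \<in> gedges \<Gamma>" "path \<Gamma> u' xs v" by (auto simp: path_Cons)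
  have "reading K \<Gamma> \<beta> v (inv_word xs @ [flip l]) = inv (reading K \<Gamma> \<beta> u' xs) \<otimes> letter_value K \<beta> u' (flip l) u"
    using reading_append[OF path_inv[OF mc u'(2)], of "[flip l]" u] Cons.IH[OF u'(2)] u'
      reading_single[of u' "flip l" u] by (simp add: path_single[OF mc])
  then show ?case
    using u' by (simp add: reading_Cons[OF mc] letter_value_flip inv_mult_group letter_value_closed reading_closed)
qed simp

text \<open>By foldedness, reading a letter and then its inverse goes back along the same edge, so that the two
  labels cancel and the end point does not change.\<close>
lemma cancel_invariant:
  assumes "path \<Gamma> u (l # xs) v"
  shows "path \<Gamma> u (cancel l xs) v \<and> reading K \<Gamma> \<beta> u (cancel l xs) = reading K \<Gamma> \<beta> u (l # xs)"
proof (cases "xs \<noteq> [] \<and> hd xs = flip l")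
  case True
  then obtain ys where ys: "xs = flip l # ys" by (cases xs) auto
  then obtain u' u'' where e: "edge_along u l u' \<in> gedges \<Gamma>" "edge_along u'' l u' \<in> gedges \<Gamma>"
      and p: "path \<Gamma> u'' ys v"
    using assms by (auto simp: path_Cons)
  have [simp]: "u'' = u" using edge_along_source[OF mc e(2,1)] .
  have "reading K \<Gamma> \<beta> u (l # xs) = letter_value K \<beta> u l u' \<otimes> (inv (letter_value K \<beta> u l u') \<otimes> reading K \<Gamma> \<beta> u ys)"
    using e by (simp add: ys reading_Cons[OF mc e(1)] reading_Cons[OF mc, of u' "flip l" u] letter_value_flip)
  also have "\<dots> = reading K \<Gamma> \<beta> u ys"
    using reading_closed[of u ys v] p letter_value_closed[OF e(1)] by (simp add: m_assoc[symmetric])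
  finally show ?thesis using p by (simp add: cancel_def ys)
qed (use assms in \<open>auto simp: cancel_def\<close>)

lemma reduce_invariant:
  assumes "path \<Gamma> u xs v"
  shows "path \<Gamma> u (reduce xs) v \<and> reading K \<Gamma> \<beta> u (reduce xs) = reading K \<Gamma> \<beta> u xs"
  using assms
proof (induction xs arbitrary: u)
  case (Cons l xs)
  then obtain u' where u': "edge_along u l u' \<in> gedges \<Gamma>" "path \<Gamma> u' xs v" by (auto simp: path_Cons)
  then have "path \<Gamma> u (l # reduce xs) v" "reading K \<Gamma> \<beta> u (l # reduce xs) = reading K \<Gamma> \<beta> u (l # xs)"
    using Cons.IH[OF u'(2)] by (auto simp: path_Cons reading_Cons[OF mc])
  then show ?case using cancel_invariant by simp
qed simp

text \<open>The reading depends only on the element of the free group that the word represents: free reduction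
  does not change it, and the reduced form of an element is unique.\<close>
lemma reading_eval:
  assumes F: "free_basis F B" and p: "path \<Gamma> u xs v" "path \<Gamma> u ys w" and e: "eval_word F xs = eval_word F ys"
  shows "reading K \<Gamma> \<beta> u xs = reading K \<Gamma> \<beta> u ys"
proof -
  have g: "group F" and BF: "B \<subseteq> carrier F"
    and un: "\<And>g. g \<in> carrier F \<Longrightarrow> \<exists>!xs. xs \<in> reduced_words B \<and> eval_word F xs = g"
    using F by (auto simp: free_basis_def)
  have l: "fst ` set xs \<subseteq> B" "fst ` set ys \<subseteq> B" using path_letters[OF mc] p by auto
  then have "reduce xs \<in> reduced_words B" "reduce ys \<in> reduced_words B"
    using order_trans[OF reduce_letters l(1)] order_trans[OF reduce_letters l(2)] reduced_reduce
    by (auto simp: reduced_words_def)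
  moreover have "eval_word F (reduce xs) = eval_word F xs" "eval_word F (reduce ys) = eval_word F xs"
    using eval_reduce[OF g] l BF e by auto
  moreover have "eval_word F xs \<in> carrier F" using eval_closed[OF g] l BF by auto
  ultimately have "reduce xs = reduce ys" using un by blast
  then show ?thesis using reduce_invariant[OF p(1)] reduce_invariant[OF p(2)] by metis
qed

end

lemma labelled_graphI:
  "multi_core_graph B \<Gamma> \<Longrightarrow> group K \<Longrightarrow> \<beta> \<in> gedges \<Gamma> \<rightarrow>\<^sub>E carrier K \<Longrightarrow> labelled_graph K B \<Gamma> \<beta>"
  by (auto simp: labelled_graph_def labelled_graph_axioms_def)

section \<open>Connected components\<close>

definition connected :: "'f lgraph \<Rightarrow> (vertex \<times> vertex) set" where
  "connected \<Gamma> = {(u, v). \<exists>xs. path \<Gamma> u xs v}"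

lemma components_connected: "components \<Gamma> = gverts \<Gamma> // connected \<Gamma>"
  by (simp add: components_def connected_def)

lemma equiv_connected:
  assumes mc: "multi_core_graph B \<Gamma>"
  shows "equiv (gverts \<Gamma>) (connected \<Gamma>)"
proof (rule equivI)
  show "connected \<Gamma> \<subseteq> gverts \<Gamma> \<times> gverts \<Gamma>"
    using path_start[OF mc] path_end by (auto simp: connected_def)
  show "refl_on (gverts \<Gamma>) (connected \<Gamma>)"
  proof (rule refl_onI)
    fix x assume "x \<in> gverts \<Gamma>"
    then have "path \<Gamma> x [] x" by simp
    then show "(x, x) \<in> connected \<Gamma>" unfolding connected_def by blast
  qed
  show "sym (connected \<Gamma>)"
    using path_inv[OF mc] unfolding connected_def sym_def by blast
  show "trans (connected \<Gamma>)"
    using path_append[OF mc] unfolding connected_def trans_def by blast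
qed

definition comp_of :: "'f lgraph \<Rightarrow> vertex \<Rightarrow> vertex set" where
  "comp_of \<Gamma> v = connected \<Gamma> `` {v}"

text \<open>The empty path at the base point makes the homomorphism that a labelling induces literally equal,
  and not merely conjugate, to the one from which the labelling is built below.\<close>
definition tree_path :: "'f lgraph \<Rightarrow> vertex \<Rightarrow> 'f letter list" where
  "tree_path \<Gamma> v = (if v = base (comp_of \<Gamma> v) then [] else connecting \<Gamma> (base (comp_of \<Gamma> v)) v)"

context
  fixes B :: "'f set" and \<Gamma> :: "'f lgraph"
  assumes mc: "multi_core_graph B \<Gamma>"
begin

lemma comp_of_in: "v \<in> gverts \<Gamma> \<Longrightarrow> comp_of \<Gamma> v \<in> components \<Gamma>"
  by (simp add: comp_of_def components_connected quotientI)

lemma comp_of_self: "v \<in> gverts \<Gamma> \<Longrightarrow> v \<in> comp_of \<Gamma> v"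
  using equiv_class_self[OF equiv_connected[OF mc]] by (simp add: comp_of_def)

lemma comp_of_unique: "C \<in> components \<Gamma> \<Longrightarrow> v \<in> C \<Longrightarrow> C = comp_of \<Gamma> v"
  unfolding components_connected comp_of_def
  by (metis (no_types) Image_singleton_iff equiv_class_eq equiv_connected[OF mc] quotientE)

lemma component_subset: "C \<in> components \<Gamma> \<Longrightarrow> C \<subseteq> gverts \<Gamma>"
  unfolding components_connected using in_quotient_imp_subset[OF equiv_connected[OF mc]] by blast

lemma base_in: "C \<in> components \<Gamma> \<Longrightarrow> base C \<in> C"
  unfolding components_connected base_def
  using in_quotient_imp_non_empty[OF equiv_connected[OF mc]] by (simp add: some_in_eq)

lemma comp_of_base: "C \<in> components \<Gamma> \<Longrightarrow> comp_of \<Gamma> (base C) = C"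
  using comp_of_unique base_in by metis

lemma finite_components: "finite (components \<Gamma>)"
  unfolding components_connected
  by (rule finite_quotient[OF multi_core_graphD(1)[OF mc] equiv_type[OF equiv_connected[OF mc]]])

lemma path_comp_of: "path \<Gamma> u xs v \<Longrightarrow> comp_of \<Gamma> u = comp_of \<Gamma> v"
  unfolding comp_of_def by (rule equiv_class_eq[OF equiv_connected[OF mc]]) (auto simp: connected_def)

lemma connecting_path:
  assumes "C \<in> components \<Gamma>" "u \<in> C" "v \<in> C"
  shows "path \<Gamma> u (connecting \<Gamma> u v) v"
proof -
  have "(u, v) \<in> connected \<Gamma>"
    using assms comp_of_unique[OF assms(1,2)] by (auto simp: comp_of_def)
  then obtain xs where "path \<Gamma> u xs v" by (auto simp: connected_def)
  then show ?thesis unfolding connecting_def by (rule someI)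
qed

lemma tree_path:
  assumes "v \<in> gverts \<Gamma>"
  shows "path \<Gamma> (base (comp_of \<Gamma> v)) (tree_path \<Gamma> v) v"
  using connecting_path[OF comp_of_in base_in[OF comp_of_in] comp_of_self] assms
  by (auto simp: tree_path_def)

lemma tree_path_base: "C \<in> components \<Gamma> \<Longrightarrow> tree_path \<Gamma> (base C) = []"
  by (simp add: tree_path_def comp_of_base)

end

section \<open>Homomorphisms as edge labellings\<close>

text \<open>The homomorphism on the fundamental group of the component \<open>C\<close> that the labelling \<open>\<beta>\<close> induces.\<close>
definition holonomy :: "('f, 'm) monoid_scheme \<Rightarrow> ('k, 'l) monoid_scheme \<Rightarrow> 'f lgraph \<Rightarrow>
    (vertex \<times> 'f \<times> vertex \<Rightarrow> 'k) \<Rightarrow> vertex set \<Rightarrow> 'f \<Rightarrow> 'k" where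
  "holonomy F K \<Gamma> \<beta> C = (\<lambda>x \<in> pi1_lab F \<Gamma> (base C).
     reading K \<Gamma> \<beta> (base C) (SOME xs. path \<Gamma> (base C) xs (base C) \<and> eval_word F xs = x))"

text \<open>The gauge is pinned to 1 at the base points, as another value there would conjugate the
  homomorphism.\<close>
definition at_vertex :: "('k, 'l) monoid_scheme \<Rightarrow> 'f lgraph \<Rightarrow> (vertex \<Rightarrow> 'k) \<Rightarrow> vertex \<Rightarrow> 'k" where
  "at_vertex K \<Gamma> g v = (if v = base (comp_of \<Gamma> v) then \<one>\<^bsub>K\<^esub> else g v)"

definition based :: "('f, 'm) monoid_scheme \<Rightarrow> 'f lgraph \<Rightarrow> vertex \<Rightarrow> 'f letter list \<Rightarrow> vertex \<Rightarrow> 'f" where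
  "based F \<Gamma> u xs v = eval_word F (tree_path \<Gamma> u @ xs @ inv_word (tree_path \<Gamma> v))"

text \<open>The labelling with prescribed homomorphisms \<open>\<alpha>\<close> for which the reading along the tree path to \<open>v\<close>
  is \<open>g v\<close>. It is the gauge transform by \<open>g\<close> of the labelling that gives to an edge the value of \<open>\<alpha>\<close>
  at the corresponding loop.\<close>
definition glue :: "('f, 'm) monoid_scheme \<Rightarrow> ('k, 'l) monoid_scheme \<Rightarrow> 'f lgraph \<Rightarrow>
    (vertex set \<Rightarrow> 'f \<Rightarrow> 'k) \<Rightarrow> (vertex \<Rightarrow> 'k) \<Rightarrow> vertex \<times> 'f \<times> vertex \<Rightarrow> 'k" where
  "glue F K \<Gamma> \<alpha> g = (\<lambda>e \<in> gedges \<Gamma>. case e of (u, b, v) \<Rightarrow>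
     inv\<^bsub>K\<^esub> (at_vertex K \<Gamma> g u) \<otimes>\<^bsub>K\<^esub> \<alpha> (comp_of \<Gamma> u) (based F \<Gamma> u [(b, True)] v) \<otimes>\<^bsub>K\<^esub> at_vertex K \<Gamma> g v)"

context
  fixes F :: "('f, 'm) monoid_scheme" and B :: "'f set" and \<Gamma> :: "'f lgraph"
    and K :: "('k, 'l) monoid_scheme"
  assumes F: "free_basis F B" and mc: "multi_core_graph B \<Gamma>" and K: "group K"
begin

interpretation K: group K by (rule K)

interpretation F: group F by (rule free_basis_group[OF F])

lemma path_carrier: "path \<Gamma> u xs v \<Longrightarrow> fst ` set xs \<subseteq> carrier F"
  using path_letters[OF mc] free_basis_subset[OF F] by blast

lemma pi1_mult:
  assumes "x \<in> pi1_lab F \<Gamma> p" "y \<in> pi1_lab F \<Gamma> p"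
  shows "x \<otimes>\<^bsub>F\<^esub> y \<in> pi1_lab F \<Gamma> p"
proof -
  obtain xs ys where "path \<Gamma> p xs p" "path \<Gamma> p ys p" "x = eval_word F xs" "y = eval_word F ys"
    using assms by (auto simp: pi1_lab_def)
  then have "path \<Gamma> p (xs @ ys) p" "x \<otimes>\<^bsub>F\<^esub> y = eval_word F (xs @ ys)"
    using path_append[OF mc] eval_append[OF F.group_axioms] path_carrier by auto
  then show ?thesis by (auto simp: pi1_lab_def)
qed

lemma pi1_closed: "x \<in> pi1_lab F \<Gamma> p \<Longrightarrow> x \<in> carrier F"
  using eval_closed[OF F.group_axioms path_carrier[of p _ p]] by (auto simp: pi1_lab_def)

lemma pi1_inv: "x \<in> pi1_lab F \<Gamma> p \<Longrightarrow> inv\<^bsub>F\<^esub> x \<in> pi1_lab F \<Gamma> p"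
proof -
  assume "x \<in> pi1_lab F \<Gamma> p"
  then obtain xs where xs: "path \<Gamma> p xs p" "x = eval_word F xs" by (auto simp: pi1_lab_def)
  then have "inv\<^bsub>F\<^esub> x = eval_word F (inv_word xs)" using eval_inv_word[OF F.group_axioms path_carrier] by simp
  then show ?thesis unfolding pi1_lab_def using path_inv[OF mc xs(1)] by blast
qed

lemma homsD:
  assumes "\<alpha> \<in> homs F J K"
  shows "\<And>x. x \<in> J \<Longrightarrow> \<alpha> x \<in> carrier K"
    "\<And>x y. x \<in> J \<Longrightarrow> y \<in> J \<Longrightarrow> \<alpha> (x \<otimes>\<^bsub>F\<^esub> y) = \<alpha> x \<otimes>\<^bsub>K\<^esub> \<alpha> y" "\<alpha> \<in> extensional J"
  using assms by (auto simp: homs_def hom_def)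

lemma homs_one:
  assumes "\<alpha> \<in> homs F (pi1_lab F \<Gamma> p) K" "p \<in> gverts \<Gamma>"
  shows "\<alpha> \<one>\<^bsub>F\<^esub> = \<one>\<^bsub>K\<^esub>"
proof -
  have "path \<Gamma> p [] p" using assms by simp
  then have "eval_word F [] \<in> pi1_lab F \<Gamma> p" unfolding pi1_lab_def by blast
  then have one: "\<one>\<^bsub>F\<^esub> \<in> pi1_lab F \<Gamma> p" by simp
  have "\<alpha> \<one>\<^bsub>F\<^esub> \<otimes>\<^bsub>K\<^esub> \<alpha> \<one>\<^bsub>F\<^esub> = \<alpha> \<one>\<^bsub>F\<^esub>"
    using homsD(2)[OF assms(1) one one] by simp
  then show ?thesis using K.l_cancel_one[of "\<alpha> \<one>\<^bsub>F\<^esub>" "\<alpha> \<one>\<^bsub>F\<^esub>"] homsD(1)[OF assms(1) one] by simp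
qed

lemma homs_inv:
  assumes "\<alpha> \<in> homs F (pi1_lab F \<Gamma> p) K" "p \<in> gverts \<Gamma>" "x \<in> pi1_lab F \<Gamma> p"
  shows "\<alpha> (inv\<^bsub>F\<^esub> x) = inv\<^bsub>K\<^esub> (\<alpha> x)"
proof -
  have "\<alpha> (inv\<^bsub>F\<^esub> x) \<otimes>\<^bsub>K\<^esub> \<alpha> x = \<one>\<^bsub>K\<^esub>"
    using homsD(2)[OF assms(1) pi1_inv[OF assms(3)] assms(3)] homs_one[OF assms(1,2)] pi1_closed[OF assms(3)]
    by simp
  then show ?thesis
    using K.inv_equality[of "\<alpha> (inv\<^bsub>F\<^esub> x)" "\<alpha> x"] homsD(1)[OF assms(1)] assms(3) pi1_inv[OF assms(3)] by simp
qed

lemma based_path: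
  assumes p: "path \<Gamma> u xs v" and C: "C = comp_of \<Gamma> u"
  shows "path \<Gamma> (base C) (tree_path \<Gamma> u @ xs @ inv_word (tree_path \<Gamma> v)) (base C)"
proof -
  have "u \<in> gverts \<Gamma>" "v \<in> gverts \<Gamma>" using path_start[OF mc p] path_end[OF p] by auto
  then show ?thesis
    using tree_path[OF mc, of u] path_inv[OF mc tree_path[OF mc, of v]] p path_comp_of[OF mc p] C
    by (auto simp: path_append[OF mc])
qed

lemma based_in_pi1:
  "path \<Gamma> u xs v \<Longrightarrow> C = comp_of \<Gamma> u \<Longrightarrow> based F \<Gamma> u xs v \<in> pi1_lab F \<Gamma> (base C)"
  using based_path unfolding based_def pi1_lab_def by blast

lemma tree_path_carrier: "v \<in> gverts \<Gamma> \<Longrightarrow> fst ` set (tree_path \<Gamma> v) \<subseteq> carrier F"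
  using tree_path[OF mc] path_carrier by blast

lemma based_eq:
  assumes "path \<Gamma> u xs v"
  shows "based F \<Gamma> u xs v =
    eval_word F (tree_path \<Gamma> u) \<otimes>\<^bsub>F\<^esub> eval_word F xs \<otimes>\<^bsub>F\<^esub> inv\<^bsub>F\<^esub> eval_word F (tree_path \<Gamma> v)"
proof -
  have "u \<in> gverts \<Gamma>" "v \<in> gverts \<Gamma>" using path_start[OF mc assms] path_end[OF assms] by auto
  note c = tree_path_carrier[OF this(1)] tree_path_carrier[OF this(2)] path_carrier[OF assms]
  moreover have i: "fst ` set (inv_word (tree_path \<Gamma> v)) \<subseteq> carrier F"
    using c(2) by (simp only: inv_word_letters)
  ultimately have "fst ` set (xs @ inv_word (tree_path \<Gamma> v)) \<subseteq> carrier F"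
    by (simp only: set_append image_Un Un_subset_iff)
  then show ?thesis
    using c i by (simp add: based_def eval_append[OF F.group_axioms] eval_inv_word[OF F.group_axioms] eval_closed[OF F.group_axioms] F.m_assoc)
qed

lemma based_append:
  assumes "path \<Gamma> u xs v" "path \<Gamma> v ys w"
  shows "based F \<Gamma> u (xs @ ys) w = based F \<Gamma> u xs v \<otimes>\<^bsub>F\<^esub> based F \<Gamma> v ys w"
proof -
  have "path \<Gamma> u (xs @ ys) w" using assms path_append[OF mc] by blast
  moreover have V: "u \<in> gverts \<Gamma>" "v \<in> gverts \<Gamma>" "w \<in> gverts \<Gamma>"
    using path_start[OF mc assms(1)] path_end[OF assms(1)] path_end[OF assms(2)] by auto
  have cancel: "(a \<otimes>\<^bsub>F\<^esub> b \<otimes>\<^bsub>F\<^esub> inv\<^bsub>F\<^esub> c) \<otimes>\<^bsub>F\<^esub> (c \<otimes>\<^bsub>F\<^esub> d \<otimes>\<^bsub>F\<^esub> e) = a \<otimes>\<^bsub>F\<^esub> (b \<otimes>\<^bsub>F\<^esub> d) \<otimes>\<^bsub>F\<^esub> e"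
    if "a \<in> carrier F" "b \<in> carrier F" "c \<in> carrier F" "d \<in> carrier F" "e \<in> carrier F" for a b c d e
  proof -
    have "inv\<^bsub>F\<^esub> c \<otimes>\<^bsub>F\<^esub> (c \<otimes>\<^bsub>F\<^esub> (d \<otimes>\<^bsub>F\<^esub> e)) = d \<otimes>\<^bsub>F\<^esub> e" using that by (simp add: F.m_assoc[symmetric])
    then show ?thesis using that by (simp add: F.m_assoc)
  qed
  ultimately show ?thesis
    using assms cancel eval_closed[OF F.group_axioms tree_path_carrier[OF V(1)]]
      eval_closed[OF F.group_axioms tree_path_carrier[OF V(2)]] eval_closed[OF F.group_axioms tree_path_carrier[OF V(3)]]
      eval_closed[OF F.group_axioms path_carrier[OF assms(1)]] eval_closed[OF F.group_axioms path_carrier[OF assms(2)]]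
    by (simp add: based_eq eval_append[OF F.group_axioms path_carrier[OF assms(1)] path_carrier[OF assms(2)]])
qed

lemma based_Nil: "v \<in> gverts \<Gamma> \<Longrightarrow> based F \<Gamma> v [] v = \<one>\<^bsub>F\<^esub>"
  using tree_path_carrier by (simp add: based_eq eval_closed[OF F.group_axioms])

lemma based_flip:
  assumes "edge_along u l v \<in> gedges \<Gamma>"
  shows "based F \<Gamma> v [flip l] u = inv\<^bsub>F\<^esub> based F \<Gamma> u [l] v"
proof -
  have p: "path \<Gamma> u [l] v" "path \<Gamma> v [flip l] u" using assms by (auto simp: path_single[OF mc])
  have "based F \<Gamma> v [flip l] u \<otimes>\<^bsub>F\<^esub> based F \<Gamma> u [l] v = based F \<Gamma> v ([flip l] @ [l]) v"
    by (rule based_append[OF p(2,1), symmetric])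
  also have "\<dots> = \<one>\<^bsub>F\<^esub>"
  proof -
    have "path \<Gamma> v ([flip l] @ [l]) v" using p path_append[OF mc] by blast
    moreover have "fst l \<in> carrier F" using p path_carrier by fastforce
    moreover have "v \<in> gverts \<Gamma>" using edge_alongD[OF mc assms] by auto
    ultimately show ?thesis
      using tree_path_carrier by (simp add: based_eq eval_closed[OF F.group_axioms])
  qed
  finally show ?thesis
    using F.inv_equality pi1_closed[OF based_in_pi1[OF p(1) refl]] pi1_closed[OF based_in_pi1[OF p(2) refl]]
    by simp
qed

text \<open>The gauge factors at the inner vertices of the path cancel, and the loops of the successive edges
  multiply to the loop of the whole path.\<close>
lemma reading_glue:
  assumes \<alpha>: "\<And>C. C \<in> components \<Gamma> \<Longrightarrow> \<alpha> C \<in> homs F (pi1_lab F \<Gamma> (base C)) K"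
    and g: "\<And>v. v \<in> gverts \<Gamma> \<Longrightarrow> at_vertex K \<Gamma> g v \<in> carrier K"
    and p: "path \<Gamma> u xs v"
  shows "reading K \<Gamma> (glue F K \<Gamma> \<alpha> g) u xs =
    inv\<^bsub>K\<^esub> (at_vertex K \<Gamma> g u) \<otimes>\<^bsub>K\<^esub> \<alpha> (comp_of \<Gamma> u) (based F \<Gamma> u xs v) \<otimes>\<^bsub>K\<^esub> at_vertex K \<Gamma> g v"
  using p
proof (induction xs arbitrary: u)
  case Nil
  then have v: "v \<in> gverts \<Gamma>" "u = v" by auto
  note c = comp_of_in[OF mc v(1)]
  have "base (comp_of \<Gamma> v) \<in> gverts \<Gamma>" using base_in[OF mc c] component_subset[OF mc c] by auto
  then show ?case
    using homs_one[OF \<alpha>[OF c]] g[OF v(1)] v by (simp add: based_Nil)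
next
  case (Cons l xs)
  then obtain u' where e: "edge_along u l u' \<in> gedges \<Gamma>" and p': "path \<Gamma> u' xs v" by (auto simp: path_Cons)
  have pl: "path \<Gamma> u [l] u'" using e by (simp add: path_single[OF mc])
  have V: "u \<in> gverts \<Gamma>" "u' \<in> gverts \<Gamma>" "v \<in> gverts \<Gamma>"
    using edge_alongD[OF mc e] path_end[OF p'] by auto
  define C where "C = comp_of \<Gamma> u"
  have C1: "C \<in> components \<Gamma>" using comp_of_in[OF mc V(1)] by (simp add: C_def)
  have C: "C \<in> components \<Gamma>" "comp_of \<Gamma> u' = C" "base C \<in> gverts \<Gamma>"
    using C1 path_comp_of[OF mc pl] base_in[OF mc C1] component_subset[OF mc C1]
    by (auto simp: C_def)
  note hom = homsD[OF \<alpha>[OF C(1)]]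
  let ?g = "at_vertex K \<Gamma> g"
  have b1: "based F \<Gamma> u [l] u' \<in> pi1_lab F \<Gamma> (base C)" using based_in_pi1[OF pl] C_def by simp
  have b2: "based F \<Gamma> u' xs v \<in> pi1_lab F \<Gamma> (base C)" using based_in_pi1[OF p'] C by simp
  have lv: "letter_value K (glue F K \<Gamma> \<alpha> g) u l u' = inv\<^bsub>K\<^esub> (?g u) \<otimes>\<^bsub>K\<^esub> \<alpha> C (based F \<Gamma> u [l] u') \<otimes>\<^bsub>K\<^esub> ?g u'"
  proof (cases "snd l")
    case True
    then have "l = (fst l, True)" by (cases l) auto
    then show ?thesis using e True by (simp add: letter_value_def glue_def edge_along_def C_def)
  next
    case False
    then have l: "flip l = (fst l, True)" by (simp add: flip_def)
    have b3: "based F \<Gamma> u' [flip l] u \<in> pi1_lab F \<Gamma> (base C)"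
      using based_in_pi1[of u' "[flip l]" u] e C by (simp add: path_single[OF mc])
    have "based F \<Gamma> u [l] u' = inv\<^bsub>F\<^esub> based F \<Gamma> u' [flip l] u"
      using based_flip[of u' "flip l" u] e by simp
    then have "\<alpha> C (based F \<Gamma> u [l] u') = inv\<^bsub>K\<^esub> (\<alpha> C (based F \<Gamma> u' [flip l] u))"
      using homs_inv[OF \<alpha>[OF C(1)] C(3) b3] by simp
    then show ?thesis
      using e False l C(2) g[OF V(1)] g[OF V(2)] hom(1)[OF b3]
      by (simp add: letter_value_def glue_def edge_along_def K.inv_mult_group K.m_assoc)
  qed
  have cancel: "(a \<otimes>\<^bsub>K\<^esub> b \<otimes>\<^bsub>K\<^esub> c) \<otimes>\<^bsub>K\<^esub> (inv\<^bsub>K\<^esub> c \<otimes>\<^bsub>K\<^esub> d \<otimes>\<^bsub>K\<^esub> e) = a \<otimes>\<^bsub>K\<^esub> (b \<otimes>\<^bsub>K\<^esub> d) \<otimes>\<^bsub>K\<^esub> e"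
    if "a \<in> carrier K" "b \<in> carrier K" "c \<in> carrier K" "d \<in> carrier K" "e \<in> carrier K" for a b c d e
  proof -
    have "c \<otimes>\<^bsub>K\<^esub> (inv\<^bsub>K\<^esub> c \<otimes>\<^bsub>K\<^esub> (d \<otimes>\<^bsub>K\<^esub> e)) = d \<otimes>\<^bsub>K\<^esub> e" using that by (simp add: K.m_assoc[symmetric])
    then show ?thesis using that by (simp add: K.m_assoc)
  qed
  have "reading K \<Gamma> (glue F K \<Gamma> \<alpha> g) u (l # xs) =
      (inv\<^bsub>K\<^esub> (?g u) \<otimes>\<^bsub>K\<^esub> \<alpha> C (based F \<Gamma> u [l] u') \<otimes>\<^bsub>K\<^esub> ?g u') \<otimes>\<^bsub>K\<^esub>
      (inv\<^bsub>K\<^esub> (?g u') \<otimes>\<^bsub>K\<^esub> \<alpha> C (based F \<Gamma> u' xs v) \<otimes>\<^bsub>K\<^esub> ?g v)"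
    unfolding reading_Cons[OF mc e] lv Cons.IH[OF p'] C(2) ..
  also have "\<dots> = inv\<^bsub>K\<^esub> (?g u) \<otimes>\<^bsub>K\<^esub> (\<alpha> C (based F \<Gamma> u [l] u') \<otimes>\<^bsub>K\<^esub> \<alpha> C (based F \<Gamma> u' xs v)) \<otimes>\<^bsub>K\<^esub> ?g v"
    using g V hom(1) b1 b2 by (intro cancel) auto
  also have "\<alpha> C (based F \<Gamma> u [l] u') \<otimes>\<^bsub>K\<^esub> \<alpha> C (based F \<Gamma> u' xs v) = \<alpha> C (based F \<Gamma> u (l # xs) v)"
    using hom(2)[OF b1 b2] based_append[OF pl p'] by simp
  finally show ?case by (simp add: C_def)
qed


lemma holonomy_eval:
  assumes \<beta>: "\<beta> \<in> gedges \<Gamma> \<rightarrow>\<^sub>E carrier K" and p: "path \<Gamma> (base C) xs (base C)"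
  shows "holonomy F K \<Gamma> \<beta> C (eval_word F xs) = reading K \<Gamma> \<beta> (base C) xs"
proof -
  interpret L: labelled_graph K B \<Gamma> \<beta> by (rule labelled_graphI[OF mc K \<beta>])
  define ys where "ys = (SOME ys. path \<Gamma> (base C) ys (base C) \<and> eval_word F ys = eval_word F xs)"
  have "path \<Gamma> (base C) ys (base C) \<and> eval_word F ys = eval_word F xs"
    unfolding ys_def by (rule someI[of _ xs]) (use p in simp)
  then have "reading K \<Gamma> \<beta> (base C) ys = reading K \<Gamma> \<beta> (base C) xs"
    using L.reading_eval[OF F _ p] by blast
  moreover have "eval_word F xs \<in> pi1_lab F \<Gamma> (base C)" using p by (auto simp: pi1_lab_def)
  ultimately show ?thesis by (simp add: holonomy_def ys_def)
qed

lemma holonomy_homs: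
  assumes \<beta>: "\<beta> \<in> gedges \<Gamma> \<rightarrow>\<^sub>E carrier K"
  shows "holonomy F K \<Gamma> \<beta> C \<in> homs F (pi1_lab F \<Gamma> (base C)) K"
proof -
  interpret L: labelled_graph K B \<Gamma> \<beta> by (rule labelled_graphI[OF mc K \<beta>])
  have "holonomy F K \<Gamma> \<beta> C x \<in> carrier K" if "x \<in> pi1_lab F \<Gamma> (base C)" for x
  proof -
    from \<open>x \<in> _\<close> obtain xs where "path \<Gamma> (base C) xs (base C)" "x = eval_word F xs"
      by (auto simp: pi1_lab_def)
    then show ?thesis using holonomy_eval[OF \<beta>] L.reading_closed[of "base C" xs "base C"] by simp
  qed
  moreover have "holonomy F K \<Gamma> \<beta> C (x \<otimes>\<^bsub>F\<^esub> y) = holonomy F K \<Gamma> \<beta> C x \<otimes>\<^bsub>K\<^esub> holonomy F K \<Gamma> \<beta> C y"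
    if "x \<in> pi1_lab F \<Gamma> (base C)" "y \<in> pi1_lab F \<Gamma> (base C)" for x y
  proof -
    obtain xs ys where p: "path \<Gamma> (base C) xs (base C)" "path \<Gamma> (base C) ys (base C)"
        and xy: "x = eval_word F xs" "y = eval_word F ys"
      using \<open>x \<in> _\<close> \<open>y \<in> _\<close> by (auto simp: pi1_lab_def)
    have "path \<Gamma> (base C) (xs @ ys) (base C)" using p path_append[OF mc] by blast
    from holonomy_eval[OF \<beta> this] show ?thesis
      using holonomy_eval[OF \<beta> p(1)] holonomy_eval[OF \<beta> p(2)] L.reading_append[OF p]
        eval_append[OF F.group_axioms path_carrier[OF p(1)] path_carrier[OF p(2)]] xy by simp
  qed
  ultimately show ?thesis by (auto simp: homs_def hom_def holonomy_def)
qed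

lemma holonomy_glue:
  assumes \<alpha>: "\<And>C. C \<in> components \<Gamma> \<Longrightarrow> \<alpha> C \<in> homs F (pi1_lab F \<Gamma> (base C)) K"
    and g: "\<And>v. v \<in> gverts \<Gamma> \<Longrightarrow> at_vertex K \<Gamma> g v \<in> carrier K"
    and C: "C \<in> components \<Gamma>" and gl: "glue F K \<Gamma> \<alpha> g \<in> gedges \<Gamma> \<rightarrow>\<^sub>E carrier K"
  shows "holonomy F K \<Gamma> (glue F K \<Gamma> \<alpha> g) C = \<alpha> C"
proof (rule extensionalityI)
  show "holonomy F K \<Gamma> (glue F K \<Gamma> \<alpha> g) C \<in> extensional (pi1_lab F \<Gamma> (base C))"
    by (simp add: holonomy_def)
  show "\<alpha> C \<in> extensional (pi1_lab F \<Gamma> (base C))" using homsD(3)[OF \<alpha>[OF C]] .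
  fix x assume x: "x \<in> pi1_lab F \<Gamma> (base C)"
  then obtain xs where xs: "path \<Gamma> (base C) xs (base C)" "x = eval_word F xs" by (auto simp: pi1_lab_def)
  have "at_vertex K \<Gamma> g (base C) = \<one>\<^bsub>K\<^esub>" using C by (simp add: at_vertex_def comp_of_base[OF mc])
  moreover have "based F \<Gamma> (base C) xs (base C) = x"
    using C xs by (simp add: based_def tree_path_base[OF mc])
  ultimately show "holonomy F K \<Gamma> (glue F K \<Gamma> \<alpha> g) C x = \<alpha> C x"
    using holonomy_eval[OF gl xs(1)] reading_glue[OF \<alpha> g xs(1)] homsD(1)[OF \<alpha>[OF C] x] C xs(2)
    by (simp add: comp_of_base[OF mc])
qed

lemma glue_closed:
  assumes \<alpha>: "\<And>C. C \<in> components \<Gamma> \<Longrightarrow> \<alpha> C \<in> homs F (pi1_lab F \<Gamma> (base C)) K"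
    and g: "\<And>v. v \<in> gverts \<Gamma> \<Longrightarrow> at_vertex K \<Gamma> g v \<in> carrier K"
  shows "glue F K \<Gamma> \<alpha> g \<in> gedges \<Gamma> \<rightarrow>\<^sub>E carrier K"
proof -
  have "glue F K \<Gamma> \<alpha> g (u, b, v) \<in> carrier K" if e: "(u, b, v) \<in> gedges \<Gamma>" for u b v
  proof -
    have "path \<Gamma> u [(b, True)] v" using e by (simp add: path_single[OF mc] edge_along_def)
    then have "\<alpha> (comp_of \<Gamma> u) (based F \<Gamma> u [(b, True)] v) \<in> carrier K"
      using based_in_pi1 homsD(1)[OF \<alpha>[OF comp_of_in[OF mc]]] edge_ends[OF mc e] by blast
    then show ?thesis using e g edge_ends[OF mc e] by (simp add: glue_def)
  qed
  then show ?thesis by (force simp: glue_def)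
qed

abbreviation "Homs C \<equiv> homs F (pi1_lab F \<Gamma> (base C)) K"

lemma at_vertex_closed:
  assumes "g \<in> (gverts \<Gamma> - base ` components \<Gamma>) \<rightarrow>\<^sub>E carrier K" "v \<in> gverts \<Gamma>"
  shows "at_vertex K \<Gamma> g v \<in> carrier K"
proof (cases "v = base (comp_of \<Gamma> v)")
  case False
  then have "v \<notin> base ` components \<Gamma>" using comp_of_base[OF mc] by auto
  then show ?thesis using assms False by (auto simp: at_vertex_def)
qed (simp add: at_vertex_def)

text \<open>Conversely a labelling determines \<open>\<alpha>\<close> as its holonomy and \<open>g\<close> as its reading along the tree
  paths.\<close>
lemma glue_bij:
  "bij_betw (\<lambda>(\<alpha>, g). glue F K \<Gamma> \<alpha> g)
     (PiE (components \<Gamma>) Homs \<times> ((gverts \<Gamma> - base ` components \<Gamma>) \<rightarrow>\<^sub>E carrier K))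
     (gedges \<Gamma> \<rightarrow>\<^sub>E carrier K)"
proof (rule bij_betw_byWitness[where f' = "\<lambda>\<beta>. (\<lambda>C \<in> components \<Gamma>. holonomy F K \<Gamma> \<beta> C,
    \<lambda>v \<in> gverts \<Gamma> - base ` components \<Gamma>. reading K \<Gamma> \<beta> (base (comp_of \<Gamma> v)) (tree_path \<Gamma> v))"])
  let ?A = "PiE (components \<Gamma>) Homs" and ?G = "(gverts \<Gamma> - base ` components \<Gamma>) \<rightarrow>\<^sub>E carrier K"
  let ?f = "\<lambda>(\<alpha>, g). glue F K \<Gamma> \<alpha> g"
  let ?f' = "\<lambda>\<beta>. (\<lambda>C \<in> components \<Gamma>. holonomy F K \<Gamma> \<beta> C,
    \<lambda>v \<in> gverts \<Gamma> - base ` components \<Gamma>. reading K \<Gamma> \<beta> (base (comp_of \<Gamma> v)) (tree_path \<Gamma> v))"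
  show "?f ` (?A \<times> ?G) \<subseteq> gedges \<Gamma> \<rightarrow>\<^sub>E carrier K"
  proof (rule subsetI)
    fix \<beta> assume "\<beta> \<in> ?f ` (?A \<times> ?G)"
    then obtain \<alpha> g where ag: "\<alpha> \<in> ?A" "g \<in> ?G" "\<beta> = glue F K \<Gamma> \<alpha> g" by auto
    show "\<beta> \<in> gedges \<Gamma> \<rightarrow>\<^sub>E carrier K" unfolding ag(3)
      by (rule glue_closed[OF PiE_mem[OF ag(1)] at_vertex_closed[OF ag(2)]])
  qed
  show "?f' ` (gedges \<Gamma> \<rightarrow>\<^sub>E carrier K) \<subseteq> ?A \<times> ?G"
  proof (rule subsetI)
    fix q assume "q \<in> ?f' ` (gedges \<Gamma> \<rightarrow>\<^sub>E carrier K)"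
    then obtain \<beta> where \<beta>: "\<beta> \<in> gedges \<Gamma> \<rightarrow>\<^sub>E carrier K" "q = ?f' \<beta>" by blast
    interpret L: labelled_graph K B \<Gamma> \<beta> by (rule labelled_graphI[OF mc K \<beta>(1)])
    show "q \<in> ?A \<times> ?G"
      unfolding \<beta>(2) using holonomy_homs[OF \<beta>(1)] L.reading_closed[OF tree_path[OF mc]] by auto
  qed
  show "\<forall>q \<in> ?A \<times> ?G. ?f' (?f q) = q"
  proof
    fix q assume "q \<in> ?A \<times> ?G"
    then obtain \<alpha> g where ag: "\<alpha> \<in> ?A" "g \<in> ?G" and q: "q = (\<alpha>, g)" by auto
    note \<alpha> = PiE_mem[OF ag(1)] and g = at_vertex_closed[OF ag(2)]
    note gl = glue_closed[OF \<alpha> g]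
    have "(\<lambda>C \<in> components \<Gamma>. holonomy F K \<Gamma> (glue F K \<Gamma> \<alpha> g) C) = \<alpha>"
      using holonomy_glue[OF \<alpha> g _ gl] ag(1) by (intro extensionalityI[of _ "components \<Gamma>"]) (auto simp: PiE_def)
    moreover have "reading K \<Gamma> (glue F K \<Gamma> \<alpha> g) (base (comp_of \<Gamma> v)) (tree_path \<Gamma> v) = g v"
      if v: "v \<in> gverts \<Gamma>" "v \<notin> base ` components \<Gamma>" for v
    proof -
      define C where "C = comp_of \<Gamma> v"
      have C1: "C \<in> components \<Gamma>" using comp_of_in[OF mc v(1)] by (simp add: C_def)
      have C: "C \<in> components \<Gamma>" "comp_of \<Gamma> (base C) = C" "base C \<in> gverts \<Gamma>"
        using C1 comp_of_base[OF mc C1] base_in[OF mc C1] component_subset[OF mc C1] by auto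
      have t: "path \<Gamma> (base C) (tree_path \<Gamma> v) v" using tree_path[OF mc v(1)] by (simp add: C_def)
      have "based F \<Gamma> (base C) (tree_path \<Gamma> v) v = \<one>\<^bsub>F\<^esub>"
        using based_eq[OF t] tree_path_carrier[OF v(1)] C by (simp add: tree_path_base[OF mc] eval_closed[OF F.group_axioms])
      moreover have "at_vertex K \<Gamma> g (base C) = \<one>\<^bsub>K\<^esub>" using C by (simp add: at_vertex_def)
      moreover have "v \<noteq> base (comp_of \<Gamma> v)" using v comp_of_in[OF mc v(1)] by blast
      then have "at_vertex K \<Gamma> g v = g v" by (simp add: at_vertex_def)
      ultimately show ?thesis
        using reading_glue[OF \<alpha> g t] homs_one[OF \<alpha>[OF C(1)] C(3)] C g[OF v(1)]
        by (simp add: C_def[symmetric])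
    qed
    then have "(\<lambda>v \<in> gverts \<Gamma> - base ` components \<Gamma>. reading K \<Gamma> (glue F K \<Gamma> \<alpha> g) (base (comp_of \<Gamma> v)) (tree_path \<Gamma> v)) = g"
      using ag(2) by (intro extensionalityI[of _ "gverts \<Gamma> - base ` components \<Gamma>"]) (auto simp: PiE_def)
    ultimately show "?f' (?f q) = q" by (simp add: q)
  qed
  show "\<forall>\<beta> \<in> gedges \<Gamma> \<rightarrow>\<^sub>E carrier K. ?f (?f' \<beta>) = \<beta>"
  proof
    fix \<beta> assume \<beta>: "\<beta> \<in> gedges \<Gamma> \<rightarrow>\<^sub>E carrier K"
    interpret L: labelled_graph K B \<Gamma> \<beta> by (rule labelled_graphI[OF mc K \<beta>])
    define g where "g = snd (?f' \<beta>)"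
    define \<alpha> where "\<alpha> = fst (?f' \<beta>)"
    have g: "at_vertex K \<Gamma> g v = reading K \<Gamma> \<beta> (base (comp_of \<Gamma> v)) (tree_path \<Gamma> v)" if v: "v \<in> gverts \<Gamma>" for v
    proof (cases "v = base (comp_of \<Gamma> v)")
      case True
      then show ?thesis by (simp add: at_vertex_def tree_path_def)
    next
      case False
      then have "v \<notin> base ` components \<Gamma>" using comp_of_base[OF mc] by auto
      then show ?thesis using False v by (simp add: at_vertex_def g_def)
    qed
    have "glue F K \<Gamma> \<alpha> g (u, b, v) = \<beta> (u, b, v)" if e: "(u, b, v) \<in> gedges \<Gamma>" for u b v
    proof -
      note V = edge_ends[OF mc e]
      define C where "C = comp_of \<Gamma> u"
      have p: "path \<Gamma> u [(b, True)] v" using e by (simp add: path_single[OF mc] edge_along_def)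
      have C: "C \<in> components \<Gamma>" "comp_of \<Gamma> v = C"
        using comp_of_in[OF mc V(1)] path_comp_of[OF mc p] by (auto simp: C_def)
      have tu: "path \<Gamma> (base C) (tree_path \<Gamma> u) u" and tv: "path \<Gamma> (base C) (tree_path \<Gamma> v) v"
        using tree_path[OF mc V(1)] tree_path[OF mc V(2)] C by (simp_all add: C_def)
      note tvi = path_inv[OF mc tv]
      have cancel: "inv\<^bsub>K\<^esub> a \<otimes>\<^bsub>K\<^esub> (a \<otimes>\<^bsub>K\<^esub> (b \<otimes>\<^bsub>K\<^esub> inv\<^bsub>K\<^esub> c)) \<otimes>\<^bsub>K\<^esub> c = b"
        if "a \<in> carrier K" "b \<in> carrier K" "c \<in> carrier K" for a b c
      proof -
        have "inv\<^bsub>K\<^esub> a \<otimes>\<^bsub>K\<^esub> (a \<otimes>\<^bsub>K\<^esub> (b \<otimes>\<^bsub>K\<^esub> inv\<^bsub>K\<^esub> c)) = b \<otimes>\<^bsub>K\<^esub> inv\<^bsub>K\<^esub> c"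
          using that by (simp add: K.m_assoc[symmetric])
        then show ?thesis using that by (simp add: K.m_assoc)
      qed
      have "\<alpha> C (based F \<Gamma> u [(b, True)] v) = reading K \<Gamma> \<beta> (base C) (tree_path \<Gamma> u @ [(b, True)] @ inv_word (tree_path \<Gamma> v))"
        using holonomy_eval[OF \<beta> based_path[OF p C_def]] C by (simp add: \<alpha>_def based_def)
      also have "\<dots> = reading K \<Gamma> \<beta> (base C) (tree_path \<Gamma> u) \<otimes>\<^bsub>K\<^esub>
          (reading K \<Gamma> \<beta> u [(b, True)] \<otimes>\<^bsub>K\<^esub> inv\<^bsub>K\<^esub> reading K \<Gamma> \<beta> (base C) (tree_path \<Gamma> v))"
      proof -
        have "path \<Gamma> u ([(b, True)] @ inv_word (tree_path \<Gamma> v)) (base C)"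
          using p tvi path_append[OF mc] by blast
        then show ?thesis
          using L.reading_append[OF tu] L.reading_append[OF p tvi] L.reading_inv[OF tv] by simp
      qed
      also have "reading K \<Gamma> \<beta> u [(b, True)] = \<beta> (u, b, v)"
        using L.reading_single[of u "(b, True)" v] e by (simp add: edge_along_def letter_value_def)
      finally show ?thesis
        using e g[OF V(1)] g[OF V(2)] L.reading_closed[OF tu] L.reading_closed[OF tv] L.\<beta>[OF e] C
        by (simp add: glue_def C_def[symmetric] cancel)
    qed
    then have "glue F K \<Gamma> \<alpha> g = \<beta>"
      using \<beta> by (intro extensionalityI[of _ "gedges \<Gamma>"]) (auto simp: glue_def PiE_def)
    then show "?f (?f' \<beta>) = \<beta>" by (simp add: g_def \<alpha>_def)
  qed
qed

lemma trivial_homs: "(\<lambda>x \<in> J. \<one>\<^bsub>K\<^esub>) \<in> homs F J K" if "\<And>x y. x \<in> J \<Longrightarrow> y \<in> J \<Longrightarrow> x \<otimes>\<^bsub>F\<^esub> y \<in> J"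
  using that by (auto simp: homs_def hom_def)

lemma finite_labellings: "finite (carrier K) \<Longrightarrow> finite (gedges \<Gamma> \<rightarrow>\<^sub>E carrier K)"
  by (intro finite_PiE) (use multi_core_graphD[OF mc] in auto)

text \<open>Fundamental groups are infinite in general, but each homomorphism is the holonomy of one of the
  finitely many labellings.\<close>
lemma finite_Homs:
  assumes fin: "finite (carrier K)" and C: "C \<in> components \<Gamma>"
  shows "finite (Homs C)"
proof (rule finite_subset)
  show "Homs C \<subseteq> (\<lambda>\<beta>. holonomy F K \<Gamma> \<beta> C) ` (gedges \<Gamma> \<rightarrow>\<^sub>E carrier K)"
  proof
    fix \<alpha>C assume a: "\<alpha>C \<in> Homs C"
    define \<alpha> where "\<alpha> D = (if D = C then \<alpha>C else (\<lambda>x \<in> pi1_lab F \<Gamma> (base D). \<one>\<^bsub>K\<^esub>))" for D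
    have \<alpha>: "\<alpha> D \<in> Homs D" for D using a trivial_homs pi1_mult by (auto simp: \<alpha>_def)
    have g: "at_vertex K \<Gamma> (\<lambda>_. \<one>\<^bsub>K\<^esub>) v \<in> carrier K" for v by (simp add: at_vertex_def)
    note gl = glue_closed[OF \<alpha> g]
    have "\<alpha>C = holonomy F K \<Gamma> (glue F K \<Gamma> \<alpha> (\<lambda>_. \<one>\<^bsub>K\<^esub>)) C"
      unfolding holonomy_glue[OF \<alpha> g C gl] by (simp add: \<alpha>_def)
    then show "\<alpha>C \<in> (\<lambda>\<beta>. holonomy F K \<Gamma> \<beta> C) ` (gedges \<Gamma> \<rightarrow>\<^sub>E carrier K)" using gl by blast
  qed
qed (use finite_labellings[OF fin] in simp)

text \<open>Each family of homomorphisms is induced by the same number of labellings, one for each choice of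
  the elements at the vertices that are not base points. So independent uniform homomorphisms may be
  replaced by one uniform labelling.\<close>
lemma expectation_as_labellings:
  assumes fin: "finite (carrier K)"
  shows "(\<Prod>C \<in> components \<Gamma>. average (Homs C) (f C)) =
    average (gedges \<Gamma> \<rightarrow>\<^sub>E carrier K) (\<lambda>\<beta>. \<Prod>C \<in> components \<Gamma>. f C (holonomy F K \<Gamma> \<beta> C))"
proof -
  have "(\<Prod>C \<in> components \<Gamma>. average (Homs C) (f C)) =
      average (PiE (components \<Gamma>) Homs) (\<lambda>\<alpha>. \<Prod>C \<in> components \<Gamma>. f C (\<alpha> C))"
    by (rule prod_average) (use finite_components[OF mc] finite_Homs[OF fin] in auto)
  also have "\<dots> = average (gedges \<Gamma> \<rightarrow>\<^sub>E carrier K) (\<lambda>\<beta>. \<Prod>C \<in> components \<Gamma>. f C (holonomy F K \<Gamma> \<beta> C))"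
  proof (rule average_fibres[OF glue_bij, symmetric])
    show "finite ((gverts \<Gamma> - base ` components \<Gamma>) \<rightarrow>\<^sub>E carrier K)"
      using multi_core_graphD(1)[OF mc] fin by (intro finite_PiE) auto
    show "(gverts \<Gamma> - base ` components \<Gamma>) \<rightarrow>\<^sub>E carrier K \<noteq> {}" using K.one_closed by (auto simp: PiE_eq_empty_iff)
    fix \<alpha> g assume ag: "\<alpha> \<in> PiE (components \<Gamma>) Homs" "g \<in> (gverts \<Gamma> - base ` components \<Gamma>) \<rightarrow>\<^sub>E carrier K"
    note \<alpha> = PiE_mem[OF ag(1)] and g = at_vertex_closed[OF ag(2)]
    show "(\<Prod>C \<in> components \<Gamma>. f C (holonomy F K \<Gamma> (case (\<alpha>, g) of (\<alpha>, g) \<Rightarrow> glue F K \<Gamma> \<alpha> g) C))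
      = (\<Prod>C \<in> components \<Gamma>. f C (\<alpha> C))"
      using holonomy_glue[OF \<alpha> g _ glue_closed[OF \<alpha> g]] by (intro prod.cong refl) auto
  qed
  finally show ?thesis .
qed

end

section \<open>Word graphs\<close>

text \<open>A letter is not its own inverse, and a reduced word of length 2 does not consist of a letter and
  its inverse, so the process cannot arrive at the empty word.\<close>
lemma strip_ends_nonempty: "reduced xs \<Longrightarrow> xs \<noteq> [] \<Longrightarrow> strip_ends xs \<noteq> []"
proof (induction xs rule: strip_ends.induct)
  case (1 xs)
  show ?case
  proof (cases "last xs = flip (hd xs)")
    case False
    then show ?thesis using 1 by (simp add: strip_ends.simps[of xs])
  next
    case True
    obtain l ys where xs: "xs = l # ys" using 1 by (cases xs) auto
    have "ys \<noteq> []"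
    proof
      assume "ys = []"
      then have "l = flip l" using True xs by simp
      then show False by (metis flip_simps(2))
    qed
    then obtain zs m where ys: "ys = zs @ [m]" by (metis rev_exhaust)
    have m: "m = flip l" using True xs ys by simp
    have "zs \<noteq> []" using 1(2) m by (auto simp: xs ys reduced_def)
    moreover have "reduced zs"
      using 1(2) by (auto simp: xs ys reduced_def successively_append_iff successively_Cons)
    ultimately have "strip_ends zs \<noteq> []" using 1(1) True 1(3) by (simp add: xs ys)
    then show ?thesis using True 1(3) by (simp add: strip_ends.simps[of xs], simp add: xs ys)
  qed
qed

lemma cyclic_reduction_nonempty:
  assumes F: "free_basis F B" and g: "g \<in> carrier F" "g \<noteq> \<one>\<^bsub>F\<^esub>"
  shows "cyclic_reduction F B g \<noteq> []"
proof -
  have "\<exists>!xs. xs \<in> reduced_words B \<and> eval_word F xs = g" using F g by (simp add: free_basis_def)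
  from theI'[OF this] have "reduced_form F B g \<in> reduced_words B" "eval_word F (reduced_form F B g) = g"
    by (simp_all add: reduced_form_def)
  moreover from this(2) have "reduced_form F B g \<noteq> []" using g by (metis eval_word.simps(1))
  ultimately show ?thesis
    using strip_ends_nonempty[of "reduced_form F B g"] by (simp add: cyclic_reduction_def reduced_words_def)
qed

abbreviation cyc :: "('f, 'm) monoid_scheme \<Rightarrow> 'f set \<Rightarrow> 'f list \<Rightarrow> nat \<Rightarrow> 'f letter list" where
  "cyc F B ws j \<equiv> cyclic_reduction F B (ws ! j)"

lemma word_graph_verts: "gverts (word_graph F B ws) = {(j, i). j < length ws \<and> i < length (cyc F B ws j)}"
  by (simp add: word_graph_def Let_def)

lemma word_graph_edges:
  "gedges (word_graph F B ws) = (\<lambda>(j, i). edge_along (j, i) (cyc F B ws j ! i) (j, Suc i mod length (cyc F B ws j))) ` gverts (word_graph F B ws)"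
  unfolding word_graph_verts
  by (auto simp: word_graph_def Let_def edge_along_def intro!: image_cong)

context
  fixes F :: "('f, 'm) monoid_scheme" and B :: "'f set" and ws :: "'f list"
  assumes F: "free_basis F B" and ws: "multi_word F ws"
begin

lemma cyc_nonempty: "j < length ws \<Longrightarrow> cyc F B ws j \<noteq> []"
  using cyclic_reduction_nonempty[OF F, of "ws ! j"] subsetD[OF ws[unfolded multi_word_def] nth_mem[of j ws]]
  by simp

lemma word_start: "j < length ws \<Longrightarrow> (j, 0) \<in> gverts (word_graph F B ws)"
  using cyc_nonempty by (auto simp: word_graph_verts)

lemma word_step:
  "j < length ws \<Longrightarrow> i < length (cyc F B ws j) \<Longrightarrow>
    edge_along (j, i) (cyc F B ws j ! i) (j, Suc i mod length (cyc F B ws j)) \<in> gedges (word_graph F B ws)"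
  unfolding word_graph_edges by (rule image_eqI[of _ _ "(j, i)"]) (auto simp: word_graph_verts)

lemma word_path_drop:
  assumes j: "j < length ws" and i: "i \<le> length (cyc F B ws j)"
  shows "path (word_graph F B ws) (j, i mod length (cyc F B ws j)) (drop i (cyc F B ws j)) (j, 0)"
  using i
proof (induction i rule: inc_induct)
  case base then show ?case using word_start[OF j] by simp
next
  case (step i)
  then have "edge_along (j, i) (cyc F B ws j ! i) (j, Suc i mod length (cyc F B ws j)) \<in> gedges (word_graph F B ws)"
    using word_step[OF j] by simp
  then show ?case using step by (auto simp: path_Cons simp flip: Cons_nth_drop_Suc)
qed

lemma word_path: "j < length ws \<Longrightarrow> path (word_graph F B ws) (j, 0) (cyc F B ws j) (j, 0)"
  using word_path_drop[of j 0] by simp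

text \<open>The holonomy at the representative of the image of the \<open>j\<close>-th cycle is conjugate to the reading along
  that cycle, and \<open>\<xi> j\<close> is a class function.\<close>
lemma expect_words_labellings:
  assumes \<eta>: "\<eta> \<in> Qset F B ws" and K: "group K" and fin: "finite (carrier K)"
    and \<xi>: "\<And>j. j < length ws \<Longrightarrow> class_function K (\<xi> j)"
  shows "expect_words F B ws K \<xi> \<eta> = average (gedges (gcod \<eta>) \<rightarrow>\<^sub>E carrier K)
    (\<lambda>\<beta>. \<Prod>j<length ws. \<xi> j (reading K (word_graph F B ws) (\<lambda>e. \<beta> (emap (gmap \<eta>) e)) (j, 0) (cyc F B ws j)))"
proof -
  interpret K: group K by (rule K)
  have s: "\<eta> \<in> sur B" and d: "gdom \<eta> = (word_graph F B ws)" using \<eta> by (auto simp: Qset_def)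
  note mc = surD(2)[OF s]
  have m: "morphism B \<eta>" using s by (simp add: sur_def)
  let ?\<Delta> = "gcod \<eta>"
  define J where "J C = {j. j < length ws \<and> gmap \<eta> (j, 0) \<in> C}" for C
  have V: "gmap \<eta> (j, 0) \<in> gverts ?\<Delta>" if "j < length ws" for j
    using surD(3)[OF s] word_start[OF that] d by auto
  have "expect_words F B ws K \<xi> \<eta> = average (gedges ?\<Delta> \<rightarrow>\<^sub>E carrier K)
     (\<lambda>\<beta>. \<Prod>C \<in> components ?\<Delta>. \<Prod>j \<in> J C. \<xi> j (holonomy F K ?\<Delta> \<beta> C (image_word F B ws \<eta> C j)))"
    unfolding expect_words_def J_def by (rule expectation_as_labellings[OF F mc K fin])
  also have "\<dots> = average (gedges ?\<Delta> \<rightarrow>\<^sub>E carrier K)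
    (\<lambda>\<beta>. \<Prod>j<length ws. \<xi> j (reading K (word_graph F B ws) (\<lambda>e. \<beta> (emap (gmap \<eta>) e)) (j, 0) (cyc F B ws j)))"
  proof (rule average_cong)
    fix \<beta> assume \<beta>: "\<beta> \<in> gedges ?\<Delta> \<rightarrow>\<^sub>E carrier K"
    interpret L: labelled_graph K B ?\<Delta> \<beta> by (rule labelled_graphI[OF mc K \<beta>])
    let ?x = "\<lambda>j. \<xi> j (reading K (word_graph F B ws) (\<lambda>e. \<beta> (emap (gmap \<eta>) e)) (j, 0) (cyc F B ws j))"
    have "\<xi> j (holonomy F K ?\<Delta> \<beta> C (image_word F B ws \<eta> C j)) = ?x j"
      if C: "C \<in> components ?\<Delta>" and j: "j \<in> J C" for C j
    proof -
      have j': "j < length ws" "gmap \<eta> (j, 0) \<in> C" using j by (auto simp: J_def)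
      define t where "t = connecting ?\<Delta> (base C) (gmap \<eta> (j, 0))"
      have t: "path ?\<Delta> (base C) t (gmap \<eta> (j, 0))"
        unfolding t_def by (rule connecting_path[OF mc C base_in[OF mc C] j'(2)])
      have w: "path ?\<Delta> (gmap \<eta> (j, 0)) (cyc F B ws j) (gmap \<eta> (j, 0))"
        using path_emap[OF m, of "(j, 0)" "cyc F B ws j" "(j, 0)"] word_path[OF j'(1)] d by simp
      have wt: "path ?\<Delta> (gmap \<eta> (j, 0)) (cyc F B ws j @ inv_word t) (base C)"
        using w path_inv[OF mc t] path_append[OF mc] by blast
      then have p: "path ?\<Delta> (base C) (t @ cyc F B ws j @ inv_word t) (base C)"
        using t path_append[OF mc] by blast
      let ?k = "reading K ?\<Delta> \<beta> (base C) t" and ?r = "reading K ?\<Delta> \<beta> (gmap \<eta> (j, 0)) (cyc F B ws j)"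
      have "holonomy F K ?\<Delta> \<beta> C (image_word F B ws \<eta> C j) = ?k \<otimes>\<^bsub>K\<^esub> (?r \<otimes>\<^bsub>K\<^esub> inv\<^bsub>K\<^esub> ?k)"
        using holonomy_eval[OF F mc K \<beta> p] L.reading_append[OF t wt] L.reading_append[OF w path_inv[OF mc t]]
          L.reading_inv[OF t] by (simp add: image_word_def t_def Let_def)
      also have "\<dots> = ?k \<otimes>\<^bsub>K\<^esub> ?r \<otimes>\<^bsub>K\<^esub> inv\<^bsub>K\<^esub> ?k"
        using L.reading_closed[OF t] L.reading_closed[OF w] by (simp add: K.m_assoc)
      finally have "\<xi> j (holonomy F K ?\<Delta> \<beta> C (image_word F B ws \<eta> C j)) = \<xi> j ?r"
        using \<xi>[OF j'(1)] L.reading_closed[OF t] L.reading_closed[OF w] by (simp add: class_function_def)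
      also have "?r = reading K (word_graph F B ws) (\<lambda>e. \<beta> (emap (gmap \<eta>) e)) (j, 0) (cyc F B ws j)"
        using reading_emap[OF m, of "(j, 0)" "cyc F B ws j" "(j, 0)"] word_path[OF j'(1)] d by simp
      finally show ?thesis .
    qed
    then have "(\<Prod>C \<in> components ?\<Delta>. \<Prod>j \<in> J C. \<xi> j (holonomy F K ?\<Delta> \<beta> C (image_word F B ws \<eta> C j)))
      = (\<Prod>C \<in> components ?\<Delta>. \<Prod>j \<in> J C. ?x j)" by (intro prod.cong refl)
    also have "\<dots> = (\<Prod>C \<in> components ?\<Delta>. \<Prod>j \<in> {j. j \<in> {..<length ws} \<and> comp_of ?\<Delta> (gmap \<eta> (j, 0)) = C}. ?x j)"
    proof (intro prod.cong)
      fix C assume "C \<in> components ?\<Delta>"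
      then have "gmap \<eta> (j, 0) \<in> C \<longleftrightarrow> comp_of ?\<Delta> (gmap \<eta> (j, 0)) = C" if "j < length ws" for j
        using comp_of_unique[OF mc, of C "gmap \<eta> (j, 0)"] comp_of_self[OF mc V[OF that]] by metis
      then show "J C = {j. j \<in> {..<length ws} \<and> comp_of ?\<Delta> (gmap \<eta> (j, 0)) = C}"
        unfolding J_def by blast
    qed auto
    also have "\<dots> = (\<Prod>j<length ws. ?x j)"
      using comp_of_in[OF mc V] by (intro prod.group finite_components[OF mc]) auto
    finally show "(\<Prod>C \<in> components ?\<Delta>. \<Prod>j \<in> J C. \<xi> j (holonomy F K ?\<Delta> \<beta> C (image_word F B ws \<eta> C j)))
      = (\<Prod>j<length ws. ?x j)" .
  qed
  finally show ?thesis .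
qed

end

section \<open>Sections of permutation labellings\<close>

text \<open>A lift of the graph to the \<open>n\<close>-sheeted cover defined by \<open>\<tau>\<close>. The direction matches the convention
  that readings multiply from left to right and permutations compose from right to left: the
  reading along a path carries the sheet over its end to the sheet over its start.\<close>
definition is_section :: "'f lgraph \<Rightarrow> (vertex \<times> 'f \<times> vertex \<Rightarrow> nat \<Rightarrow> nat) \<Rightarrow> (vertex \<Rightarrow> nat) \<Rightarrow> bool" where
  "is_section \<Gamma> \<tau> s \<longleftrightarrow> (\<forall>e \<in> gedges \<Gamma>. \<tau> e (s (snd (snd e))) = s (fst e))"

definition sections :: "nat \<Rightarrow> 'f lgraph \<Rightarrow> (vertex \<times> 'f \<times> vertex \<Rightarrow> nat \<Rightarrow> nat) \<Rightarrow> (vertex \<Rightarrow> nat) set" where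
  "sections n \<Gamma> \<tau> = {s \<in> gverts \<Gamma> \<rightarrow>\<^sub>E {1..n}. is_section \<Gamma> \<tau> s}"

lemma sym_group_simps [simp]:
  "carrier (sym_group n) = {p. p permutes {1..n}}" "f \<otimes>\<^bsub>sym_group n\<^esub> g = f \<circ> g" "\<one>\<^bsub>sym_group n\<^esub> = id"
  by (simp_all add: sym_group_def)

lemma sectionsI:
  assumes "\<And>v. v \<in> gverts \<Gamma> \<Longrightarrow> s v \<in> {1..n}"
    "\<And>u b v. (u, b, v) \<in> gedges \<Gamma> \<Longrightarrow> \<tau> (u, b, v) (s v) = s u" "s \<in> extensional (gverts \<Gamma>)"
  shows "s \<in> sections n \<Gamma> \<tau>"
  unfolding sections_def is_section_def PiE_def Pi_def using assms by (simp only: mem_Collect_eq Int_iff) auto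

lemma finite_sections: "multi_core_graph B \<Gamma> \<Longrightarrow> finite (sections n \<Gamma> \<tau>)"
  unfolding sections_def by (rule finite_subset[of _ "gverts \<Gamma> \<rightarrow>\<^sub>E {1..n}"])
    (auto intro!: finite_PiE dest: multi_core_graphD(1))

text \<open>The sheets of the cover are transported along paths, backwards in the sense just explained.\<close>
locale permutation_labelling =
  fixes n :: nat and B :: "'f set" and \<Gamma> :: "'f lgraph" and \<tau> :: "vertex \<times> 'f \<times> vertex \<Rightarrow> nat \<Rightarrow> nat"
  assumes mc: "multi_core_graph B \<Gamma>" and \<tau>: "\<And>e. e \<in> gedges \<Gamma> \<Longrightarrow> \<tau> e permutes {1..n}"
begin

sublocale labelled_graph "sym_group n" B \<Gamma> \<tau>
  using mc \<tau> sym_group_is_group[of n] by (simp add: labelled_graph_def labelled_graph_axioms_def)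

abbreviation "transport u xs \<equiv> reading (sym_group n) \<Gamma> \<tau> u xs"

lemma transport_permutes: "path \<Gamma> u xs v \<Longrightarrow> transport u xs permutes {1..n}"
  using reading_closed by simp

lemma transport_append: "path \<Gamma> u xs v \<Longrightarrow> path \<Gamma> v ys w \<Longrightarrow> transport u (xs @ ys) x = transport u xs (transport v ys x)"
  using reading_append by simp

lemma transport_back: "path \<Gamma> u xs v \<Longrightarrow> transport v (inv_word xs) (transport u xs x) = x"
  using reading_inv[of u xs v] l_inv[OF reading_closed[of u xs v]] by (simp add: fun_eq_iff)

text \<open>The condition on an edge, in a form that is the same for both directions of traversal.\<close>
lemma letter_section:
  assumes e: "edge_along u l u' \<in> gedges \<Gamma>"
  shows "s u = letter_value (sym_group n) \<tau> u l u' (s u') \<longleftrightarrow>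
    \<tau> (edge_along u l u') (s (snd (snd (edge_along u l u')))) = s (fst (edge_along u l u'))"
proof (cases "snd l")
  case True
  then show ?thesis by (auto simp: letter_value_def edge_along_def)
next
  case False
  have p: "\<tau> (edge_along u l u') permutes {1..n}" using \<tau>[OF e] .
  then have "inv\<^bsub>sym_group n\<^esub> \<tau> (edge_along u l u') = inv' (\<tau> (edge_along u l u'))"
    by (intro sym_group_inv_equality) simp
  then show ?thesis using False permutes_inv_eq[OF p, of "s u'" "s u"]
    by (auto simp: letter_value_def edge_along_def)
qed

lemma section_transport:
  assumes s: "is_section \<Gamma> \<tau> s" and p: "path \<Gamma> u xs v"
  shows "s u = transport u xs (s v)"
  using p
proof (induction xs arbitrary: u)
  case (Cons l xs)
  then obtain u' where u': "edge_along u l u' \<in> gedges \<Gamma>" "path \<Gamma> u' xs v" by (auto simp: path_Cons)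
  have "s u = letter_value (sym_group n) \<tau> u l u' (s u')"
    using letter_section[OF u'(1)] s u'(1) by (simp add: is_section_def)
  then show ?case using Cons.IH[OF u'(2)] by (simp add: reading_Cons[OF mc u'(1)])
qed simp

text \<open>On each component a section is determined by its value at the base point, and a value there extends
  to the component exactly if it is fixed by the transport along every closed path.\<close>
lemma card_sections:
  "card (sections n \<Gamma> \<tau>) =
    (\<Prod>C \<in> components \<Gamma>. card {y \<in> {1..n}. \<forall>xs. path \<Gamma> (base C) xs (base C) \<longrightarrow> transport (base C) xs y = y})"
proof -
  define Fix where "Fix C = {y \<in> {1..n}. \<forall>xs. path \<Gamma> (base C) xs (base C) \<longrightarrow> transport (base C) xs y = y}" for C
  define S where "S a = (\<lambda>v \<in> gverts \<Gamma>. transport v (inv_word (tree_path \<Gamma> v)) (a (comp_of \<Gamma> v)))" for a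
  have "bij_betw (\<lambda>s. \<lambda>C \<in> components \<Gamma>. s (base C)) (sections n \<Gamma> \<tau>) (PiE (components \<Gamma>) Fix)"
  proof (rule bij_betw_byWitness[where f' = S])
    show "\<forall>s \<in> sections n \<Gamma> \<tau>. S (\<lambda>C \<in> components \<Gamma>. s (base C)) = s"
    proof
      fix s assume s: "s \<in> sections n \<Gamma> \<tau>"
      show "S (\<lambda>C \<in> components \<Gamma>. s (base C)) = s"
      proof (rule extensionalityI[of _ "gverts \<Gamma>"])
        fix v assume v: "v \<in> gverts \<Gamma>"
        show "S (\<lambda>C \<in> components \<Gamma>. s (base C)) v = s v"
          using section_transport[OF _ path_inv[OF mc tree_path[OF mc v]], of s] s v comp_of_in[OF mc v]
          by (simp add: S_def sections_def)
      qed (use s in \<open>auto simp: S_def sections_def PiE_def\<close>)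
    qed
    show "(\<lambda>s. \<lambda>C \<in> components \<Gamma>. s (base C)) ` sections n \<Gamma> \<tau> \<subseteq> PiE (components \<Gamma>) Fix"
    proof (rule subsetI)
      fix a assume "a \<in> (\<lambda>s. \<lambda>C \<in> components \<Gamma>. s (base C)) ` sections n \<Gamma> \<tau>"
      then obtain s where s: "s \<in> sections n \<Gamma> \<tau>" "a = (\<lambda>C \<in> components \<Gamma>. s (base C))" by auto
      have "s (base C) \<in> Fix C" if C: "C \<in> components \<Gamma>" for C
      proof -
        have "base C \<in> gverts \<Gamma>" using base_in[OF mc C] component_subset[OF mc C] by auto
        then have "s (base C) \<in> {1..n}" using s by (auto simp: sections_def)
        then show ?thesis using section_transport[of s "base C" _ "base C"] s by (auto simp: Fix_def sections_def)
      qed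
      then show "a \<in> PiE (components \<Gamma>) Fix" using s by auto
    qed
    have *: "S a (base C) = a C" if "C \<in> components \<Gamma>" for a C
    proof -
      have "base C \<in> gverts \<Gamma>" using base_in[OF mc that] component_subset[OF mc that] by auto
      then show ?thesis using that by (simp add: S_def comp_of_base[OF mc] tree_path_base[OF mc])
    qed
    show "\<forall>a \<in> PiE (components \<Gamma>) Fix. (\<lambda>C \<in> components \<Gamma>. S a (base C)) = a"
    proof
      fix a assume a: "a \<in> PiE (components \<Gamma>) Fix"
      then show "(\<lambda>C \<in> components \<Gamma>. S a (base C)) = a"
        by (intro extensionalityI[of _ "components \<Gamma>"]) (auto simp: * PiE_def)
    qed
    show "S ` PiE (components \<Gamma>) Fix \<subseteq> sections n \<Gamma> \<tau>"
    proof (rule subsetI)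
      fix s assume "s \<in> S ` PiE (components \<Gamma>) Fix"
      then obtain a where a: "a \<in> PiE (components \<Gamma>) Fix" "s = S a" by auto
      have aC: "a (comp_of \<Gamma> v) \<in> Fix (comp_of \<Gamma> v)" if "v \<in> gverts \<Gamma>" for v
        using PiE_mem[OF a(1) comp_of_in[OF mc that]] .
      have "S a v \<in> {1..n}" if v: "v \<in> gverts \<Gamma>" for v
        using transport_permutes[OF path_inv[OF mc tree_path[OF mc v]]] aC[OF v] v
          permutes_in_image by (fastforce simp: S_def Fix_def)
      moreover have "\<tau> (u, b, v) (S a v) = S a u" if e: "(u, b, v) \<in> gedges \<Gamma>" for u b v
      proof -
        note V = edge_ends[OF mc e]
        have e': "edge_along u (b, True) v \<in> gedges \<Gamma>" using e by (simp add: edge_along_def)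
        then have p: "path \<Gamma> u [(b, True)] v" by (simp add: path_single[OF mc])
        define C where "C = comp_of \<Gamma> u"
        have C: "comp_of \<Gamma> v = C" using path_comp_of[OF mc p] by (simp add: C_def)
        have tu: "path \<Gamma> (base C) (tree_path \<Gamma> u) u" and tv: "path \<Gamma> (base C) (tree_path \<Gamma> v) v"
          using tree_path[OF mc V(1)] tree_path[OF mc V(2)] C by (simp_all add: C_def)
        note tvi = path_inv[OF mc tv]
        have q: "path \<Gamma> u ([(b, True)] @ inv_word (tree_path \<Gamma> v)) (base C)" using p tvi path_append[OF mc] by blast
        have "path \<Gamma> (base C) (tree_path \<Gamma> u @ [(b, True)] @ inv_word (tree_path \<Gamma> v)) (base C)"
          using tu q path_append[OF mc] by blast
        then have "transport (base C) (tree_path \<Gamma> u @ [(b, True)] @ inv_word (tree_path \<Gamma> v)) (a C) = a C"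
          using aC[OF V(1)] by (simp add: C_def Fix_def)
        then have "transport (base C) (tree_path \<Gamma> u) (transport u [(b, True)] (transport v (inv_word (tree_path \<Gamma> v)) (a C))) = a C"
          using transport_append[OF tu q] transport_append[OF p tvi] by simp
        then have "transport u (inv_word (tree_path \<Gamma> u)) (a C) =
            transport u [(b, True)] (transport v (inv_word (tree_path \<Gamma> v)) (a C))"
          using transport_back[OF tu] by metis
        moreover have "transport u [(b, True)] = \<tau> (u, b, v)"
          using reading_single[OF e'] by (simp add: letter_value_def edge_along_def)
        ultimately show ?thesis using V C by (simp add: S_def C_def)
      qed
      ultimately show "s \<in> sections n \<Gamma> \<tau>"
        unfolding a(2) by (rule sectionsI) (simp_all only: S_def restrict_extensional)
    qed
  qed
  from bij_betw_same_card[OF this] show ?thesis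
    by (simp add: card_PiE finite_components[OF mc] Fix_def)
qed

end

text \<open>Transport along the connecting path identifies the common fixed points over the base point of a
  component \<open>C\<close> of the codomain with the fixed points of the pulled back labelling over the base
  point of the component \<open>C'\<close> of the domain; these are counted by sections.\<close>
lemma expect_fix_labellings:
  assumes F: "free_basis F B" and s: "\<eta> \<in> sur B"
  shows "expect_fix F n \<eta> = average (gedges (gcod \<eta>) \<rightarrow>\<^sub>E carrier (sym_group n))
    (\<lambda>\<sigma>. of_nat (card (sections n (gdom \<eta>) (\<lambda>e. \<sigma> (emap (gmap \<eta>) e)))))"
proof -
  let ?\<Delta> = "gcod \<eta>" and ?\<Gamma> = "gdom \<eta>"
  note mc = surD(2)[OF s] and mcd = surD(1)[OF s]
  have m: "morphism B \<eta>" using s by (simp add: sur_def)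
  note S = sym_group_is_group[of n]
  have fin: "finite (carrier (sym_group n))" by (simp add: finite_permutations)
  let ?X = "\<lambda>\<sigma> C C'. {x \<in> {1..n}. \<forall>h \<in> image_subgroup F \<eta> C C'.
    holonomy F (sym_group n) ?\<Delta> \<sigma> C h x = x}"
  define I where "I C = {C' \<in> components ?\<Gamma>. gmap \<eta> ` C' \<subseteq> C}" for C
  have V: "gmap \<eta> (base C') \<in> gverts ?\<Delta>" if "C' \<in> components ?\<Gamma>" for C'
    using surD(3)[OF s] base_in[OF mcd that] component_subset[OF mcd that] by auto
  have I: "I C = {C' \<in> components ?\<Gamma>. comp_of ?\<Delta> (gmap \<eta> (base C')) = C}" if C: "C \<in> components ?\<Delta>" for C
  proof -
    have "gmap \<eta> ` C' \<subseteq> C \<longleftrightarrow> comp_of ?\<Delta> (gmap \<eta> (base C')) = C" if C': "C' \<in> components ?\<Gamma>" for C'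
    proof
      assume "gmap \<eta> ` C' \<subseteq> C"
      then have "gmap \<eta> (base C') \<in> C" using base_in[OF mcd C'] by auto
      then show "comp_of ?\<Delta> (gmap \<eta> (base C')) = C" by (rule comp_of_unique[OF mc C, symmetric])
    next
      assume a: "comp_of ?\<Delta> (gmap \<eta> (base C')) = C"
      show "gmap \<eta> ` C' \<subseteq> C"
      proof
        fix w assume "w \<in> gmap \<eta> ` C'"
        then obtain v where v: "v \<in> C'" "w = gmap \<eta> v" by auto
        have "comp_of ?\<Delta> (gmap \<eta> (base C')) = comp_of ?\<Delta> w"
          using path_comp_of[OF mc path_emap[OF m connecting_path[OF mcd C' base_in[OF mcd C'] v(1)]]] v(2) by simp
        moreover have "w \<in> gverts ?\<Delta>" using v component_subset[OF mcd C'] surD(3)[OF s] by auto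
        ultimately show "w \<in> C" using a comp_of_self[OF mc] by auto
      qed
    qed
    then show ?thesis by (auto simp: I_def)
  qed
  have "expect_fix F n \<eta> = average (gedges ?\<Delta> \<rightarrow>\<^sub>E carrier (sym_group n))
     (\<lambda>\<sigma>. \<Prod>C \<in> components ?\<Delta>. \<Prod>C' \<in> I C. of_nat (card (?X \<sigma> C C')))"
    unfolding expect_fix_def I_def by (rule expectation_as_labellings[OF F mc S fin])
  also have "\<dots> = average (gedges (gcod \<eta>) \<rightarrow>\<^sub>E carrier (sym_group n))
    (\<lambda>\<sigma>. of_nat (card (sections n ?\<Gamma> (\<lambda>e. \<sigma> (emap (gmap \<eta>) e)))))"
  proof (rule average_cong)
    fix \<sigma> assume \<sigma>: "\<sigma> \<in> gedges ?\<Delta> \<rightarrow>\<^sub>E carrier (sym_group n)"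
    let ?\<tau> = "\<lambda>e. \<sigma> (emap (gmap \<eta>) e)"
    interpret D: permutation_labelling n B ?\<Delta> \<sigma>
      using mc \<sigma> by (auto simp: permutation_labelling_def PiE_iff)
    have "?\<tau> e permutes {1..n}" if "e \<in> gedges ?\<Gamma>" for e
      by (rule D.\<tau>) (use surD(4)[OF s] that in auto)
    then interpret T: permutation_labelling n B ?\<Gamma> ?\<tau>
      using mcd by (auto simp: permutation_labelling_def)
    let ?c = "\<lambda>C'. complex_of_nat (card {y \<in> {1..n}. \<forall>xs. path ?\<Gamma> (base C') xs (base C') \<longrightarrow> T.transport (base C') xs y = y})"
    have "complex_of_nat (card (?X \<sigma> C C')) = ?c C'"
      if C: "C \<in> components ?\<Delta>" and C': "C' \<in> components ?\<Gamma>" "gmap \<eta> ` C' \<subseteq> C" for C C'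
    proof -
      define q where "q = base C'"
      define t where "t = connecting ?\<Delta> (base C) (gmap \<eta> q)"
      have qC: "gmap \<eta> q \<in> C" using C' base_in[OF mcd C'(1)] by (auto simp: q_def)
      have t: "path ?\<Delta> (base C) t (gmap \<eta> q)"
        unfolding t_def by (rule connecting_path[OF mc C base_in[OF mc C] qC])
      define k where "k = D.transport (base C) t"
      have kp: "k permutes {1..n}" unfolding k_def by (rule D.transport_permutes[OF t])
      have hol: "holonomy F (sym_group n) ?\<Delta> \<sigma> C (eval_word F (t @ xs @ inv_word t)) (k y) = k (T.transport q xs y)"
        if xs: "path ?\<Gamma> q xs q" for xs y
      proof -
        have w: "path ?\<Delta> (gmap \<eta> q) xs (gmap \<eta> q)" by (rule path_emap[OF m xs])
        have wt: "path ?\<Delta> (gmap \<eta> q) (xs @ inv_word t) (base C)"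
          using w path_inv[OF mc t] path_append[OF mc] by blast
        then have p: "path ?\<Delta> (base C) (t @ xs @ inv_word t) (base C)"
          using t path_append[OF mc] by blast
        show ?thesis
          using holonomy_eval[OF F mc S \<sigma> p] D.transport_append[OF t wt] D.transport_append[OF w path_inv[OF mc t]]
            D.transport_back[OF t] reading_emap[OF m xs, of "sym_group n" \<sigma>] by (simp add: k_def)
      qed
      have img: "image_subgroup F \<eta> C C' = {eval_word F (t @ xs @ inv_word t) | xs. path ?\<Gamma> q xs q}"
        by (simp add: image_subgroup_def Let_def q_def t_def)
      let ?Y = "{y \<in> {1..n}. \<forall>xs. path ?\<Gamma> q xs q \<longrightarrow> T.transport q xs y = y}"
      have "bij_betw k ?Y (?X \<sigma> C C')"
        unfolding bij_betw_def
      proof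
        show "inj_on k ?Y"
          using permutes_inj[OF kp] by (rule inj_on_subset) simp
        show "k ` ?Y = ?X \<sigma> C C'"
        proof (intro equalityI subsetI)
          fix x assume "x \<in> k ` ?Y"
          then show "x \<in> ?X \<sigma> C C'"
            using hol permutes_in_image[OF kp] unfolding img by auto
        next
          fix x assume x: "x \<in> ?X \<sigma> C C'"
          obtain y where y: "x = k y" using permutes_surj[OF kp] by (metis surjD)
          have "y \<in> {1..n}" using x y permutes_in_image[OF kp] by auto
          moreover have "T.transport q xs y = y" if "path ?\<Gamma> q xs q" for xs
          proof -
            have "k (T.transport q xs y) = k y" using x y hol[OF that] that unfolding img by auto
            then show ?thesis using permutes_inj[OF kp] by (simp add: inj_eq)
          qed
          ultimately show "x \<in> k ` ?Y" using y by auto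
        qed
      qed
      from bij_betw_same_card[OF this] show ?thesis by (simp add: q_def)
    qed
    then have "(\<Prod>C \<in> components ?\<Delta>. \<Prod>C' \<in> I C. complex_of_nat (card (?X \<sigma> C C'))) = (\<Prod>C \<in> components ?\<Delta>. \<Prod>C' \<in> I C. ?c C')"
      by (intro prod.cong refl) (auto simp: I_def)
    also have "\<dots> = (\<Prod>C \<in> components ?\<Delta>. \<Prod>C' \<in> {C' \<in> components ?\<Gamma>. comp_of ?\<Delta> (gmap \<eta> (base C')) = C}. ?c C')"
      using I by (intro prod.cong) auto
    also have "\<dots> = (\<Prod>C' \<in> components ?\<Gamma>. ?c C')"
      using comp_of_in[OF mc V] by (intro prod.group finite_components[OF mc] finite_components[OF mcd]) auto
    also have "\<dots> = of_nat (card (sections n ?\<Gamma> ?\<tau>))" by (simp add: T.card_sections)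
    finally show "(\<Prod>C \<in> components ?\<Delta>. \<Prod>C' \<in> I C. complex_of_nat (card (?X \<sigma> C C'))) = of_nat (card (sections n ?\<Gamma> ?\<tau>))" .
  qed
  finally show ?thesis .
qed

section \<open>Sections over cycles\<close>

context
  fixes F :: "('f, 'm) monoid_scheme" and B :: "'f set" and ws :: "'f list"
  assumes F: "free_basis F B" and ws: "multi_word F ws" and mcw: "multi_core_graph B (word_graph F B ws)"
begin

text \<open>On a cycle it suffices that the value at the start is fixed by the transport once around. The value
  at another vertex is transported from the start along the remaining part of the cycle.\<close>
lemma word_sections_bij:
  assumes \<tau>: "\<And>e. e \<in> gedges (word_graph F B ws) \<Longrightarrow> \<tau> e permutes {1..n}"
  shows "bij_betw (\<lambda>s. \<lambda>j \<in> {..<length ws}. s (j, 0)) (sections n (word_graph F B ws) \<tau>)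
    (PiE {..<length ws} (\<lambda>j. {y \<in> {1..n}. reading (sym_group n) (word_graph F B ws) \<tau> (j, 0) (cyc F B ws j) y = y}))"
proof -
  let ?\<Gamma> = "word_graph F B ws"
  interpret permutation_labelling n B ?\<Gamma> \<tau> using mcw \<tau> by (simp add: permutation_labelling_def)
  note start = word_start[OF F ws] and path = word_path[OF F ws]
    and drop_path = word_path_drop[OF F ws]
  define Fix where "Fix j = {y \<in> {1..n}. transport (j, 0) (cyc F B ws j) y = y}" for j
  define S where "S a = (\<lambda>(j, i) \<in> gverts ?\<Gamma>. transport (j, i) (drop i (cyc F B ws j)) (a j))" for a
  have V: "(j, i) \<in> gverts ?\<Gamma> \<longleftrightarrow> j < length ws \<and> i < length (cyc F B ws j)" for j i
    by (simp add: word_graph_verts)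
  have dp: "path ?\<Gamma> (j, i) (drop i (cyc F B ws j)) (j, 0)" if "(j, i) \<in> gverts ?\<Gamma>" for j i
    using drop_path[of j i] that by (simp add: V)
  have "bij_betw (\<lambda>s. \<lambda>j \<in> {..<length ws}. s (j, 0)) (sections n ?\<Gamma> \<tau>) (PiE {..<length ws} Fix)"
  proof (rule bij_betw_byWitness[where f' = S])
    show "\<forall>s \<in> sections n ?\<Gamma> \<tau>. S (\<lambda>j \<in> {..<length ws}. s (j, 0)) = s"
    proof
      fix s assume s: "s \<in> sections n ?\<Gamma> \<tau>"
      show "S (\<lambda>j \<in> {..<length ws}. s (j, 0)) = s"
      proof (rule extensionalityI[of _ "gverts ?\<Gamma>"])
        fix v assume v: "v \<in> gverts ?\<Gamma>"
        obtain j i where ji: "v = (j, i)" by (cases v)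
        show "S (\<lambda>j \<in> {..<length ws}. s (j, 0)) v = s v"
          using section_transport[OF _ dp[OF v[unfolded ji]], of s] s v V[of j i]
          by (simp add: S_def sections_def ji)
      qed (use s in \<open>auto simp: S_def sections_def PiE_def\<close>)
    qed
    show "(\<lambda>s. \<lambda>j \<in> {..<length ws}. s (j, 0)) ` sections n ?\<Gamma> \<tau> \<subseteq> PiE {..<length ws} Fix"
    proof (rule subsetI)
      fix a assume "a \<in> (\<lambda>s. \<lambda>j \<in> {..<length ws}. s (j, 0)) ` sections n ?\<Gamma> \<tau>"
      then obtain s where s: "s \<in> sections n ?\<Gamma> \<tau>" "a = (\<lambda>j \<in> {..<length ws}. s (j, 0))" by auto
      have "s (j, 0) \<in> Fix j" if j: "j < length ws" for j
        using section_transport[OF _ path[OF j], of s] s(1) start[OF j] by (auto simp: Fix_def sections_def)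
      then show "a \<in> PiE {..<length ws} Fix" using s by auto
    qed
    show "\<forall>a \<in> PiE {..<length ws} Fix. (\<lambda>j \<in> {..<length ws}. S a (j, 0)) = a"
    proof
      fix a assume a: "a \<in> PiE {..<length ws} Fix"
      have "S a (j, 0) = a j" if j: "j < length ws" for j
        using PiE_mem[OF a, of j] j start[OF j] by (simp add: S_def Fix_def)
      then show "(\<lambda>j \<in> {..<length ws}. S a (j, 0)) = a"
        using a by (intro extensionalityI[of _ "{..<length ws}"]) (auto simp: PiE_def)
    qed
    show "S ` PiE {..<length ws} Fix \<subseteq> sections n ?\<Gamma> \<tau>"
    proof (rule subsetI)
      fix s assume "s \<in> S ` PiE {..<length ws} Fix"
      then obtain a where a: "a \<in> PiE {..<length ws} Fix" "s = S a" by auto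
      have aj: "a j \<in> {1..n}" "transport (j, 0) (cyc F B ws j) (a j) = a j" if "j < length ws" for j
        using PiE_mem[OF a(1), of j] that by (auto simp: Fix_def)
      have "s v \<in> {1..n}" if v: "v \<in> gverts ?\<Gamma>" for v
      proof -
        obtain j i where ji: "v = (j, i)" by (cases v)
        then show ?thesis
          using transport_permutes[OF dp[OF v[unfolded ji]]] aj(1)[of j] v V[of j i]
          by (simp add: a(2) S_def permutes_in_image del: atLeastAtMost_iff)
      qed
      moreover have "\<tau> e (s (snd (snd e))) = s (fst e)" if e: "e \<in> gedges ?\<Gamma>" for e
      proof -
        obtain j i where ji: "j < length ws" "i < length (cyc F B ws j)"
            "e = edge_along (j, i) (cyc F B ws j ! i) (j, Suc i mod length (cyc F B ws j))"
          using e V unfolding word_graph_edges by auto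
        let ?i' = "Suc i mod length (cyc F B ws j)"
        have e': "edge_along (j, i) (cyc F B ws j ! i) (j, ?i') \<in> gedges ?\<Gamma>" using ji e by simp
        have V': "(j, i) \<in> gverts ?\<Gamma>" "(j, ?i') \<in> gverts ?\<Gamma>" using edge_alongD[OF mcw e'] by auto
        have i': "s (j, ?i') = transport (j, ?i') (drop (Suc i) (cyc F B ws j)) (a j)"
        proof (cases "Suc i = length (cyc F B ws j)")
          case True
          then show ?thesis using V' aj(2)[OF ji(1)] by (simp add: a(2) S_def)
        next
          case False
          then have "?i' = Suc i" using ji by simp
          then show ?thesis using V' by (simp add: a(2) S_def)
        qed
        have "s (j, i) = transport (j, i) (cyc F B ws j ! i # drop (Suc i) (cyc F B ws j)) (a j)"
          using V' ji by (simp add: a(2) S_def Cons_nth_drop_Suc)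
        also have "\<dots> = letter_value (sym_group n) \<tau> (j, i) (cyc F B ws j ! i) (j, ?i') (s (j, ?i'))"
          by (simp add: reading_Cons[OF mcw e'] i')
        finally show ?thesis using letter_section[OF e'] ji(3) by simp
      qed
      moreover have "s \<in> extensional (gverts ?\<Gamma>)" unfolding a(2) S_def by (rule restrict_extensional)
      ultimately show "s \<in> sections n ?\<Gamma> \<tau>" by (intro sectionsI) (blast, fastforce, blast)
    qed
  qed
  then show ?thesis unfolding Fix_def[abs_def] .
qed

end

section \<open>Wreath products\<close>

context
  fixes G :: "('g, 'l) monoid_scheme" and n :: nat
  assumes G: "group G"
begin

interpretation G: group G by (rule G)

lemma wreath_carrier: "(v, \<sigma>) \<in> carrier (wreath G n) \<longleftrightarrow> v \<in> {1..n} \<rightarrow>\<^sub>E carrier G \<and> \<sigma> permutes {1..n}"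
  by (simp add: wreath_def)

lemma wreath_mult: "(v, \<sigma>) \<otimes>\<^bsub>wreath G n\<^esub> (w, \<tau>) =
    (\<lambda>i \<in> {1..n}. v i \<otimes>\<^bsub>G\<^esub> w (inv' \<sigma> i), \<sigma> \<circ> \<tau>)"
  by (simp add: wreath_def)

lemma wreath_one: "\<one>\<^bsub>wreath G n\<^esub> = (\<lambda>i \<in> {1..n}. \<one>\<^bsub>G\<^esub>, id)"
  by (simp add: wreath_def)

lemma wreath_left_inverse:
  assumes "v \<in> {1..n} \<rightarrow>\<^sub>E carrier G" "\<sigma> permutes {1..n}"
  shows "(\<lambda>i \<in> {1..n}. inv\<^bsub>G\<^esub> (v (\<sigma> i)), inv' \<sigma>) \<in> carrier (wreath G n)"
    "(\<lambda>i \<in> {1..n}. inv\<^bsub>G\<^esub> (v (\<sigma> i)), inv' \<sigma>) \<otimes>\<^bsub>wreath G n\<^esub> (v, \<sigma>) = \<one>\<^bsub>wreath G n\<^esub>"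
proof -
  have v: "v i \<in> carrier G" if "i \<in> {1..n}" for i using assms(1) that by (rule PiE_mem)
  have s: "\<sigma> i \<in> {1..n}" if "i \<in> {1..n}" for i using that permutes_in_image[OF assms(2)] by simp
  show "(\<lambda>i \<in> {1..n}. inv\<^bsub>G\<^esub> (v (\<sigma> i)), inv' \<sigma>) \<in> carrier (wreath G n)"
    using v[OF s] permutes_inv[OF assms(2)] by (auto simp: wreath_carrier simp del: atLeastAtMost_iff)
  show "(\<lambda>i \<in> {1..n}. inv\<^bsub>G\<^esub> (v (\<sigma> i)), inv' \<sigma>) \<otimes>\<^bsub>wreath G n\<^esub> (v, \<sigma>) = \<one>\<^bsub>wreath G n\<^esub>"
    using v[OF s] permutes_inv_o[OF assms(2)] permutes_inv_inv[OF assms(2)]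
    by (auto simp: wreath_mult wreath_one restrict_def simp del: atLeastAtMost_iff)
qed

lemma wreath_group: "group (wreath G n)"
proof (rule groupI)
  fix x y assume "x \<in> carrier (wreath G n)" "y \<in> carrier (wreath G n)"
  then obtain v \<sigma> w \<tau> where xy: "x = (v, \<sigma>)" "y = (w, \<tau>)" "v \<in> {1..n} \<rightarrow>\<^sub>E carrier G" "\<sigma> permutes {1..n}"
      "w \<in> {1..n} \<rightarrow>\<^sub>E carrier G" "\<tau> permutes {1..n}"
    by (cases x, cases y) (auto simp: wreath_carrier)
  have "v i \<otimes>\<^bsub>G\<^esub> w (inv' \<sigma> i) \<in> carrier G" if i: "i \<in> {1..n}" for i
    using PiE_mem[OF xy(3) i] PiE_mem[OF xy(5), of "inv' \<sigma> i"] i permutes_in_image[OF permutes_inv[OF xy(4)]]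
    by simp
  then show "x \<otimes>\<^bsub>wreath G n\<^esub> y \<in> carrier (wreath G n)"
    using permutes_compose[OF xy(6,4)] by (auto simp: xy(1,2) wreath_mult wreath_carrier simp del: atLeastAtMost_iff)
next
  show "\<one>\<^bsub>wreath G n\<^esub> \<in> carrier (wreath G n)"
    by (auto simp: wreath_one wreath_carrier permutes_id)
next
  fix x y z assume c: "x \<in> carrier (wreath G n)" "y \<in> carrier (wreath G n)" "z \<in> carrier (wreath G n)"
  obtain v \<sigma> w \<tau> u \<rho> where xyz: "x = (v, \<sigma>)" "y = (w, \<tau>)" "z = (u, \<rho>)"
    by (cases x, cases y, cases z)
  have v: "v \<in> {1..n} \<rightarrow>\<^sub>E carrier G" "w \<in> {1..n} \<rightarrow>\<^sub>E carrier G" "u \<in> {1..n} \<rightarrow>\<^sub>E carrier G"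
    and p: "\<sigma> permutes {1..n}" "\<tau> permutes {1..n}" "\<rho> permutes {1..n}"
    using c by (auto simp: xyz wreath_carrier)
  have inv: "inv' (\<sigma> \<circ> \<tau>) i = inv' \<tau> (inv' \<sigma> i)" for i
    using o_inv_distrib[OF permutes_bij[OF p(1)] permutes_bij[OF p(2)]] by simp
  have im: "inv' \<sigma> i \<in> {1..n}" "inv' \<tau> i \<in> {1..n}" if "i \<in> {1..n}" for i
    using that permutes_in_image[OF permutes_inv[OF p(1)]] permutes_in_image[OF permutes_inv[OF p(2)]] by auto
  show "x \<otimes>\<^bsub>wreath G n\<^esub> y \<otimes>\<^bsub>wreath G n\<^esub> z = x \<otimes>\<^bsub>wreath G n\<^esub> (y \<otimes>\<^bsub>wreath G n\<^esub> z)"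
    using im PiE_mem[OF v(1)] PiE_mem[OF v(2)] PiE_mem[OF v(3)]
    by (auto simp: xyz wreath_mult inv G.m_assoc comp_assoc simp del: atLeastAtMost_iff intro!: restrict_ext)
next
  fix x assume c: "x \<in> carrier (wreath G n)"
  obtain v \<sigma> where x: "x = (v, \<sigma>)" by (cases x)
  have v: "v \<in> {1..n} \<rightarrow>\<^sub>E carrier G" "\<sigma> permutes {1..n}" using c by (auto simp: x wreath_carrier)
  have "(\<lambda>i \<in> {1..n}. \<one>\<^bsub>G\<^esub> \<otimes>\<^bsub>G\<^esub> v i) = v"
    using v(1) PiE_mem[OF v(1)] by (intro extensionalityI[of _ "{1..n}"]) (simp_all add: PiE_def)
  moreover have "(\<lambda>i \<in> {1..n}. (\<lambda>i \<in> {1..n}. \<one>\<^bsub>G\<^esub>) i \<otimes>\<^bsub>G\<^esub> v (inv' id i)) = (\<lambda>i \<in> {1..n}. \<one>\<^bsub>G\<^esub> \<otimes>\<^bsub>G\<^esub> v i)"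
    by (intro restrict_ext) simp
  ultimately show "\<one>\<^bsub>wreath G n\<^esub> \<otimes>\<^bsub>wreath G n\<^esub> x = x"
    unfolding x wreath_one wreath_mult by simp
  show "\<exists>y \<in> carrier (wreath G n). y \<otimes>\<^bsub>wreath G n\<^esub> x = \<one>\<^bsub>wreath G n\<^esub>"
    using wreath_left_inverse[OF v] x by blast
qed

lemma wreath_inv:
  assumes "(v, \<sigma>) \<in> carrier (wreath G n)"
  shows "inv\<^bsub>wreath G n\<^esub> (v, \<sigma>) = (\<lambda>i \<in> {1..n}. inv\<^bsub>G\<^esub> (v (\<sigma> i)), inv' \<sigma>)"
proof -
  have v: "v \<in> {1..n} \<rightarrow>\<^sub>E carrier G" "\<sigma> permutes {1..n}" using assms by (auto simp: wreath_carrier)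
  show ?thesis
    by (rule group.inv_equality[OF wreath_group wreath_left_inverse(2)[OF v] assms wreath_left_inverse(1)[OF v]])
qed

lemma finite_wreath: "finite (carrier G) \<Longrightarrow> finite (carrier (wreath G n))"
  by (simp add: wreath_def finite_PiE finite_permutations)

text \<open>Conjugation by an element with permutation part \<open>\<tau>\<close> maps the fixed points by \<open>\<tau>\<close> and conjugates the
  coordinate at each fixed point in \<open>G\<close>.\<close>
lemma class_function_Ind:
  assumes "class_function G \<phi>"
  shows "class_function (wreath G n) (Ind n \<phi>)"
  unfolding class_function_def
proof (intro ballI)
  fix x y assume c: "x \<in> carrier (wreath G n)" "y \<in> carrier (wreath G n)"
  obtain v \<sigma> w \<tau> where xy: "x = (v, \<sigma>)" "y = (w, \<tau>)" by (cases x, cases y)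
  have v: "v \<in> {1..n} \<rightarrow>\<^sub>E carrier G" "w \<in> {1..n} \<rightarrow>\<^sub>E carrier G"
    and p: "\<sigma> permutes {1..n}" "\<tau> permutes {1..n}" using c by (auto simp: xy wreath_carrier)
  have bij: "bij_betw \<tau> {i \<in> {1..n}. \<sigma> i = i} {i \<in> {1..n}. (\<tau> \<circ> \<sigma> \<circ> inv' \<tau>) i = i}"
  proof (rule bij_betw_byWitness[where f' = "inv' \<tau>"])
    show "\<tau> ` {i \<in> {1..n}. \<sigma> i = i} \<subseteq> {i \<in> {1..n}. (\<tau> \<circ> \<sigma> \<circ> inv' \<tau>) i = i}"
      using permutes_in_image[OF p(2)] permutes_inverses(2)[OF p(2)] by auto
    show "inv' \<tau> ` {i \<in> {1..n}. (\<tau> \<circ> \<sigma> \<circ> inv' \<tau>) i = i} \<subseteq> {i \<in> {1..n}. \<sigma> i = i}"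
    proof (rule image_subsetI)
      fix i assume i: "i \<in> {i \<in> {1..n}. (\<tau> \<circ> \<sigma> \<circ> inv' \<tau>) i = i}"
      then have "inv' \<tau> (\<tau> (\<sigma> (inv' \<tau> i))) = inv' \<tau> i" by simp
      then have "\<sigma> (inv' \<tau> i) = inv' \<tau> i" by (simp only: permutes_inverses(2)[OF p(2)])
      then show "inv' \<tau> i \<in> {i \<in> {1..n}. \<sigma> i = i}"
        using i permutes_in_image[OF permutes_inv[OF p(2)]] by simp
    qed
  qed (use permutes_inverses[OF p(2)] in auto)
  have conj: "fst (y \<otimes>\<^bsub>wreath G n\<^esub> x \<otimes>\<^bsub>wreath G n\<^esub> inv\<^bsub>wreath G n\<^esub> y) (\<tau> j) = w (\<tau> j) \<otimes>\<^bsub>G\<^esub> v j \<otimes>\<^bsub>G\<^esub> inv\<^bsub>G\<^esub> (w (\<tau> j))"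
    if j: "j \<in> {1..n}" "\<sigma> j = j" for j
  proof -
    have "inv' (\<tau> \<circ> \<sigma>) (\<tau> j) = j"
      using o_inv_distrib[OF permutes_bij[OF p(2)] permutes_bij[OF p(1)]] permutes_inverses(2)[OF p(2)]
        permutes_inv_eq[OF p(1), of j j] j by simp
    moreover have "\<tau> j \<in> {1..n}" using j permutes_in_image[OF p(2)] by simp
    ultimately show ?thesis
      using c j permutes_inverses(2)[OF p(2)] by (simp add: xy wreath_inv wreath_mult del: atLeastAtMost_iff)
  qed
  have snd: "snd (y \<otimes>\<^bsub>wreath G n\<^esub> x \<otimes>\<^bsub>wreath G n\<^esub> inv\<^bsub>wreath G n\<^esub> y) = \<tau> \<circ> \<sigma> \<circ> inv' \<tau>"
    using c by (simp add: xy wreath_inv wreath_mult)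
  have "Ind n \<phi> (y \<otimes>\<^bsub>wreath G n\<^esub> x \<otimes>\<^bsub>wreath G n\<^esub> inv\<^bsub>wreath G n\<^esub> y)
      = (\<Sum>i \<in> {i \<in> {1..n}. (\<tau> \<circ> \<sigma> \<circ> inv' \<tau>) i = i}. \<phi> (fst (y \<otimes>\<^bsub>wreath G n\<^esub> x \<otimes>\<^bsub>wreath G n\<^esub> inv\<^bsub>wreath G n\<^esub> y) i))"
    unfolding Ind_def case_prod_unfold snd ..
  also have "\<dots> = (\<Sum>j \<in> {i \<in> {1..n}. \<sigma> i = i}. \<phi> (fst (y \<otimes>\<^bsub>wreath G n\<^esub> x \<otimes>\<^bsub>wreath G n\<^esub> inv\<^bsub>wreath G n\<^esub> y) (\<tau> j)))"
    by (rule sum.reindex_bij_betw[OF bij, symmetric])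
  also have "\<dots> = (\<Sum>j \<in> {i \<in> {1..n}. \<sigma> i = i}. \<phi> (v j))"
  proof (intro sum.cong refl)
    fix j assume "j \<in> {i \<in> {1..n}. \<sigma> i = i}"
    then have j: "j \<in> {1..n}" "\<sigma> j = j" by auto
    then have "v j \<in> carrier G" "w (\<tau> j) \<in> carrier G"
      using PiE_mem[OF v(1)] PiE_mem[OF v(2)] permutes_in_image[OF p(2)] by auto
    then show "\<phi> (fst (y \<otimes>\<^bsub>wreath G n\<^esub> x \<otimes>\<^bsub>wreath G n\<^esub> inv\<^bsub>wreath G n\<^esub> y) (\<tau> j)) = \<phi> (v j)"
      unfolding conj[OF j] using assms by (simp add: class_function_def)
  qed
  also have "\<dots> = Ind n \<phi> x" by (simp add: Ind_def xy)
  finally show "Ind n \<phi> (y \<otimes>\<^bsub>wreath G n\<^esub> x \<otimes>\<^bsub>wreath G n\<^esub> inv\<^bsub>wreath G n\<^esub> y) = Ind n \<phi> x" .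
qed

lemma snd_reading_wreath:
  assumes mc: "multi_core_graph B \<Gamma>" and \<beta>: "\<And>e. e \<in> gedges \<Gamma> \<Longrightarrow> \<beta> e \<in> carrier (wreath G n)"
    and p: "path \<Gamma> u xs v"
  shows "snd (reading (wreath G n) \<Gamma> \<beta> u xs) = reading (sym_group n) \<Gamma> (\<lambda>e. snd (\<beta> e)) u xs"
  using p
proof (induction xs arbitrary: u)
  case Nil then show ?case by (simp add: wreath_one)
next
  case (Cons l xs)
  then obtain u' where u': "edge_along u l u' \<in> gedges \<Gamma>" "path \<Gamma> u' xs v" by (auto simp: path_Cons)
  obtain a \<sigma> where a: "\<beta> (edge_along u l u') = (a, \<sigma>)" by force
  obtain b \<rho> where b: "reading (wreath G n) \<Gamma> \<beta> u' xs = (b, \<rho>)" by force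
  have "\<sigma> permutes {1..n}" using \<beta>[OF u'(1)] by (simp add: a wreath_carrier)
  then have "inv\<^bsub>sym_group n\<^esub> \<sigma> = inv' \<sigma>" by (intro sym_group_inv_equality) simp
  then show ?case
    using Cons.IH[OF u'(2)] \<beta>[OF u'(1)] a b
    by (auto simp: reading_Cons[OF mc u'(1)] letter_value_def wreath_mult wreath_inv)
qed

text \<open>The coordinate at the sheet \<open>s u\<close> collects the coordinates met along the lift \<open>s\<close>. Both for a
  forward and for a backward step this is the coordinate of the edge at the sheet over its
  origin.\<close>
lemma fst_reading_wreath:
  assumes mc: "multi_core_graph B \<Gamma>" and \<beta>: "\<And>e. e \<in> gedges \<Gamma> \<Longrightarrow> \<beta> e \<in> carrier (wreath G n)"
    and s: "s \<in> sections n \<Gamma> (\<lambda>e. snd (\<beta> e))" and p: "path \<Gamma> u xs v"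
  shows "fst (reading (wreath G n) \<Gamma> \<beta> u xs) (s u) = reading G \<Gamma> (\<lambda>e. fst (\<beta> e) (s (fst e))) u xs"
  using p
proof (induction xs arbitrary: u)
  case Nil
  then have "s u \<in> {1..n}" using s by (auto simp: sections_def)
  then show ?case by (simp add: wreath_one)
next
  case (Cons l xs)
  then obtain u' where u': "edge_along u l u' \<in> gedges \<Gamma>" "path \<Gamma> u' xs v" by (auto simp: path_Cons)
  obtain a \<sigma> where a: "\<beta> (edge_along u l u') = (a, \<sigma>)" by force
  obtain b \<rho> where b: "reading (wreath G n) \<Gamma> \<beta> u' xs = (b, \<rho>)" by force
  have c: "(a, \<sigma>) \<in> carrier (wreath G n)" using \<beta>[OF u'(1)] a by simp
  then have p: "\<sigma> permutes {1..n}" by (simp add: wreath_carrier)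
  have S: "s u \<in> {1..n}" using s edge_alongD[OF mc u'(1)] by (auto simp: sections_def)
  have "snd (\<beta> (edge_along u l u')) (s (snd (snd (edge_along u l u')))) = s (fst (edge_along u l u'))"
    using s u'(1) by (simp add: sections_def is_section_def)
  then have se: "\<sigma> (s (snd (snd (edge_along u l u')))) = s (fst (edge_along u l u'))" by (simp add: a)
  show ?case
  proof (cases "snd l")
    case True
    then have "inv' \<sigma> (s u) = s u'" using se by (simp add: edge_along_def permutes_inv_eq[OF p])
    then show ?thesis
      using Cons.IH[OF u'(2)] S a b True
      by (simp add: reading_Cons[OF mc u'(1)] letter_value_def wreath_mult edge_along_def del: atLeastAtMost_iff)
  next
    case False
    then have "\<sigma> (s u) = s u'" using se by (simp add: edge_along_def)
    moreover have "inv' (inv' \<sigma>) = \<sigma>" by (rule permutes_inv_inv[OF p])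
    ultimately show ?thesis
      using Cons.IH[OF u'(2)] S a b False c
      by (simp add: reading_Cons[OF mc u'(1)] letter_value_def wreath_mult wreath_inv edge_along_def del: atLeastAtMost_iff)
  qed
qed

text \<open>The pair \<open>(e, i)\<close> stands for the edge of the cover that lies over \<open>e\<close> and has its origin in the
  sheet \<open>i\<close>.\<close>
lemma wreath_labellings_bij:
  "bij_betw (\<lambda>(\<sigma>, v). \<lambda>e \<in> E. (\<lambda>i \<in> {1..n}. v (e, i), \<sigma> e))
    ((E \<rightarrow>\<^sub>E carrier (sym_group n)) \<times> ((E \<times> {1..n}) \<rightarrow>\<^sub>E carrier G)) (E \<rightarrow>\<^sub>E carrier (wreath G n))"
proof (rule bij_betw_byWitness[where f' = "\<lambda>\<beta>. (\<lambda>e \<in> E. snd (\<beta> e), \<lambda>(e, i) \<in> E \<times> {1..n}. fst (\<beta> e) i)"])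
  let ?f = "\<lambda>(\<sigma>, v). \<lambda>e \<in> E. (\<lambda>i \<in> {1..n}. v (e, i), \<sigma> e)"
  let ?f' = "\<lambda>\<beta>. (\<lambda>e \<in> E. snd (\<beta> e), \<lambda>(e, i) \<in> E \<times> {1..n}. fst (\<beta> e) i)"
  show "\<forall>q \<in> (E \<rightarrow>\<^sub>E carrier (sym_group n)) \<times> ((E \<times> {1..n}) \<rightarrow>\<^sub>E carrier G). ?f' (?f q) = q"
  proof
    fix q assume "q \<in> (E \<rightarrow>\<^sub>E carrier (sym_group n)) \<times> ((E \<times> {1..n}) \<rightarrow>\<^sub>E carrier G)"
    then obtain \<sigma> v where q: "q = (\<sigma>, v)" "\<sigma> \<in> E \<rightarrow>\<^sub>E carrier (sym_group n)" "v \<in> (E \<times> {1..n}) \<rightarrow>\<^sub>E carrier G" by auto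
    have "(\<lambda>e \<in> E. snd (?f (\<sigma>, v) e)) = \<sigma>"
      using q(2) by (intro extensionalityI[of _ E]) (auto simp: PiE_def)
    moreover have "(\<lambda>(e, i) \<in> E \<times> {1..n}. fst (?f (\<sigma>, v) e) i) = v"
      using q(3) by (intro extensionalityI[of _ "E \<times> {1..n}"]) (auto simp: PiE_def)
    ultimately show "?f' (?f q) = q" by (simp add: q(1))
  qed
  show "\<forall>\<beta> \<in> E \<rightarrow>\<^sub>E carrier (wreath G n). ?f (?f' \<beta>) = \<beta>"
  proof
    fix \<beta> assume \<beta>: "\<beta> \<in> E \<rightarrow>\<^sub>E carrier (wreath G n)"
    show "?f (?f' \<beta>) = \<beta>"
    proof (rule extensionalityI[of _ E])
      fix e assume e: "e \<in> E"
      obtain v \<sigma> where b: "\<beta> e = (v, \<sigma>)" by force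
      have "v \<in> extensional {1..n}" using PiE_mem[OF \<beta> e] by (simp add: b wreath_carrier PiE_def)
      then have "(\<lambda>i \<in> {1..n}. v i) = v" by (rule extensional_restrict)
      moreover have "(\<lambda>i \<in> {1..n}. (\<lambda>(e, i) \<in> E \<times> {1..n}. fst (\<beta> e) i) (e, i)) = (\<lambda>i \<in> {1..n}. v i)"
        using e by (intro restrict_ext) (simp add: b)
      ultimately show "?f (?f' \<beta>) e = \<beta> e" using e by (simp add: b)
    qed (use \<beta> in \<open>auto simp: PiE_def\<close>)
  qed
  show "?f ` ((E \<rightarrow>\<^sub>E carrier (sym_group n)) \<times> ((E \<times> {1..n}) \<rightarrow>\<^sub>E carrier G)) \<subseteq> E \<rightarrow>\<^sub>E carrier (wreath G n)"
  proof (rule subsetI)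
    fix \<beta> assume "\<beta> \<in> ?f ` ((E \<rightarrow>\<^sub>E carrier (sym_group n)) \<times> ((E \<times> {1..n}) \<rightarrow>\<^sub>E carrier G))"
    then obtain \<sigma> v where q: "\<beta> = ?f (\<sigma>, v)" "\<sigma> \<in> E \<rightarrow>\<^sub>E carrier (sym_group n)" "v \<in> (E \<times> {1..n}) \<rightarrow>\<^sub>E carrier G" by blast
    then show "\<beta> \<in> E \<rightarrow>\<^sub>E carrier (wreath G n)"
      using PiE_mem[OF q(2)] PiE_mem[OF q(3)] unfolding q(1) by (auto simp: wreath_carrier)
  qed
  show "?f' ` (E \<rightarrow>\<^sub>E carrier (wreath G n)) \<subseteq> (E \<rightarrow>\<^sub>E carrier (sym_group n)) \<times> ((E \<times> {1..n}) \<rightarrow>\<^sub>E carrier G)"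
  proof (rule subsetI)
    fix q assume "q \<in> ?f' ` (E \<rightarrow>\<^sub>E carrier (wreath G n))"
    then obtain \<beta> where \<beta>: "\<beta> \<in> E \<rightarrow>\<^sub>E carrier (wreath G n)" "q = ?f' \<beta>" by blast
    have "snd (\<beta> e) permutes {1..n}" "fst (\<beta> e) \<in> {1..n} \<rightarrow>\<^sub>E carrier G" if "e \<in> E" for e
      using PiE_mem[OF \<beta>(1) that] wreath_carrier by (metis prod.collapse)+
    then show "q \<in> (E \<rightarrow>\<^sub>E carrier (sym_group n)) \<times> ((E \<times> {1..n}) \<rightarrow>\<^sub>E carrier G)"
      unfolding \<beta>(2) by (auto simp del: atLeastAtMost_iff)
  qed
qed

end

section \<open>Lifts to the cover of a permutation labelling\<close>

text \<open>The kernel of the lift \<open>v \<mapsto> (\<eta> v, s v)\<close> to the cover.\<close>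
definition joint_kernel :: "'f gmor \<Rightarrow> (vertex \<Rightarrow> nat) \<Rightarrow> (vertex \<times> vertex) set" where
  "joint_kernel \<eta> s = {(u, v). u \<in> gverts (gdom \<eta>) \<and> v \<in> gverts (gdom \<eta>) \<and> (gmap \<eta> u, s u) = (gmap \<eta> v, s v)}"

text \<open>The cover is folded, as permutations are injective. So the image of the lift is folded as well.\<close>
lemma section_edge_iff:
  assumes \<eta>: "\<eta> \<in> sur B" and \<sigma>: "\<And>e. e \<in> gedges (gcod \<eta>) \<Longrightarrow> \<sigma> e permutes {1..n}"
    and s: "s \<in> sections n (gdom \<eta>) (\<lambda>e. \<sigma> (emap (gmap \<eta>) e))"
    and e: "(u, b, v) \<in> gedges (gdom \<eta>)" "(u', b, v') \<in> gedges (gdom \<eta>)"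
  shows "(gmap \<eta> u, s u) = (gmap \<eta> u', s u') \<longleftrightarrow> (gmap \<eta> v, s v) = (gmap \<eta> v', s v')"
proof -
  let ?e = "(gmap \<eta> u, b, gmap \<eta> v)" and ?e' = "(gmap \<eta> u', b, gmap \<eta> v')"
  have E: "?e \<in> gedges (gcod \<eta>)" "?e' \<in> gedges (gcod \<eta>)"
    using e unfolding surD(4)[OF \<eta>, symmetric] by force+
  have g: "gmap \<eta> u = gmap \<eta> u' \<longleftrightarrow> gmap \<eta> v = gmap \<eta> v'"
    using multi_core_graphD(4)[OF surD(2)[OF \<eta>], of "gmap \<eta> u" b "gmap \<eta> v" "gmap \<eta> v'"]
      multi_core_graphD(5)[OF surD(2)[OF \<eta>], of "gmap \<eta> u" b "gmap \<eta> v" "gmap \<eta> u'"] E by auto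
  have "\<sigma> ?e (s v) = s u" "\<sigma> ?e' (s v') = s u'"
    using s e by (auto simp: sections_def is_section_def)
  moreover have "inj (\<sigma> ?e)" using permutes_inj[OF \<sigma>[OF E(1)]] .
  ultimately have "s u = s u' \<longleftrightarrow> s v = s v'" if "gmap \<eta> u = gmap \<eta> u'"
    using that g by (metis injD)
  then show ?thesis using g by auto
qed

lemma joint_kernel_in_kernels:
  assumes \<eta>: "\<eta> \<in> sur B" and \<sigma>: "\<And>e. e \<in> gedges (gcod \<eta>) \<Longrightarrow> \<sigma> e permutes {1..n}"
    and s: "s \<in> sections n (gdom \<eta>) (\<lambda>e. \<sigma> (emap (gmap \<eta>) e))"
  shows "joint_kernel \<eta> s \<in> kernels B (gdom \<eta>)"
  unfolding joint_kernel_def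
  by (rule folded_map_kernel[OF surD(1)[OF \<eta>]]) (rule section_edge_iff[OF \<eta> \<sigma> s])

text \<open>Since \<open>\<eta>1\<close> is onto vertices and edges, a section over \<open>\<eta>2\<close> is the same as a section over \<open>\<eta>\<close> that is
  constant on the fibres of \<open>\<eta>1\<close>.\<close>
lemma card_sections_decomp:
  assumes p: "(\<eta>1, \<eta>2) \<in> decomp_pairs B \<eta>"
  shows "card (sections n (gdom \<eta>2) (\<lambda>e. \<sigma> (emap (gmap \<eta>2) e))) =
    card {s \<in> sections n (gdom \<eta>) (\<lambda>e. \<sigma> (emap (gmap \<eta>) e)). mor_kernel \<eta>1 \<subseteq> joint_kernel \<eta> s}"
proof -
  note d = decomp_pairsD[OF p]
  let ?V = "gverts (gdom \<eta>)" and ?V1 = "gverts (gdom \<eta>2)" and ?h = "gmap \<eta>1"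
  have mc: "multi_core_graph B (gdom \<eta>)" using surD(1)[OF d(1)] d(3) by simp
  have onto: "?h ` ?V = ?V1" using surD(3)[OF d(1)] d(3,4) by simp
  have ontoE: "emap ?h ` gedges (gdom \<eta>) = gedges (gdom \<eta>2)" using surD(4)[OF d(1)] d(3,4) by simp
  have emap_eq: "emap (gmap \<eta>2) (emap ?h e) = emap (gmap \<eta>) e" if "e \<in> gedges (gdom \<eta>)" for e
    unfolding emap_emap by (rule emap_cong[OF mc that]) (rule d(6))
  define pre where "pre x = (SOME v. v \<in> ?V \<and> ?h v = x)" for x
  have pre: "pre x \<in> ?V" "?h (pre x) = x" if x: "x \<in> ?V1" for x
  proof -
    from x have "x \<in> ?h ` ?V" by (simp only: onto)
    then obtain v where v: "x = ?h v" "v \<in> ?V" by (rule imageE)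
    have "pre x \<in> ?V \<and> ?h (pre x) = x" unfolding pre_def by (rule someI[of _ v]) (use v in simp)
    then show "pre x \<in> ?V" "?h (pre x) = x" by auto
  qed
  let ?S1 = "sections n (gdom \<eta>2) (\<lambda>e. \<sigma> (emap (gmap \<eta>2) e))"
    and ?S = "{s \<in> sections n (gdom \<eta>) (\<lambda>e. \<sigma> (emap (gmap \<eta>) e)). mor_kernel \<eta>1 \<subseteq> joint_kernel \<eta> s}"
  have sec_iff: "is_section (gdom \<eta>) (\<lambda>e. \<sigma> (emap (gmap \<eta>) e)) s \<longleftrightarrow> is_section (gdom \<eta>2) (\<lambda>e. \<sigma> (emap (gmap \<eta>2) e)) s1"
    if s: "\<And>v. v \<in> ?V \<Longrightarrow> s v = s1 (?h v)" for s s1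
  proof -
    have "\<sigma> (emap (gmap \<eta>) e) (s (snd (snd e))) = s (fst e) \<longleftrightarrow>
      \<sigma> (emap (gmap \<eta>2) (emap ?h e)) (s1 (snd (snd (emap ?h e)))) = s1 (fst (emap ?h e))"
      if e: "e \<in> gedges (gdom \<eta>)" for e
    proof -
      obtain u b v where uv: "e = (u, b, v)" by (cases e)
      show ?thesis unfolding emap_eq[OF e] using s edge_ends[OF mc e[unfolded uv]] by (simp add: uv)
    qed
    then show ?thesis unfolding is_section_def ontoE[symmetric] by blast
  qed
  have const: "s (pre (?h v)) = s v" if s: "s \<in> ?S" and v: "v \<in> ?V" for s v
  proof -
    have "?h v \<in> ?V1" using v onto by auto
    then have "(pre (?h v), v) \<in> mor_kernel \<eta>1" using pre v d(3) by (simp add: mor_kernel_def)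
    then show ?thesis using s by (auto simp: joint_kernel_def)
  qed
  have "bij_betw (\<lambda>s. \<lambda>v \<in> ?V. s (?h v)) ?S1 ?S"
  proof (rule bij_betw_byWitness[where f' = "\<lambda>s. \<lambda>x \<in> ?V1. s (pre x)"])
    show "\<forall>s \<in> ?S1. (\<lambda>x \<in> ?V1. (\<lambda>v \<in> ?V. s (?h v)) (pre x)) = s"
    proof
      fix s assume "s \<in> ?S1"
      then show "(\<lambda>x \<in> ?V1. (\<lambda>v \<in> ?V. s (?h v)) (pre x)) = s"
        using pre by (intro extensionalityI[of _ ?V1]) (auto simp: sections_def PiE_def)
    qed
    show "\<forall>s \<in> ?S. (\<lambda>v \<in> ?V. (\<lambda>x \<in> ?V1. s (pre x)) (?h v)) = s"
    proof
      fix s assume s: "s \<in> ?S"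
      have "?h v \<in> ?V1" if "v \<in> ?V" for v using that onto by auto
      then show "(\<lambda>v \<in> ?V. (\<lambda>x \<in> ?V1. s (pre x)) (?h v)) = s"
        using const[OF s] s by (intro extensionalityI[of _ ?V]) (auto simp: sections_def PiE_def)
    qed
    show "(\<lambda>s. \<lambda>v \<in> ?V. s (?h v)) ` ?S1 \<subseteq> ?S"
    proof (rule image_subsetI)
      fix s assume s: "s \<in> ?S1"
      have "mor_kernel \<eta>1 \<subseteq> joint_kernel \<eta> (\<lambda>v \<in> ?V. s (?h v))"
      proof (rule subrelI)
        fix u v assume "(u, v) \<in> mor_kernel \<eta>1"
        then show "(u, v) \<in> joint_kernel \<eta> (\<lambda>v \<in> ?V. s (?h v))"
          using d(3) d(6)[of u] d(6)[of v] by (simp add: mor_kernel_def joint_kernel_def)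
      qed
      moreover have "is_section (gdom \<eta>) (\<lambda>e. \<sigma> (emap (gmap \<eta>) e)) (\<lambda>v \<in> ?V. s (?h v))"
        using sec_iff[of "\<lambda>v \<in> ?V. s (?h v)" s] s by (simp add: sections_def)
      moreover have "s (?h v) \<in> {1..n}" if "v \<in> ?V" for v
      proof -
        have "?h v \<in> ?V1" using that onto by auto
        then show ?thesis using s by (auto simp: sections_def)
      qed
      ultimately show "(\<lambda>v \<in> ?V. s (?h v)) \<in> ?S"
        by (simp add: sections_def PiE_iff)
    qed
    show "(\<lambda>s. \<lambda>x \<in> ?V1. s (pre x)) ` ?S \<subseteq> ?S1"
    proof (rule image_subsetI)
      fix s assume s: "s \<in> ?S"
      have "s v = (\<lambda>x \<in> ?V1. s (pre x)) (?h v)" if v: "v \<in> ?V" for v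
      proof -
        have "?h v \<in> ?V1" using v onto by auto
        then show ?thesis using const[OF s v] by simp
      qed
      then have "is_section (gdom \<eta>2) (\<lambda>e. \<sigma> (emap (gmap \<eta>2) e)) (\<lambda>x \<in> ?V1. s (pre x))"
        using sec_iff[of s "\<lambda>x \<in> ?V1. s (pre x)"] s by (simp add: sections_def)
      moreover have "s (pre x) \<in> {1..n}" if "x \<in> ?V1" for x
        using pre(1)[OF that] s by (auto simp: sections_def)
      ultimately show "(\<lambda>x \<in> ?V1. s (pre x)) \<in> ?S1"
        by (simp add: sections_def PiE_iff)
    qed
  qed
  then show ?thesis by (rule bij_betw_same_card)
qed

section \<open>The induction-convolution formula\<close>

definition word_product ::
  "('f, 'm) monoid_scheme \<Rightarrow> 'f set \<Rightarrow> 'f list \<Rightarrow> ('g, 'l) monoid_scheme \<Rightarrow> (nat \<Rightarrow> 'g \<Rightarrow> complex) \<Rightarrow>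
   (vertex \<times> 'f \<times> vertex \<Rightarrow> 'g) \<Rightarrow> complex" where
  "word_product F B ws K \<xi> \<gamma> =
     (\<Prod>j<length ws. \<xi> j (reading K (word_graph F B ws) \<gamma> (j, 0) (cyc F B ws j)))"

context
  fixes F :: "('f, 'm) monoid_scheme" and B :: "'f set" and ws :: "'f list"
    and G :: "('g, 'l) monoid_scheme" and \<zeta> :: "nat \<Rightarrow> 'g \<Rightarrow> complex" and n :: nat and \<eta> :: "'f gmor"
  assumes F: "free_basis F B" and ws: "multi_word F ws" and G: "group G" and fin: "finite (carrier G)"
    and \<zeta>: "\<And>j. j < length ws \<Longrightarrow> class_function G (\<zeta> j)"
    and \<eta>: "\<eta> \<in> Qset F B ws"
begin

lemma Qset_sur: "\<eta>' \<in> Qset F B ws \<longleftrightarrow> \<eta>' \<in> sur B \<and> gdom \<eta>' = gdom \<eta>"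
  using \<eta> by (auto simp: Qset_def)

lemma dom: "gdom \<eta> = word_graph F B ws" and sur: "\<eta> \<in> sur B"
  using \<eta> by (auto simp: Qset_def)

lemma mcw: "multi_core_graph B (word_graph F B ws)"
  using surD(1)[OF sur] dom by simp

lemma word_product_cong:
  assumes "\<And>e. e \<in> gedges (word_graph F B ws) \<Longrightarrow> f e = g e"
  shows "word_product F B ws K \<xi> f = word_product F B ws K \<xi> g"
  unfolding word_product_def
  by (intro prod.cong refl arg_cong[of _ _ "\<xi> _"] reading_cong[OF mcw word_path[OF F ws] assms]) auto

lemma expect_words_product:
  assumes "\<eta>' \<in> Qset F B ws"
  shows "expect_words F B ws G \<zeta> \<eta>' =
    average (gedges (gcod \<eta>') \<rightarrow>\<^sub>E carrier G) (\<lambda>\<beta>. word_product F B ws G \<zeta> (\<lambda>e. \<beta> (emap (gmap \<eta>') e)))"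
  using expect_words_labellings[OF F ws assms G fin \<zeta>] by (simp add: word_product_def)

text \<open>Each factor \<open>Ind (\<zeta> j)\<close> is a sum over the fixed points of the permutation once around the \<open>j\<close>-th
  cycle. Choosing a fixed point for every \<open>j\<close> amounts to choosing a section.\<close>
lemma word_product_Ind:
  assumes \<beta>: "\<And>e. e \<in> gedges (word_graph F B ws) \<Longrightarrow> \<beta> e \<in> carrier (wreath G n)"
  shows "word_product F B ws (wreath G n) (\<lambda>j. Ind n (\<zeta> j)) \<beta> =
    (\<Sum>s \<in> sections n (word_graph F B ws) (\<lambda>e. snd (\<beta> e)). word_product F B ws G \<zeta> (\<lambda>e. fst (\<beta> e) (s (fst e))))"
proof -
  let ?\<Gamma> = "word_graph F B ws" and ?c = "\<lambda>j. cyc F B ws j"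
  let ?\<tau> = "\<lambda>e. snd (\<beta> e)"
  define Fix where "Fix j = {y \<in> {1..n}. reading (sym_group n) ?\<Gamma> ?\<tau> (j, 0) (?c j) y = y}" for j
  let ?h = "\<lambda>j y. \<zeta> j (fst (reading (wreath G n) ?\<Gamma> \<beta> (j, 0) (?c j)) y)"
  note path = word_path[OF F ws]
  have perm: "?\<tau> e permutes {1..n}" if "e \<in> gedges ?\<Gamma>" for e
    using \<beta>[OF that] wreath_carrier[OF G, of "fst (\<beta> e)" "snd (\<beta> e)" n] by simp
  have "word_product F B ws (wreath G n) (\<lambda>j. Ind n (\<zeta> j)) \<beta> = (\<Prod>j<length ws. \<Sum>y \<in> Fix j. ?h j y)"
    unfolding word_product_def Ind_def case_prod_unfold Fix_def
    by (intro prod.cong refl) (simp add: snd_reading_wreath[OF G mcw \<beta> path])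
  also have "\<dots> = (\<Sum>a \<in> PiE {..<length ws} Fix. \<Prod>j<length ws. ?h j (a j))"
    by (rule prod_sum_PiE) (auto simp: Fix_def)
  also have "\<dots> = (\<Sum>s \<in> sections n ?\<Gamma> ?\<tau>. \<Prod>j<length ws. ?h j ((\<lambda>j \<in> {..<length ws}. s (j, 0)) j))"
    unfolding Fix_def[abs_def]
    by (rule sum.reindex_bij_betw[OF word_sections_bij[OF F ws mcw perm], symmetric])
  also have "\<dots> = (\<Sum>s \<in> sections n ?\<Gamma> ?\<tau>. word_product F B ws G \<zeta> (\<lambda>e. fst (\<beta> e) (s (fst e))))"
    unfolding word_product_def
  proof (intro sum.cong prod.cong refl)
    fix s j assume s: "s \<in> sections n ?\<Gamma> ?\<tau>" and j: "j \<in> {..<length ws}"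
    then have "path ?\<Gamma> (j, 0) (?c j) (j, 0)" using path by simp
    from fst_reading_wreath[OF G mcw \<beta> s this] j
    show "?h j ((\<lambda>j \<in> {..<length ws}. s (j, 0)) j) =
      \<zeta> j (reading G ?\<Gamma> (\<lambda>e. fst (\<beta> e) (s (fst e))) (j, 0) (?c j))" by simp
  qed
  finally show ?thesis .
qed

abbreviation "secs \<sigma> \<equiv> sections n (gdom \<eta>) (\<lambda>e. \<sigma> (emap (gmap \<eta>) e))"

lemma expect_wreath:
  "expect_words F B ws (wreath G n) (\<lambda>j. Ind n (\<zeta> j)) \<eta> =
    average (gedges (gcod \<eta>) \<rightarrow>\<^sub>E carrier (sym_group n)) (\<lambda>\<sigma>. \<Sum>s \<in> secs \<sigma>.
      average ((gedges (gcod \<eta>) \<times> {1..n}) \<rightarrow>\<^sub>E carrier G)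
        (\<lambda>v. word_product F B ws G \<zeta> (\<lambda>e. v (emap (gmap \<eta>) e, s (fst e)))))"
proof -
  let ?E = "gedges (gcod \<eta>)" and ?W = "wreath G n" and ?\<Gamma> = "word_graph F B ws"
  have E: "emap (gmap \<eta>) e \<in> ?E" if "e \<in> gedges ?\<Gamma>" for e using surD(4)[OF sur] dom that by auto
  have "expect_words F B ws ?W (\<lambda>j. Ind n (\<zeta> j)) \<eta> =
    average (?E \<rightarrow>\<^sub>E carrier ?W) (\<lambda>\<beta>. word_product F B ws ?W (\<lambda>j. Ind n (\<zeta> j)) (\<lambda>e. \<beta> (emap (gmap \<eta>) e)))"
    using expect_words_labellings[OF F ws \<eta> wreath_group[OF G] finite_wreath[OF G fin] class_function_Ind[OF G \<zeta>]]
    by (simp add: word_product_def)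
  also have "\<dots> = average (?E \<rightarrow>\<^sub>E carrier ?W) (\<lambda>\<beta>. \<Sum>s \<in> secs (\<lambda>e. snd (\<beta> e)).
      word_product F B ws G \<zeta> (\<lambda>e. fst (\<beta> (emap (gmap \<eta>) e)) (s (fst e))))"
  proof (rule average_cong)
    fix \<beta> assume \<beta>: "\<beta> \<in> ?E \<rightarrow>\<^sub>E carrier ?W"
    show "word_product F B ws ?W (\<lambda>j. Ind n (\<zeta> j)) (\<lambda>e. \<beta> (emap (gmap \<eta>) e)) =
      (\<Sum>s \<in> secs (\<lambda>e. snd (\<beta> e)). word_product F B ws G \<zeta> (\<lambda>e. fst (\<beta> (emap (gmap \<eta>) e)) (s (fst e))))"
      unfolding dom by (rule word_product_Ind) (rule PiE_mem[OF \<beta> E])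
  qed
  also have "\<dots> = average (?E \<rightarrow>\<^sub>E carrier (sym_group n)) (\<lambda>\<sigma>. average ((?E \<times> {1..n}) \<rightarrow>\<^sub>E carrier G) (\<lambda>v. \<Sum>s \<in> secs \<sigma>.
      word_product F B ws G \<zeta> (\<lambda>e. v (emap (gmap \<eta>) e, s (fst e)))))"
    unfolding average_product[OF wreath_labellings_bij[OF G]]
  proof (intro average_cong)
    fix \<sigma> v assume "\<sigma> \<in> ?E \<rightarrow>\<^sub>E carrier (sym_group n)" "v \<in> (?E \<times> {1..n}) \<rightarrow>\<^sub>E carrier G"
    let ?\<beta> = "case (\<sigma>, v) of (\<sigma>, v) \<Rightarrow> \<lambda>e \<in> ?E. (\<lambda>i \<in> {1..n}. v (e, i), \<sigma> e)"
    have "secs (\<lambda>e. snd (?\<beta> e)) = secs \<sigma>"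
      using E by (simp add: sections_def is_section_def dom)
    moreover have "word_product F B ws G \<zeta> (\<lambda>e. fst (?\<beta> (emap (gmap \<eta>) e)) (s (fst e))) =
        word_product F B ws G \<zeta> (\<lambda>e. v (emap (gmap \<eta>) e, s (fst e)))" if s: "s \<in> secs \<sigma>" for s
    proof (rule word_product_cong)
      fix e assume e: "e \<in> gedges ?\<Gamma>"
      then have "fst e \<in> gverts ?\<Gamma>" using multi_core_graphD(3)[OF mcw] by auto
      then have "s (fst e) \<in> {1..n}" using s dom by (auto simp: sections_def)
      then show "fst (?\<beta> (emap (gmap \<eta>) e)) (s (fst e)) = v (emap (gmap \<eta>) e, s (fst e))"
        using E[OF e] by simp
    qed
    ultimately show "(\<Sum>s \<in> secs (\<lambda>e. snd (?\<beta> e)). word_product F B ws G \<zeta> (\<lambda>e. fst (?\<beta> (emap (gmap \<eta>) e)) (s (fst e))))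
      = (\<Sum>s \<in> secs \<sigma>. word_product F B ws G \<zeta> (\<lambda>e. v (emap (gmap \<eta>) e, s (fst e))))"
      by (intro sum.cong) auto
  qed
  also have "\<dots> = average (?E \<rightarrow>\<^sub>E carrier (sym_group n)) (\<lambda>\<sigma>. \<Sum>s \<in> secs \<sigma>.
      average ((?E \<times> {1..n}) \<rightarrow>\<^sub>E carrier G) (\<lambda>v. word_product F B ws G \<zeta> (\<lambda>e. v (emap (gmap \<eta>) e, s (fst e)))))"
    unfolding average_sum ..
  finally show ?thesis .
qed

lemma average_by_partition:
  assumes "\<eta>' \<in> Qset F B ws" "finite X" "c ` gedges (gdom \<eta>) \<subseteq> X"
    and "\<And>e e'. e \<in> gedges (gdom \<eta>) \<Longrightarrow> e' \<in> gedges (gdom \<eta>) \<Longrightarrow>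
      c e = c e' \<longleftrightarrow> emap (gmap \<eta>') e = emap (gmap \<eta>') e'"
  shows "average (X \<rightarrow>\<^sub>E carrier G) (\<lambda>v. word_product F B ws G \<zeta> (\<lambda>e. v (c e))) = expect_words F B ws G \<zeta> \<eta>'"
  unfolding expect_words_product[OF assms(1)]
proof (rule average_same_partition[where E = "gedges (gdom \<eta>)"])
  have s: "\<eta>' \<in> sur B" "gdom \<eta>' = gdom \<eta>" using assms(1) Qset_sur by auto
  show "finite (gedges (gcod \<eta>'))" using multi_core_graphD(2)[OF surD(2)[OF s(1)]] .
  show "emap (gmap \<eta>') ` gedges (gdom \<eta>) \<subseteq> gedges (gcod \<eta>')" using surD(4)[OF s(1)] s(2) by auto
  show "carrier G \<noteq> {}" using group.is_monoid[OF G] monoid.one_closed by blast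
  fix f g :: "vertex \<times> 'f \<times> vertex \<Rightarrow> 'g" assume "\<And>e. e \<in> gedges (gdom \<eta>) \<Longrightarrow> f e = g e"
  then show "word_product F B ws G \<zeta> f = word_product F B ws G \<zeta> g" unfolding dom by (rule word_product_cong)
qed (use assms fin in auto)

lemma emap_eq_iff_ker:
  assumes "\<eta>' \<in> Qset F B ws" "(u, b, v) \<in> gedges (gdom \<eta>)" "(u', b', v') \<in> gedges (gdom \<eta>)"
  shows "emap (gmap \<eta>') (u, b, v) = emap (gmap \<eta>') (u', b', v') \<longleftrightarrow> b = b' \<and> (u, u') \<in> mor_kernel \<eta>' \<and> (v, v') \<in> mor_kernel \<eta>'"
  using edge_ends[OF surD(1)[OF sur] assms(2)] edge_ends[OF surD(1)[OF sur] assms(3)] assms(1)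
  by (auto simp: mor_kernel_def Qset_sur)

lemma expect_words_ker:
  assumes q: "\<eta>1 \<in> Qset F B ws" "\<eta>2 \<in> Qset F B ws" and k: "mor_kernel \<eta>1 = mor_kernel \<eta>2"
  shows "expect_words F B ws G \<zeta> \<eta>1 = expect_words F B ws G \<zeta> \<eta>2"
proof -
  have s: "\<eta>1 \<in> sur B" "gdom \<eta>1 = gdom \<eta>" using q(1) Qset_sur by auto
  show ?thesis
    unfolding expect_words_product[OF q(1)]
  proof (rule average_by_partition[OF q(2)])
    show "finite (gedges (gcod \<eta>1))" using multi_core_graphD(2)[OF surD(2)[OF s(1)]] .
    show "emap (gmap \<eta>1) ` gedges (gdom \<eta>) \<subseteq> gedges (gcod \<eta>1)" using surD(4)[OF s(1)] s(2) by auto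
    fix e e' assume e: "e \<in> gedges (gdom \<eta>)" "e' \<in> gedges (gdom \<eta>)"
    obtain u b v u' b' v' where uv: "e = (u, b, v)" "e' = (u', b', v')" by (cases e, cases e')
    show "emap (gmap \<eta>1) e = emap (gmap \<eta>1) e' \<longleftrightarrow> emap (gmap \<eta>2) e = emap (gmap \<eta>2) e'"
      using emap_eq_iff_ker[OF q(1)] emap_eq_iff_ker[OF q(2)] e k unfolding uv by simp
  qed
qed

text \<open>The lift \<open>s\<close> sends the edge \<open>e\<close> to the edge over \<open>\<eta> e\<close> that starts in the sheet \<open>s (fst e)\<close>. Two
  edges have the same image exactly if \<open>\<eta>'\<close> identifies them.\<close>
lemma average_over_section:
  assumes \<sigma>: "\<And>e. e \<in> gedges (gcod \<eta>) \<Longrightarrow> \<sigma> e permutes {1..n}" and s: "s \<in> secs \<sigma>"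
    and q: "\<eta>' \<in> Qset F B ws" and k: "mor_kernel \<eta>' = joint_kernel \<eta> s"
  shows "average ((gedges (gcod \<eta>) \<times> {1..n}) \<rightarrow>\<^sub>E carrier G)
     (\<lambda>v. word_product F B ws G \<zeta> (\<lambda>e. v (emap (gmap \<eta>) e, s (fst e)))) = expect_words F B ws G \<zeta> \<eta>'"
proof (rule average_by_partition[OF q])
  note mc = surD(1)[OF sur]
  show "finite (gedges (gcod \<eta>) \<times> {1..n})" using multi_core_graphD(2)[OF surD(2)[OF sur]] by simp
  show "(\<lambda>e. (emap (gmap \<eta>) e, s (fst e))) ` gedges (gdom \<eta>) \<subseteq> gedges (gcod \<eta>) \<times> {1..n}"
  proof (rule image_subsetI)
    fix e assume e: "e \<in> gedges (gdom \<eta>)"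
    then have "fst e \<in> gverts (gdom \<eta>)" using multi_core_graphD(3)[OF mc] by auto
    then have "s (fst e) \<in> {1..n}" using s by (auto simp: sections_def)
    then show "(emap (gmap \<eta>) e, s (fst e)) \<in> gedges (gcod \<eta>) \<times> {1..n}" using surD(4)[OF sur] e by blast
  qed
  fix e e' assume e: "e \<in> gedges (gdom \<eta>)" "e' \<in> gedges (gdom \<eta>)"
  obtain u b v u' b' v' where uv: "e = (u, b, v)" "e' = (u', b', v')" by (cases e, cases e')
  show "(emap (gmap \<eta>) e, s (fst e)) = (emap (gmap \<eta>) e', s (fst e')) \<longleftrightarrow> emap (gmap \<eta>') e = emap (gmap \<eta>') e'"
  proof (cases "b = b'")
    case True
    have mor_kernel: "(x, y) \<in> mor_kernel \<eta>' \<longleftrightarrow> (gmap \<eta> x, s x) = (gmap \<eta> y, s y)"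
      if "x \<in> gverts (gdom \<eta>)" "y \<in> gverts (gdom \<eta>)" for x y
      using that by (simp add: k joint_kernel_def)
    note V = edge_ends[OF mc e(1)[unfolded uv]] edge_ends[OF mc e(2)[unfolded uv]]
    have "emap (gmap \<eta>') e = emap (gmap \<eta>') e' \<longleftrightarrow>
        (gmap \<eta> u, s u) = (gmap \<eta> u', s u') \<and> (gmap \<eta> v, s v) = (gmap \<eta> v', s v')"
      unfolding uv emap_eq_iff_ker[OF q e[unfolded uv]] mor_kernel[OF V(1,4)] mor_kernel[OF V(2,5)] using True by simp
    moreover have "(gmap \<eta> u, s u) = (gmap \<eta> u', s u') \<longleftrightarrow> (gmap \<eta> v, s v) = (gmap \<eta> v', s v')"
      by (rule section_edge_iff[OF sur \<sigma> s e(1)[unfolded uv] e(2)[unfolded uv True[symmetric]]])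
    ultimately show ?thesis unfolding uv emap_simp True prod.inject fst_conv by argo
  qed (simp add: uv)
qed

lemma induction_convolution:
  "expect_words F B ws (wreath G n) (\<lambda>j. Ind n (\<zeta> j)) \<eta> =
    convol B (convol B (expect_words F B ws G \<zeta>) (moebius B)) (expect_fix F n) \<eta>"
proof -
  let ?K = "kernels B (gdom \<eta>)" and ?A = "gedges (gcod \<eta>) \<rightarrow>\<^sub>E carrier (sym_group n)"
  have finK: "finite ?K" by (rule finite_kernels[OF surD(1)[OF sur]])
  (* As the expectation of \<zeta> depends on the kernel only, it is a function f on the poset of kernels;
     g is its convolution with the Moebius function. *)
  define f where "f S = expect_words F B ws G \<zeta> (SOME \<eta>'. \<eta>' \<in> Qset F B ws \<and> mor_kernel \<eta>' = S)" for S
  have f: "expect_words F B ws G \<zeta> \<eta>' = f (mor_kernel \<eta>')" if q: "\<eta>' \<in> Qset F B ws" for \<eta>'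
  proof -
    define \<theta> where "\<theta> = (SOME \<theta>. \<theta> \<in> Qset F B ws \<and> mor_kernel \<theta> = mor_kernel \<eta>')"
    have "\<theta> \<in> Qset F B ws \<and> mor_kernel \<theta> = mor_kernel \<eta>'" unfolding \<theta>_def by (rule someI[of _ \<eta>']) (use q in simp)
    then show ?thesis unfolding f_def \<theta>_def[symmetric] by (intro expect_words_ker[OF q]) simp_all
  qed
  define g where "g S = (\<Sum>R \<in> {R \<in> ?K. R \<subseteq> S}. f R * inclusion_moebius ?K R S)" for S
  have g: "convol B (expect_words F B ws G \<zeta>) (moebius B) \<eta>1 = g (mor_kernel \<eta>1)" if "\<eta>1 \<in> Qset F B ws" for \<eta>1
  proof -
    have s1: "\<eta>1 \<in> sur B" "gdom \<eta>1 = gdom \<eta>" using that Qset_sur by auto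
    show ?thesis
      unfolding g_def s1(2)[symmetric]
    proof (rule convol_by_kernels[OF s1(1)])
      fix \<theta>1 \<theta>2 assume p: "(\<theta>1, \<theta>2) \<in> decomp_pairs B \<eta>1"
      then have "\<theta>1 \<in> Qset F B ws" using decomp_pairsD[OF p] s1 Qset_sur by simp
      then show "expect_words F B ws G \<zeta> \<theta>1 * moebius B \<theta>2 = f (mor_kernel \<theta>1) * inclusion_moebius (kernels B (gdom \<eta>1)) (mor_kernel \<theta>1) (mor_kernel \<eta>1)"
        by (simp add: f moebius_eq_kernel_moebius kernel_moebius_decomp[OF p])
    qed
  qed
  have perm: "\<sigma> e permutes {1..n}" if "\<sigma> \<in> ?A" "e \<in> gedges (gcod \<eta>)" for \<sigma> e
    using PiE_mem[OF that] by simp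
  have fix2: "expect_fix F n \<eta>2 = average ?A (\<lambda>\<sigma>. \<Sum>s \<in> secs \<sigma>. if mor_kernel \<eta>1 \<subseteq> joint_kernel \<eta> s then 1 else 0)"
    if p: "(\<eta>1, \<eta>2) \<in> decomp_pairs B \<eta>" for \<eta>1 \<eta>2
  proof -
    have "(\<Sum>s \<in> secs \<sigma>. if mor_kernel \<eta>1 \<subseteq> joint_kernel \<eta> s then 1 else 0) =
        complex_of_nat (card {s \<in> secs \<sigma>. mor_kernel \<eta>1 \<subseteq> joint_kernel \<eta> s})" for \<sigma>
      using finite_sections[OF surD(1)[OF sur]] by (simp add: sum.If_cases Int_def)
    then show ?thesis
      using expect_fix_labellings[OF F decomp_pairsD(2)[OF p], of n] card_sections_decomp[OF p]
        decomp_pairsD(5)[OF p] by simp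
  qed
  have "convol B (convol B (expect_words F B ws G \<zeta>) (moebius B)) (expect_fix F n) \<eta> =
    (\<Sum>S \<in> {S \<in> ?K. S \<subseteq> mor_kernel \<eta>}. g S * average ?A (\<lambda>\<sigma>. \<Sum>s \<in> secs \<sigma>. if S \<subseteq> joint_kernel \<eta> s then 1 else 0))"
  proof (rule convol_by_kernels[OF sur])
    fix \<eta>1 \<eta>2 assume p: "(\<eta>1, \<eta>2) \<in> decomp_pairs B \<eta>"
    then have "\<eta>1 \<in> Qset F B ws" using decomp_pairsD[OF p] Qset_sur by simp
    then show "convol B (expect_words F B ws G \<zeta>) (moebius B) \<eta>1 * expect_fix F n \<eta>2 =
      g (mor_kernel \<eta>1) * average ?A (\<lambda>\<sigma>. \<Sum>s \<in> secs \<sigma>. if mor_kernel \<eta>1 \<subseteq> joint_kernel \<eta> s then 1 else 0)"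
      by (simp add: g fix2[OF p])
  qed
  also have "\<dots> = average ?A (\<lambda>\<sigma>. \<Sum>S \<in> {S \<in> ?K. S \<subseteq> mor_kernel \<eta>}. \<Sum>s \<in> secs \<sigma>. if S \<subseteq> joint_kernel \<eta> s then g S else 0)"
    unfolding average_sum
    by (intro sum.cong refl)
      (simp add: average_def sum_distrib_left if_distrib[of "\<lambda>x. g _ * x"] cong: if_cong)
  (* Moebius inversion, separately for each section. *)
  also have "\<dots> = average ?A (\<lambda>\<sigma>. \<Sum>s \<in> secs \<sigma>. f (joint_kernel \<eta> s))"
  proof (rule average_cong)
    fix \<sigma> assume \<sigma>: "\<sigma> \<in> ?A"
    have "(\<Sum>S \<in> {S \<in> ?K. S \<subseteq> mor_kernel \<eta>}. if S \<subseteq> joint_kernel \<eta> s then g S else 0) = f (joint_kernel \<eta> s)"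
      if s: "s \<in> secs \<sigma>" for s
    proof -
      have "joint_kernel \<eta> s \<subseteq> mor_kernel \<eta>" by (auto simp: joint_kernel_def mor_kernel_def)
      then have "{S \<in> {S \<in> ?K. S \<subseteq> mor_kernel \<eta>}. S \<subseteq> joint_kernel \<eta> s} = {S \<in> ?K. S \<subseteq> joint_kernel \<eta> s}" by auto
      then have "(\<Sum>S \<in> {S \<in> ?K. S \<subseteq> mor_kernel \<eta>}. if S \<subseteq> joint_kernel \<eta> s then g S else 0) =
          (\<Sum>S \<in> {S \<in> ?K. S \<subseteq> joint_kernel \<eta> s}. g S)"
        using finK by (simp flip: sum.inter_filter)
      also have "\<dots> = f (joint_kernel \<eta> s)"
        unfolding g_def by (rule inclusion_moebius_inversion[OF finK joint_kernel_in_kernels[OF sur perm[OF \<sigma>] s]])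
      finally show ?thesis .
    qed
    then show "(\<Sum>S \<in> {S \<in> ?K. S \<subseteq> mor_kernel \<eta>}. \<Sum>s \<in> secs \<sigma>. if S \<subseteq> joint_kernel \<eta> s then g S else 0) =
        (\<Sum>s \<in> secs \<sigma>. f (joint_kernel \<eta> s))"
      by (subst sum.swap) (rule sum.cong[OF refl])
  qed
  also have "\<dots> = expect_words F B ws (wreath G n) (\<lambda>j. Ind n (\<zeta> j)) \<eta>"
    unfolding expect_wreath
  proof (intro average_cong sum.cong refl)
    fix \<sigma> s assume \<sigma>: "\<sigma> \<in> ?A" and s: "s \<in> secs \<sigma>"
    obtain \<eta>' where q: "\<eta>' \<in> Qset F B ws" "mor_kernel \<eta>' = joint_kernel \<eta> s"
      using joint_kernel_in_kernels[OF sur perm[OF \<sigma>] s] by (auto simp: kernels_def Qset_sur)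
    show "f (joint_kernel \<eta> s) = average ((gedges (gcod \<eta>) \<times> {1..n}) \<rightarrow>\<^sub>E carrier G)
        (\<lambda>v. word_product F B ws G \<zeta> (\<lambda>e. v (emap (gmap \<eta>) e, s (fst e))))"
      using average_over_section[OF perm[OF \<sigma>] s q] f[OF q(1)] q(2) by simp
  qed
  finally show ?thesis ..
qed

end

theorem lemma5p1:
  fixes F :: "('f, 'm) monoid_scheme" and B :: "'f set" and r :: nat
    and G :: "('g, 'l) monoid_scheme"
    and ws :: "'f list" and \<zeta> :: "nat \<Rightarrow> 'g \<Rightarrow> complex" and n :: nat
  assumes "free_basis F B" and "finite B" and "card B = r"
    and "group G" and "finite (carrier G)"
    and "multi_word F ws"
    and "\<And>j. j < length ws \<Longrightarrow> class_function G (\<zeta> j)"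
    and "n \<ge> 1"
  shows "\<forall>\<eta> \<in> Qset F B ws.
    expect_words F B ws (wreath G n) (\<lambda>j. Ind n (\<zeta> j)) \<eta> =
    convol B (convol B (expect_words F B ws G \<zeta>) (moebius B)) (expect_fix F n) \<eta>"
proof
  fix \<eta> assume "\<eta> \<in> Qset F B ws"
  from induction_convolution[OF assms(1,6,4,5) _ this, of \<zeta> n] assms(7)
  show "expect_words F B ws (wreath G n) (\<lambda>j. Ind n (\<zeta> j)) \<eta> =
    convol B (convol B (expect_words F B ws G \<zeta>) (moebius B)) (expect_fix F n) \<eta>" by blast
qed

end
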